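(* Let $c\ge1$ be an integer and $\mu,\nu\in\mathbb R$ with $\mu\ne0$ and $\nu\neq 0$. Let $\Xi$ be the left $E^c_{\mu\nu}$–right $D^c_{\mu\nu}$ projective bimodule, and let $\mathfrak h$ be the Heisenberg Lie algebra with basis $\{X,Y,Z\}$, $[X,Y]=cZ$ and $Z$ central. Let $\nabla^0$ be the compatible connection on $\Xi$ given by $(\nabla^0_X\xi)(x,y)=-\frac{\partial\xi}{\partial y}(x,y)+\frac{\pi c i}{2\mu}x^2\xi(x,y)$, $(\nabla^0_Y\xi)(x,y)=-\frac{\partial\xi}{\partial x}(x,y)$, $(\nabla^0_Z\xi)(x,y)=\frac{\pi i x}{\mu}\xi(x,y)$, which has constant curvature $\Theta_{\nabla^0}(X,Y)=\Theta_{\nabla^0}(X,Z)=0$, $\Theta_{\nabla^0}(Y,Z)=\frac{\pi i}{\mu}\mathrm{Id}_E$. Let $\mathbb H$ be the linear map from $\mathfrak h$ to the set of skew-symmetric elements of $E^c_{\mu\nu}$ given by $$\mathbb H_X(x,y,p)=i\,g_1(y)\delta_0(p),\qquad \mathbb H_Y(x,y,p)=i\,g_2(x)\delta_0(p),\qquad \mathbb H_Z(x,y,p)=0,$$ where $(x,y)\in\mathbb R\times\mathbb T$ and $g_1,g_2$ are real-valued differentiable functions satisfying $g_1(y)=g_1(y-2p\nu)$ and $g_2(x)=g_2(x-2p\mu)$ for $p\in\mathbb Z$. Then: (a) The connection $\nabla=\nabla^0+\mathbb H$ is compatible with respect to $\langle\cdot,\cdot\rangle_R^D$ and has constant curvature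 given by $$\Theta_\nabla(X,Y)=0,\qquad\Theta_\nabla(X,Z)=0,\qquad\Theta_\nabla(Y,Z)=\frac{\pi i}{\mu}\mathrm{Id}_E,$$ where $\mathrm{Id}_E(x,y,p)=\delta_0(p)$. (b) The connection $\nabla=\nabla^0+\mathbb H$ is a Yang–Mills connection with constant curvature on $\Xi$ over $D^c_{\mu\nu}$.
   Context: Notation: $e(t)=\exp(2\pi i t)$, $\bar e(t)=\overline{e(t)}$, $\mathbb T=\mathbb R/\mathbb Z$, $M=\mathbb R\times\mathbb T$, $\delta_0(p)=1$ if $p=0$ and $0$ otherwise. Algebras. $\mathbb Z$ acts on $M$ by $\lambda_p(x,y)=(x+2p\mu,y+2p\nu)$ and $\sigma_p(x,y)=(x-p,y)$. In $C_b(M)\rtimes_\lambda\mathbb Z$: $(\Phi\ast\Psi)(x,y,p)=\sum_q\Phi(x,y,q)\Psi(x-2q\mu,y-2q\nu,p-q)$, $\Phi^*(x,y,p)=\overline{\Phi}(x-2p\mu,y-2p\nu,-p)$. In $C_b(M)\rtimes_\sigma\mathbb Z$: $(\Phi\ast\Psi)(x,y,p)=\sum_q\Phi(x,y,q)\Psi(x+q,y,p-q)$, $\Phi^*(x,y,p)=\overline\Phi(x+p,y,-p)$. The quantum Heisenberg manifold $D^c_{\mu\nu}$ is the closure, in the multiplier algebra of $C_b(M)\rtimes_\lambda\mathbb Z$, of the $*$-algebra $D_0$ of bounded continuous functions $\Phi$ on $M\times\mathbb Z$ with compact support in $\mathbb Z$ and $\bar e(ckp(y-p\nu))\Phi(x+k,y,p)=\Phi(x,y,p)$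 for all $k\in\mathbb Z$. $E^c_{\mu\nu}$ is the closure, in the multiplier algebra of $C_b(M)\rtimes_\sigma\mathbb Z$, of the $*$-algebra $E_0$ of bounded continuous functions $\Psi$ on $M\times\mathbb Z$ with compact support in $\mathbb Z$ and $e(cpk(y-k\nu))\Psi(x-2k\mu,y-2k\nu,p)=\Psi(x,y,p)$ for all $k\in\mathbb Z$. An element $\Psi$ is skew-symmetric if $\Psi^*=-\Psi$. Bimodule. $\Xi$ is the $E^c_{\mu\nu}$–$D^c_{\mu\nu}$ equivalence bimodule obtained by completing $C_c(\mathbb R\times\mathbb T)$ for $\langle f,g\rangle_R^D(x,y,p)=\sum_k\bar e(ckp(y-p\nu))f(x+k,y)\overline g(x-2p\mu+k,y-2p\nu)$, $\langle f,g\rangle_L^E(x,y,p)=\sum_k e(cpk(y-k\nu))\overline f(x-2k\mu,y-2k\nu)g(x-2k\mu+p,y-2k\nu)$, with actions $(\Psi\cdot f)(x,y)=\sum_q\overline\Psi(x,y,q)f(x+q,y)$ and $(g\cdot\Phi)(x,y)=\sum_q g(x+2q\mu,y+2q\nu)\overline\Phi(x+2q\mu,y+2q\nu,q)$. Derivations. $\mathfrak h$ acts on the smooth subalgebra of $D^c_{\mu\nu}$ by $\delta_X(\Phi)=2\pi i c p(x-p\mu)\Phi-\frac{\partial\Phi}{\partial y}$, $\delta_Y(\Phi)=-\frac{\partial\Phi}{\partial x}$, $\delta_Z(\Phi)=2\pi i p\,\Phi$ at $(x,y,p)$. By convention all algebras and modules are replaced by their smooth dense versions, with no change in notation. Connections.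 A linear connection on $\Xi$ is a linear map $\nabla:\Xi\to\Xi\otimes\mathfrak h^*$ with $\nabla_W(\xi\cdot\Phi)=\nabla_W(\xi)\cdot\Phi+\xi\cdot\delta_W(\Phi)$; it is compatible if $\delta_W(\langle\xi,\eta\rangle_R^D)=\langle\nabla_W\xi,\eta\rangle_R^D+\langle\xi,\nabla_W\eta\rangle_R^D$. $CC(\Xi)$ is the set of compatible connections. $(\nabla^0+\mathbb H)_W\xi=\nabla^0_W\xi+\mathbb H_W\cdot\xi$. The curvature is $\Theta_\nabla(W,W')=\nabla_W\nabla_{W'}-\nabla_{W'}\nabla_W-\nabla_{[W,W']}$; curvature operators are identified with the elements of $E^c_{\mu\nu}$ that induce them by the left action. The curvature is constant if all its values are scalar multiples of $\mathrm{Id}_E$. Yang–Mills functional. $\tau(\Phi)=\int_{\mathbb T^2}\Phi(x,y,0)\,dx\,dy$ on $D^c_{\mu\nu}$; the induced trace on $E^c_{\mu\nu}$ is $\tau_E(\langle\xi,\eta\rangle_L^E)=\tau(\langle\eta,\xi\rangle_R^D)$, which for $\mu>0$ is $\tau_E(\Psi)=\int_0^{2\mu}\int_0^1\Psi(x,y,0)\,dy\,dx$. $\mathrm{YM}(\nabla)=-\tau_E\big(\Theta_\nabla(X,Y)^2+\Theta_\nabla(X,Z)^2+\Theta_\nabla(Y,Z)^2\big)$. $\nabla\in CC(\Xi)$ is a critical point if the derivative of $t\mapsto\mathrm{YM}(\nabla+t\mathbb F)$ at $0$ vanishes for every linear map $\mathbb F$ from $\mathfrak h$ to the skew-symmetric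 elements of $E^c_{\mu\nu}$; by a known result this holds exactly when (1) $[\nabla_Y,\Theta_\nabla(X,Y)]+[\nabla_Z,\Theta_\nabla(X,Z)]=0$, (2) $[\nabla_X,\Theta_\nabla(Y,X)]+[\nabla_Z,\Theta_\nabla(Y,Z)]=0$, (3) $[\nabla_X,\Theta_\nabla(Z,X)]+[\nabla_Y,\Theta_\nabla(Z,Y)]-c\,\Theta_\nabla(X,Y)=0$. A Yang–Mills connection is a compatible connection that is both a critical point and a minimizer of $\mathrm{YM}$; for a Yang–Mills connection with constant curvature, "minimizer" is meant subject to the constant curvature constraint: $\mathrm{YM}(\nabla)\le\mathrm{YM}(\nabla')$ for every $\nabla'\in CC(\Xi)$ with constant curvature. *)

theory Defs
  imports "HOL-Analysis.Analysis" "HOL-Library.Complex_Order"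
begin

text \<open>
  A function on \<open>M = \<real> \<times> \<real>/\<int>\<close> is represented by a function on \<open>\<real> \<times> \<real>\<close> that is 1-periodic in the
  second variable, and an element of a crossed product of \<open>C\<^sub>b(M)\<close> by \<open>\<int>\<close> by its Fourier
  coefficients, i.e. by a function on \<open>M \<times> \<int>\<close>.
\<close>

type_synonym pt = "real \<times> real"
type_synonym alg = "pt \<Rightarrow> int \<Rightarrow> complex"
type_synonym vec = "pt \<Rightarrow> complex"

definition ee :: "real \<Rightarrow> complex" where
  "ee t = exp (2 * of_real pi * \<i> * of_real t)"

definition delta0 :: "int \<Rightarrow> complex" where
  "delta0 p = (if p = 0 then 1 else 0)"

definition periodic_T :: "(pt \<Rightarrow> 'a) \<Rightarrow> bool" where
  "periodic_T f \<longleftrightarrow> (\<forall>x y. f (x, y + 1) = f (x, y))"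


subsection \<open>Smooth functions and the smooth module\<close>

definition dx :: "vec \<Rightarrow> vec" where
  "dx f = (\<lambda>(x, y). vector_derivative (\<lambda>s. f (s, y)) (at x))"

definition dy :: "vec \<Rightarrow> vec" where
  "dy f = (\<lambda>(x, y). vector_derivative (\<lambda>s. f (x, s)) (at y))"

inductive_set partials :: "vec \<Rightarrow> vec set" for f where
  "f \<in> partials f"
| "g \<in> partials f \<Longrightarrow> dx g \<in> partials f"
| "g \<in> partials f \<Longrightarrow> dy g \<in> partials f"

definition smooth :: "vec \<Rightarrow> bool" where
  "smooth f \<longleftrightarrow> (\<forall>g\<in>partials f. continuous_on UNIV g \<and>
     (\<forall>x y. (\<lambda>s. g (s, y)) differentiable (at x) \<and> (\<lambda>s. g (x, s)) differentiable (at y)))"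

text \<open>
  The smooth version of the equivalence bimodule, as a space of functions: the Schwartz space of
  \<open>\<real> \<times> \<real>/\<int>\<close>. It does not depend on the parameters.
\<close>

definition Xi :: "vec set" where
  "Xi = {f. periodic_T f \<and> smooth f \<and>
     (\<forall>g\<in>partials f. \<forall>n. bounded (range (\<lambda>(x, y). of_real x ^ n * g (x, y))))}"


subsection \<open>Crossed products by the integers\<close>

definition lam :: "real \<Rightarrow> real \<Rightarrow> int \<Rightarrow> pt \<Rightarrow> pt" where
  "lam \<mu> \<nu> p = (\<lambda>(x, y). (x + 2 * real_of_int p * \<mu>, y + 2 * real_of_int p * \<nu>))"

definition sig :: "int \<Rightarrow> pt \<Rightarrow> pt" where
  "sig p = (\<lambda>(x, y). (x - real_of_int p, y))"

definition conv :: "(int \<Rightarrow> pt \<Rightarrow> pt) \<Rightarrow> alg \<Rightarrow> alg \<Rightarrow> alg" where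
  "conv \<alpha> \<Phi> \<Psi> = (\<lambda>m p. \<Sum>\<^sub>\<infinity>q. \<Phi> m q * \<Psi> (\<alpha> (- q) m) (p - q))"

definition star :: "(int \<Rightarrow> pt \<Rightarrow> pt) \<Rightarrow> alg \<Rightarrow> alg" where
  "star \<alpha> \<Phi> = (\<lambda>m p. cnj (\<Phi> (\<alpha> (- p) m) (- p)))"

text \<open>
  \<open>cp_norm_le \<alpha> \<Phi> C\<close> says that left convolution by \<open>\<Phi>\<close>, acting on \<open>\<ell>\<^sup>2\<close> of the discrete set of points
  \<open>(m, p)\<close>, has operator norm at most \<open>C\<close>. Multiplication by bounded functions is faithful on
  \<open>\<ell>\<^sup>2\<close>, so by Fell absorption this is the reduced crossed product norm, which is the full one
  because \<open>\<int>\<close> is amenable. The crossed product of the unital algebra \<open>C\<^sub>b(M)\<close> by the discrete group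
  \<open>\<int>\<close> is unital, hence equal to its multiplier algebra; a norm limit is determined by its Fourier
  coefficients, so closures may be taken among functions on \<open>M \<times> \<int>\<close>.
\<close>

definition cp_norm_le :: "(int \<Rightarrow> pt \<Rightarrow> pt) \<Rightarrow> alg \<Rightarrow> real \<Rightarrow> bool" where
  "cp_norm_le \<alpha> \<Phi> C \<longleftrightarrow> 0 \<le> C \<and>
     (\<forall>h S. finite {(m, p). h m p \<noteq> 0} \<longrightarrow> finite S \<longrightarrow>
        (\<Sum>(m, p)\<in>S. (norm (conv \<alpha> \<Phi> h m p))\<^sup>2)
          \<le> C\<^sup>2 * (\<Sum>(m, p)\<in>{(m, p). h m p \<noteq> 0}. (norm (h m p))\<^sup>2))"

definition cp_closure :: "(int \<Rightarrow> pt \<Rightarrow> pt) \<Rightarrow> alg set \<Rightarrow> alg set" where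
  "cp_closure \<alpha> A = {\<Phi>. \<forall>\<epsilon>>0. \<exists>\<Phi>0\<in>A. cp_norm_le \<alpha> (\<lambda>m p. \<Phi> m p - \<Phi>0 m p) \<epsilon>}"

definition Cb_finite_support :: "alg set" where
  "Cb_finite_support = {\<Phi>. (\<forall>p. periodic_T (\<lambda>m. \<Phi> m p) \<and> continuous_on UNIV (\<lambda>m. \<Phi> m p)) \<and>
     bounded (range (\<lambda>(m, p). \<Phi> m p)) \<and> finite {p. \<exists>m. \<Phi> m p \<noteq> 0}}"

definition D0 :: "int \<Rightarrow> real \<Rightarrow> real \<Rightarrow> alg set" where
  "D0 c \<mu> \<nu> = {\<Phi> \<in> Cb_finite_support. \<forall>(k::int) (x::real) (y::real) (p::int).
     cnj (ee (of_int (c * k * p) * (y - of_int p * \<nu>))) * \<Phi> (x + of_int k, y) p = \<Phi> (x, y) p}"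

definition E0 :: "int \<Rightarrow> real \<Rightarrow> real \<Rightarrow> alg set" where
  "E0 c \<mu> \<nu> = {\<Psi> \<in> Cb_finite_support. \<forall>(k::int) (x::real) (y::real) (p::int).
     ee (of_int (c * p * k) * (y - of_int k * \<nu>))
       * \<Psi> (x - 2 * of_int k * \<mu>, y - 2 * of_int k * \<nu>) p = \<Psi> (x, y) p}"

definition D_alg :: "int \<Rightarrow> real \<Rightarrow> real \<Rightarrow> alg set" where
  "D_alg c \<mu> \<nu> = cp_closure (lam \<mu> \<nu>) (D0 c \<mu> \<nu>)"

definition E_alg :: "int \<Rightarrow> real \<Rightarrow> real \<Rightarrow> alg set" where
  "E_alg c \<mu> \<nu> = cp_closure sig (E0 c \<mu> \<nu>)"


subsection \<open>The Heisenberg Lie algebra and its action\<close>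

text \<open>\<open>(a, b, d)\<close> stands for \<open>aX + bY + dZ\<close>.\<close>

type_synonym heis = "real \<times> real \<times> real"

definition X :: heis where "X = (1, 0, 0)"
definition Y :: heis where "Y = (0, 1, 0)"
definition Z :: heis where "Z = (0, 0, 1)"

fun bracket :: "int \<Rightarrow> heis \<Rightarrow> heis \<Rightarrow> heis" where
  "bracket c (a, b, d) (a', b', d') = (0, 0, of_int c * (a * b' - b * a'))"

definition delta_X :: "int \<Rightarrow> real \<Rightarrow> alg \<Rightarrow> alg" where
  "delta_X c \<mu> \<Phi> = (\<lambda>(x, y) p.
     2 * of_real pi * \<i> * of_int c * of_int p * of_real (x - of_int p * \<mu>) * \<Phi> (x, y) p
       - dy (\<lambda>m. \<Phi> m p) (x, y))"

definition delta_Y :: "alg \<Rightarrow> alg" where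
  "delta_Y \<Phi> = (\<lambda>m p. - dx (\<lambda>m. \<Phi> m p) m)"

definition delta_Z :: "alg \<Rightarrow> alg" where
  "delta_Z \<Phi> = (\<lambda>m p. 2 * of_real pi * \<i> * of_int p * \<Phi> m p)"

fun delta :: "int \<Rightarrow> real \<Rightarrow> heis \<Rightarrow> alg \<Rightarrow> alg" where
  "delta c \<mu> (a, b, d) \<Phi> = (\<lambda>m p.
     of_real a * delta_X c \<mu> \<Phi> m p + of_real b * delta_Y \<Phi> m p + of_real d * delta_Z \<Phi> m p)"

text \<open>
  The smooth subalgebra consists of the elements on which the Lie algebra can act arbitrarily often
  within the algebra.
\<close>

definition D_smooth :: "int \<Rightarrow> real \<Rightarrow> real \<Rightarrow> alg set" where
  "D_smooth c \<mu> \<nu> = {\<Phi>. (\<forall>p. smooth (\<lambda>m. \<Phi> m p)) \<and> (\<forall>Ws. fold (delta c \<mu>) Ws \<Phi> \<in> D_alg c \<mu> \<nu>)}"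


subsection \<open>The bimodule\<close>

definition ip_D :: "int \<Rightarrow> real \<Rightarrow> real \<Rightarrow> vec \<Rightarrow> vec \<Rightarrow> alg" where
  "ip_D c \<mu> \<nu> f g = (\<lambda>(x, y) p. \<Sum>\<^sub>\<infinity>k::int.
     cnj (ee (of_int (c * k * p) * (y - of_int p * \<nu>))) * f (x + of_int k, y)
       * cnj (g (x - 2 * of_int p * \<mu> + of_int k, y - 2 * of_int p * \<nu>)))"

definition ip_E :: "int \<Rightarrow> real \<Rightarrow> real \<Rightarrow> vec \<Rightarrow> vec \<Rightarrow> alg" where
  "ip_E c \<mu> \<nu> f g = (\<lambda>(x, y) p. \<Sum>\<^sub>\<infinity>k::int.
     ee (of_int (c * p * k) * (y - of_int k * \<nu>))
       * cnj (f (x - 2 * of_int k * \<mu>, y - 2 * of_int k * \<nu>))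
       * g (x - 2 * of_int k * \<mu> + of_int p, y - 2 * of_int k * \<nu>))"

text \<open>Both actions are conjugate-linear in the algebra element.\<close>

definition act_E :: "alg \<Rightarrow> vec \<Rightarrow> vec" where
  "act_E \<Psi> f = (\<lambda>(x, y). \<Sum>\<^sub>\<infinity>q::int. cnj (\<Psi> (x, y) q) * f (x + of_int q, y))"

definition act_D :: "real \<Rightarrow> real \<Rightarrow> vec \<Rightarrow> alg \<Rightarrow> vec" where
  "act_D \<mu> \<nu> g \<Phi> = (\<lambda>(x, y). \<Sum>\<^sub>\<infinity>q::int.
     g (x + 2 * of_int q * \<mu>, y + 2 * of_int q * \<nu>)
       * cnj (\<Phi> (x + 2 * of_int q * \<mu>, y + 2 * of_int q * \<nu>) q))"

text \<open>
  The smooth version of \<open>E\<close> consists of the elements that act on the smooth module, hence is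
  the endomorphism algebra of the latter over the smooth version of \<open>D\<close>.
\<close>

definition E_smooth :: "int \<Rightarrow> real \<Rightarrow> real \<Rightarrow> alg set" where
  "E_smooth c \<mu> \<nu> = {\<Psi> \<in> E_alg c \<mu> \<nu>. \<forall>\<xi>\<in>Xi. act_E \<Psi> \<xi> \<in> Xi}"

definition E_skew :: "int \<Rightarrow> real \<Rightarrow> real \<Rightarrow> alg set" where
  "E_skew c \<mu> \<nu> = {\<Psi> \<in> E_smooth c \<mu> \<nu>. star sig \<Psi> = (\<lambda>m p. - \<Psi> m p)}"

definition linear_into :: "alg set \<Rightarrow> (heis \<Rightarrow> alg) \<Rightarrow> bool" where
  "linear_into A H \<longleftrightarrow> (\<forall>W. H W \<in> A) \<and> (\<forall>m p. linear (\<lambda>W. H W m p))"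

definition Id_E :: alg where
  "Id_E = (\<lambda>m p. delta0 p)"


subsection \<open>Connections and curvature\<close>

type_synonym conn = "heis \<Rightarrow> vec \<Rightarrow> vec"

text \<open>Only the values of a connection on the smooth module matter.\<close>

definition connection :: "int \<Rightarrow> real \<Rightarrow> real \<Rightarrow> conn \<Rightarrow> bool" where
  "connection c \<mu> \<nu> nab \<longleftrightarrow>
     (\<forall>W. \<forall>\<xi>\<in>Xi. nab W \<xi> \<in> Xi) \<and>
     (\<forall>\<xi>\<in>Xi. \<forall>m. linear (\<lambda>W. nab W \<xi> m)) \<and>
     (\<forall>W. \<forall>\<xi>\<in>Xi. \<forall>\<eta>\<in>Xi. nab W (\<lambda>m. \<xi> m + \<eta> m) = (\<lambda>m. nab W \<xi> m + nab W \<eta> m)) \<and>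
     (\<forall>W. \<forall>\<xi>\<in>Xi. \<forall>a. nab W (\<lambda>m. a * \<xi> m) = (\<lambda>m. a * nab W \<xi> m)) \<and>
     (\<forall>W. \<forall>\<xi>\<in>Xi. \<forall>\<Phi>\<in>D_smooth c \<mu> \<nu>.
        nab W (act_D \<mu> \<nu> \<xi> \<Phi>) =
          (\<lambda>m. act_D \<mu> \<nu> (nab W \<xi>) \<Phi> m + act_D \<mu> \<nu> \<xi> (delta c \<mu> W \<Phi>) m))"

definition compatible_connection :: "int \<Rightarrow> real \<Rightarrow> real \<Rightarrow> conn \<Rightarrow> bool" where
  "compatible_connection c \<mu> \<nu> nab \<longleftrightarrow> connection c \<mu> \<nu> nab \<and>
     (\<forall>W. \<forall>\<xi>\<in>Xi. \<forall>\<eta>\<in>Xi. delta c \<mu> W (ip_D c \<mu> \<nu> \<xi> \<eta>) =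
        (\<lambda>m p. ip_D c \<mu> \<nu> (nab W \<xi>) \<eta> m p + ip_D c \<mu> \<nu> \<xi> (nab W \<eta>) m p))"

definition conn_add :: "conn \<Rightarrow> (heis \<Rightarrow> alg) \<Rightarrow> conn" where
  "conn_add nab H = (\<lambda>W \<xi> m. nab W \<xi> m + act_E (H W) \<xi> m)"

definition curvature_op :: "int \<Rightarrow> conn \<Rightarrow> heis \<Rightarrow> heis \<Rightarrow> vec \<Rightarrow> vec" where
  "curvature_op c nab W W' \<xi> =
     (\<lambda>m. nab W (nab W' \<xi>) m - nab W' (nab W \<xi>) m - nab (bracket c W W') \<xi> m)"

text \<open>
  The element of \<open>E\<close> inducing the curvature operator. As the left action is conjugate-linear, the
  operator of multiplication by a scalar \<open>a\<close> corresponds to \<open>cnj a\<close> times the identity of \<open>E\<close>.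
\<close>

definition curvature :: "int \<Rightarrow> real \<Rightarrow> real \<Rightarrow> conn \<Rightarrow> heis \<Rightarrow> heis \<Rightarrow> alg" where
  "curvature c \<mu> \<nu> nab W W' =
     (THE \<Psi>. \<Psi> \<in> E_smooth c \<mu> \<nu> \<and> (\<forall>\<xi>\<in>Xi. act_E \<Psi> \<xi> = curvature_op c nab W W' \<xi>))"

definition constant_curvature :: "int \<Rightarrow> real \<Rightarrow> real \<Rightarrow> conn \<Rightarrow> bool" where
  "constant_curvature c \<mu> \<nu> nab \<longleftrightarrow>
     (\<forall>W W'. \<exists>a. curvature c \<mu> \<nu> nab W W' = (\<lambda>m p. a * Id_E m p))"

definition nabla0 :: "int \<Rightarrow> real \<Rightarrow> conn" where
  "nabla0 c \<mu> = (\<lambda>(a, b, d) \<xi> (x, y).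
     of_real a * (- dy \<xi> (x, y) + of_real pi * of_int c * \<i> / (2 * of_real \<mu>) * (of_real x)\<^sup>2 * \<xi> (x, y))
     + of_real b * (- dx \<xi> (x, y))
     + of_real d * (of_real pi * \<i> * of_real x / of_real \<mu> * \<xi> (x, y)))"


subsection \<open>Traces and the Yang--Mills functional\<close>

definition trace_D :: "alg \<Rightarrow> complex" where
  "trace_D \<Phi> = integral (cbox (0, 0) (1, 1)) (\<lambda>m. \<Phi> m 0)"

text \<open>
  The trace induced by \<open>trace_D\<close>: it is additive and sends the left inner product of \<open>\<xi>\<close> and \<open>\<eta>\<close>
  to the trace of the right inner product of \<open>\<eta>\<close> and \<open>\<xi>\<close>; by fullness, each element of the smooth
  version of \<open>E\<close> is a finite sum of left inner products. Explicitly it is integration of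
  \<open>\<Psi>(\<cdot>, 0)\<close> over \<open>[0, 2\<bar>\<mu>\<bar>] \<times> [0, 1]\<close>.
\<close>

definition trace_E :: "int \<Rightarrow> real \<Rightarrow> real \<Rightarrow> alg \<Rightarrow> complex" where
  "trace_E c \<mu> \<nu> \<Psi> = (THE t. \<exists>xs. set xs \<subseteq> Xi \<times> Xi \<and>
     \<Psi> = (\<lambda>m p. \<Sum>(\<xi>, \<eta>)\<leftarrow>xs. ip_E c \<mu> \<nu> \<xi> \<eta> m p) \<and>
     t = (\<Sum>(\<xi>, \<eta>)\<leftarrow>xs. trace_D (ip_D c \<mu> \<nu> \<eta> \<xi>)))"

definition YM :: "int \<Rightarrow> real \<Rightarrow> real \<Rightarrow> conn \<Rightarrow> complex" where
  "YM c \<mu> \<nu> nab = (let \<Theta> = curvature c \<mu> \<nu> nab in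
     - trace_E c \<mu> \<nu> (\<lambda>m p. conv sig (\<Theta> X Y) (\<Theta> X Y) m p
         + conv sig (\<Theta> X Z) (\<Theta> X Z) m p + conv sig (\<Theta> Y Z) (\<Theta> Y Z) m p))"

definition YM_critical :: "int \<Rightarrow> real \<Rightarrow> real \<Rightarrow> conn \<Rightarrow> bool" where
  "YM_critical c \<mu> \<nu> nab \<longleftrightarrow> (\<forall>F. linear_into (E_skew c \<mu> \<nu>) F \<longrightarrow>
     ((\<lambda>t::real. YM c \<mu> \<nu> (conn_add nab (\<lambda>W m p. of_real t * F W m p))) has_vector_derivative 0) (at 0))"

text \<open>
  The minimum is taken subject to the constant curvature constraint. The order on \<open>complex\<close>
  compares real parts and requires equal imaginary parts; the values of \<open>YM\<close> at compatible
  connections are real.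
\<close>

definition YM_connection_constant_curvature :: "int \<Rightarrow> real \<Rightarrow> real \<Rightarrow> conn \<Rightarrow> bool" where
  "YM_connection_constant_curvature c \<mu> \<nu> nab \<longleftrightarrow>
     compatible_connection c \<mu> \<nu> nab \<and> constant_curvature c \<mu> \<nu> nab \<and> YM_critical c \<mu> \<nu> nab \<and>
     (\<forall>nab'. compatible_connection c \<mu> \<nu> nab' \<and> constant_curvature c \<mu> \<nu> nab' \<longrightarrow>
        YM c \<mu> \<nu> nab \<le> YM c \<mu> \<nu> nab')"

end

theory Submission
  imports Defs
begin

text \<open>
  Translates of smooth bump functions of small support give finitely many \<open>f\<^sub>i, g\<^sub>i\<close> in the module for which the
  left inner products of \<open>f\<^sub>i\<close> and \<open>g\<^sub>i\<close> sum to the identity. Hence every module operator \<open>T\<close> is the left action of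
  the sum of the left inner products of \<open>T f\<^sub>i\<close> and \<open>g\<^sub>i\<close>, and its trace is the sum of the integrals of
  \<open>cnj (T f\<^sub>i) * g\<^sub>i\<close>. A trace of this form kills the commutators of a compatible connection with module operators.

  The first variation of a curvature consists of such commutators and of the direction of the variation at a Lie
  bracket. As the curvature at \<open>\<nabla>\<close> is constant and vanishes on \<open>(X, Y)\<close>, the only pair with a nonzero bracket, \<open>\<nabla>\<close> is a
  critical point. Any other compatible connection differs from \<open>\<nabla>\<close> by a module operator, so a constant curvature has
  the same value on \<open>(Y, Z)\<close>; by compatibility its values on \<open>(X, Y)\<close> and \<open>(X, Z)\<close> are imaginary and can only
  increase the functional.
\<close>

text \<open>Curvatures and the induced trace are definite descriptions, so each needs existence and
  uniqueness. For curvatures these come from the frame and from faithfulness of the left action,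
  tested on functions that single out one point of a coset of the integers. For the trace, any way
  of writing an element as a sum of left inner products gives the same value, its integral over a
  fundamental domain of area 2|\<mu>|, because both inner products unfold to one integral over the
  cylinder.

  Elements of the closures are accessible only through bounded coefficients and a covariance
  relation. Convergence of the actions therefore rests on the decay of module elements, and
  arguments about an arbitrary compatible connection use the right algebra only through inner
  products, which are shown to be smooth.

  Commutators have trace zero for two reasons: a derivation of the right algebra integrates to zero,
  which makes a compatible connection skew for the scalar pairing, and the derivative of the frame
  identity vanishes.\<close>

subsection \<open>Series over the integers\<close>

text \<open>One weight dominates every series below: it is summable along any arithmetic
  progression, and a translation changes it by a bounded factor.\<close>

definition wt :: "real \<Rightarrow> real" where
  "wt x = 1 / (1 + x\<^sup>2)"

lemma wt_nonneg: "0 \<le> wt x" and wt_le_1: "wt x \<le> 1"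
proof -
  have "1 + x\<^sup>2 > 0" by (simp add: add_pos_nonneg)
  then show "0 \<le> wt x" "wt x \<le> 1" by (auto simp: wt_def)
qed

lemma wt_minus: "wt (- x) = wt x"
  by (simp add: wt_def)

lemma wt_0: "wt 0 = 1"
  by (simp add: wt_def)

text \<open>Peetre's inequality: the cost of a translation depends on the translation alone. It
  makes majorants locally uniform.\<close>

lemma wt_add_le: "wt (a + b) \<le> 2 * (1 + a\<^sup>2) * wt b"
proof -
  have "1 + b\<^sup>2 \<le> 2 * (1 + a\<^sup>2) * (1 + (a + b)\<^sup>2)"
  proof -
    \<comment> \<open>This square is exactly the gap in the next inequality.\<close>
    have "0 \<le> (2 * a + b)\<^sup>2" by simp
    then have "b\<^sup>2 \<le> 2 * a\<^sup>2 + 2 * (a + b)\<^sup>2"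
      by (simp add: power2_eq_square algebra_simps)
    moreover have "0 \<le> a\<^sup>2 * (a + b)\<^sup>2" by simp
    moreover have "2 * (1 + a\<^sup>2) * (1 + (a + b)\<^sup>2)
        = 2 + 2 * a\<^sup>2 + 2 * (a + b)\<^sup>2 + 2 * (a\<^sup>2 * (a + b)\<^sup>2)"
      by (simp add: algebra_simps)
    ultimately show ?thesis by linarith
  qed
  moreover have "1 + b\<^sup>2 > 0" "1 + (a + b)\<^sup>2 > 0" by (simp_all add: add_pos_nonneg)
  ultimately show ?thesis by (simp add: wt_def field_simps)
qed

text \<open>Two points at distance b cannot both be near the origin, so the product decays in b.
  This is the source of decay in the index p of the inner products.\<close>

lemma wt_mult_le: "wt a * wt (a + b) \<le> 2 * wt b"
proof -
  have *: "wt a \<le> 2 * (1 + (a + b)\<^sup>2) * wt b"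
    using wt_add_le[of "a + b" "- b"] by (simp add: wt_minus)
  have "1 + (a + b)\<^sup>2 > 0" by (simp add: add_pos_nonneg)
  then have **: "(1 + (a + b)\<^sup>2) * wt (a + b) = 1" by (simp add: wt_def)
  have "wt a * wt (a + b) \<le> 2 * (1 + (a + b)\<^sup>2) * wt b * wt (a + b)"
    using * wt_nonneg by (intro mult_right_mono) auto
  also have "2 * (1 + (a + b)\<^sup>2) * wt b * wt (a + b) = 2 * wt b * ((1 + (a + b)\<^sup>2) * wt (a + b))"
    by (simp only: mult_ac)
  finally show ?thesis using **  by simp
qed

lemma wt_scale_le: "L \<noteq> 0 \<Longrightarrow> wt (L * t) \<le> (1 + 1 / L\<^sup>2) * wt t"
proof -
  assume "L \<noteq> 0"
  then have "1 + t\<^sup>2 \<le> (1 + 1 / L\<^sup>2) * (1 + (L * t)\<^sup>2)"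
    by (simp add: algebra_simps power_mult_distrib)
  moreover have "1 + t\<^sup>2 > 0" "1 + (L * t)\<^sup>2 > 0" by (simp_all add: add_pos_nonneg)
  ultimately show ?thesis by (simp add: wt_def divide_simps mult.commute)
qed

lemma summable_wt_int: "(\<lambda>k::int. wt (of_int k)) summable_on UNIV"
proof -
  have nat: "(\<lambda>n::nat. wt (real n)) summable_on UNIV"
  proof (subst summable_on_UNIV_nonneg_real_iff)
    have "summable (\<lambda>n. 1 / (real (Suc n))\<^sup>2)"
      using sums_summable[OF inverse_squares_sums] by (simp add: add.commute)
    then have "summable (\<lambda>n. 1 / (real n)\<^sup>2)" by (rule summable_Suc_iff[THEN iffD1])
    then show "summable (\<lambda>n. wt (real n))"
    \<comment> \<open>The comparison is only eventual: at n = 0 the majorant is 1 / 0 = 0, while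
      \<open>wt 0\<close> is 1.\<close>
    proof (rule summable_comparison_test_ev[rotated])
      show "\<forall>\<^sub>F n in sequentially. norm (wt (real n)) \<le> 1 / (real n)\<^sup>2"
        using eventually_gt_at_top[of 0]
        by eventually_elim (auto simp: wt_def field_simps add_pos_nonneg)
    qed
  qed (simp add: wt_nonneg)
  have 1: "(\<lambda>k::int. wt (of_int k)) summable_on (int ` UNIV)"
    by (subst summable_on_reindex) (use nat in \<open>auto simp: o_def inj_on_def\<close>)
  have 2: "(\<lambda>k::int. wt (of_int k)) summable_on ((\<lambda>n. - int n) ` UNIV)"
    by (subst summable_on_reindex) (use nat in \<open>auto simp: o_def inj_on_def wt_minus\<close>)
  have "UNIV = int ` UNIV \<union> (\<lambda>n. - int n) ` UNIV"
  proof (intro equalityI subsetI)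
    fix k :: int
    show "k \<in> range int \<union> range (\<lambda>n. - int n)"
      by (cases k rule: int_cases2) auto
  qed auto
  then show ?thesis using summable_on_union[OF 1 2] by simp
qed

text \<open>The fractional part lies in [0, 1), so \<open>wt_add_le\<close> costs at most 2 (1 + 1)
  = 4. The integer part is left to a reindexing, hence bounds uniform in y.\<close>

lemma wt_shift_le: "wt (y + of_int k) \<le> 4 * wt (of_int (k + \<lfloor>y\<rfloor>))"
proof -
  have "wt (frac y + of_int (k + \<lfloor>y\<rfloor>)) \<le> 2 * (1 + (frac y)\<^sup>2) * wt (of_int (k + \<lfloor>y\<rfloor>))"
    by (rule wt_add_le)
  also have "\<dots> \<le> 4 * wt (of_int (k + \<lfloor>y\<rfloor>))"
  proof -
    have "(frac y)\<^sup>2 \<le> 1\<^sup>2" using frac_ge_0[of y] frac_lt_1[of y] by (intro power_mono) auto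
    then show ?thesis using wt_nonneg by (intro mult_right_mono) auto
  qed
  finally show ?thesis by (simp add: frac_def)
qed

definition wsum :: real where
  "wsum = (\<Sum>\<^sub>\<infinity>k::int. wt (of_int k))"

lemma wsum_nonneg: "wsum \<ge> 0"
  unfolding wsum_def by (intro infsum_nonneg) (simp add: wt_nonneg)

lemma bij_int_shift: "bij (\<lambda>k::int. k + a)"
  by (rule bij_betw_byWitness[where f' = "\<lambda>k. k - a"]) auto

lemma bij_int_minus: "bij (\<lambda>k::int. - k)"
  by (rule bij_betw_byWitness[where f' = "\<lambda>k. - k"]) auto

lemma infsum_int_shift: "(\<Sum>\<^sub>\<infinity>k::int. f (k + a)) = (\<Sum>\<^sub>\<infinity>k. f k)"
  using infsum_reindex_bij_betw[OF bij_int_shift[of a], of f] by simp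

lemma summable_int_shift: "(\<lambda>k::int. f (k + a)) summable_on UNIV \<longleftrightarrow> f summable_on UNIV"
  using summable_on_reindex_bij_betw[OF bij_int_shift[of a], of f] by simp

lemma infsum_int_minus: "(\<Sum>\<^sub>\<infinity>k::int. f (- k)) = (\<Sum>\<^sub>\<infinity>k. f k)"
  using infsum_reindex_bij_betw[OF bij_int_minus, of f] by simp

lemma summable_wt_shift: "(\<lambda>k::int. wt (y + of_int k)) summable_on UNIV"
  and infsum_wt_shift: "(\<Sum>\<^sub>\<infinity>k::int. wt (y + of_int k)) \<le> 4 * wsum"
proof -
  have s: "(\<lambda>k::int. 4 * wt (of_int (k + \<lfloor>y\<rfloor>))) summable_on UNIV"
    using summable_int_shift[of "\<lambda>k. wt (of_int k)" "\<lfloor>y\<rfloor>"] summable_wt_int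
    by (intro summable_on_cmult_right) simp
  show *: "(\<lambda>k::int. wt (y + of_int k)) summable_on UNIV"
    by (rule summable_on_comparison_test[OF s]) (use wt_shift_le wt_nonneg in auto)
  have "(\<Sum>\<^sub>\<infinity>k::int. wt (y + of_int k)) \<le> (\<Sum>\<^sub>\<infinity>k::int. 4 * wt (of_int (k + \<lfloor>y\<rfloor>)))"
    by (rule infsum_mono[OF * s]) (rule wt_shift_le)
  also have "\<dots> = 4 * wsum"
    using infsum_int_shift[of "\<lambda>k. wt (of_int k)" "\<lfloor>y\<rfloor>"]
    by (simp add: infsum_cmult_right' wsum_def)
  finally show "(\<Sum>\<^sub>\<infinity>k::int. wt (y + of_int k)) \<le> 4 * wsum" .
qed

text \<open>Rescaling reduces step L to step 1. The bound does not depend on the starting point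
  x.\<close>

lemma summable_wt_step: "L \<noteq> 0 \<Longrightarrow> (\<lambda>k::int. wt (x + of_int k * L)) summable_on UNIV"
  and infsum_wt_step:
    "L \<noteq> 0 \<Longrightarrow> (\<Sum>\<^sub>\<infinity>k::int. wt (x + of_int k * L)) \<le> (1 + 1 / L\<^sup>2) * (4 * wsum)"
proof -
  assume L: "L \<noteq> 0"
  have le: "wt (x + of_int k * L) \<le> (1 + 1 / L\<^sup>2) * wt (x / L + of_int k)" for k
    using wt_scale_le[OF L, of "x / L + of_int k"] L by (simp add: algebra_simps)
  have s: "(\<lambda>k::int. (1 + 1 / L\<^sup>2) * wt (x / L + of_int k)) summable_on UNIV"
    by (intro summable_on_cmult_right summable_wt_shift)
  show *: "(\<lambda>k::int. wt (x + of_int k * L)) summable_on UNIV"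
    by (rule summable_on_comparison_test[OF s]) (use le wt_nonneg in auto)
  have "(\<Sum>\<^sub>\<infinity>k::int. wt (x + of_int k * L)) \<le> (\<Sum>\<^sub>\<infinity>k::int. (1 + 1 / L\<^sup>2) * wt (x / L + of_int k))"
    by (rule infsum_mono[OF * s]) (rule le)
  also have "\<dots> \<le> (1 + 1 / L\<^sup>2) * (4 * wsum)"
    unfolding infsum_cmult_right' by (intro mult_left_mono infsum_wt_shift) auto
  finally show "(\<Sum>\<^sub>\<infinity>k::int. wt (x + of_int k * L)) \<le> (1 + 1 / L\<^sup>2) * (4 * wsum)" .
qed

lemma abs_summable_bounded:
  fixes f :: "'a \<Rightarrow> complex"
  assumes "M summable_on A" "\<And>k. k \<in> A \<Longrightarrow> norm (f k) \<le> M k"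
  shows "(\<lambda>k. norm (f k)) summable_on A"
  using summable_on_comparison_test[OF assms(1), of "\<lambda>k. norm (f k)"] assms(2) by simp

lemma summable_bounded:
  fixes f :: "'a \<Rightarrow> complex"
  assumes "M summable_on A" "\<And>k. k \<in> A \<Longrightarrow> norm (f k) \<le> M k"
  shows "f summable_on A"
  by (rule abs_summable_summable, rule abs_summable_bounded[OF assms])

lemma norm_infsum_bounded:
  fixes f :: "'a \<Rightarrow> complex"
  assumes "M summable_on A" "\<And>k. k \<in> A \<Longrightarrow> norm (f k) \<le> M k"
  shows "norm (infsum f A) \<le> infsum M A"
proof -
  have *: "(\<lambda>k. norm (f k)) summable_on A"
    using assms by (rule abs_summable_bounded)
  have "norm (infsum f A) \<le> (\<Sum>\<^sub>\<infinity>k\<in>A. norm (f k))"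
    by (rule norm_infsum_bound[OF *])
  also have "\<dots> \<le> infsum M A"
    by (rule infsum_mono[OF * assms(1)]) (rule assms(2))
  finally show ?thesis .
qed

lemma infsum_diff:
  fixes f g :: "'a \<Rightarrow> complex"
  assumes "f summable_on A" "g summable_on A"
  shows "(\<Sum>\<^sub>\<infinity>k\<in>A. f k - g k) = infsum f A - infsum g A"
  using infsum_add[OF assms(1), of "\<lambda>k. - g k"] summable_on_uminus[of g A] assms(2) by (simp add: infsum_uminus)

lemma continuous_on_infsum:
  fixes f :: "int \<Rightarrow> 'a::topological_space \<Rightarrow> complex"
  assumes "\<And>k. continuous_on S (f k)" "M summable_on UNIV"
    and "\<And>k s. s \<in> S \<Longrightarrow> norm (f k s) \<le> M k"
  shows "continuous_on S (\<lambda>s. \<Sum>\<^sub>\<infinity>k. f k s)"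
proof -
  have "uniform_limit S (\<lambda>X s. \<Sum>k\<in>X. f k s) (\<lambda>s. \<Sum>\<^sub>\<infinity>k. f k s) (finite_subsets_at_top UNIV)"
    by (rule Weierstrass_m_test_general[OF _ assms(2)]) (use assms in auto)
  then show ?thesis
    by (rule uniform_limit_theorem[rotated])
      (auto intro!: always_eventually continuous_on_sum assms)
qed

text \<open>Passes from unordered sums to series along an enumeration of the integers, so that the
  theorem on differentiating series term by term applies.\<close>

lemma suminf_int_decode:
  fixes f :: "int \<Rightarrow> complex"
  assumes "f summable_on UNIV"
  shows "(\<lambda>n. f (int_decode n)) sums (\<Sum>\<^sub>\<infinity>k. f k)"
proof -
  have "((\<lambda>n. f (int_decode n)) has_sum (\<Sum>\<^sub>\<infinity>k. f k)) UNIV"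
    using has_sum_reindex_bij_betw[OF bij_int_decode, of f] has_sum_infsum[OF assms] by simp
  then show ?thesis by (rule has_sum_imp_sums)
qed

text \<open>A single majorant controls the terms and their derivatives; the convex open set allows
  it to be only local.\<close>

lemma has_vector_derivative_infsum:
  fixes f f' :: "int \<Rightarrow> real \<Rightarrow> complex"
  assumes S: "open S" "convex S" "x \<in> S"
    and f': "\<And>k s. s \<in> S \<Longrightarrow> (f k has_vector_derivative f' k s) (at s)"
    and M: "M summable_on UNIV"
    and b: "\<And>k s. s \<in> S \<Longrightarrow> norm (f k s) \<le> M k"
    and b': "\<And>k s. s \<in> S \<Longrightarrow> norm (f' k s) \<le> M k"
  shows "((\<lambda>s. \<Sum>\<^sub>\<infinity>k. f k s) has_vector_derivative (\<Sum>\<^sub>\<infinity>k. f' k x)) (at x)"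
proof -
  let ?d = "int_decode"
  have sM: "summable (\<lambda>n. M (?d n))"
    using summable_on_reindex_bij_betw[OF bij_int_decode, of M] M
    by (intro summable_on_imp_summable) simp
  have sums: "(\<lambda>n. f (?d n) s) sums (\<Sum>\<^sub>\<infinity>k. f k s)" if "s \<in> S" for s
    by (rule suminf_int_decode, rule summable_bounded[OF M]) (use b that in auto)
  have sums': "(\<lambda>n. f' (?d n) s) sums (\<Sum>\<^sub>\<infinity>k. f' k s)" if "s \<in> S" for s
    by (rule suminf_int_decode, rule summable_bounded[OF M]) (use b' that in auto)
  have "uniform_limit S (\<lambda>n s. \<Sum>i<n. f' (?d i) s) (\<lambda>s. suminf (\<lambda>i. f' (?d i) s)) sequentially"
    by (rule Weierstrass_m_test[OF _ sM]) (use b' in auto)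
  then have ul: "\<forall>e>0. \<forall>\<^sub>F n in sequentially. \<forall>s\<in>S. norm ((\<Sum>i<n. f' (?d i) s) - (\<Sum>\<^sub>\<infinity>k. f' k s)) < e"
    unfolding uniform_limit_iff dist_norm using sums' by (simp add: sums_iff cong: ball_cong)
  have "\<exists>g. \<forall>s\<in>S. (\<lambda>n. f (?d n) s) sums g s \<and>
      (g has_derivative (\<lambda>h. h *\<^sub>R (\<Sum>\<^sub>\<infinity>k. f' k s))) (at s within S)"
  proof (rule has_derivative_series[where f' = "\<lambda>n s h. h *\<^sub>R f' (?d n) s", OF S(2)])
    show "(f (?d n) has_derivative (\<lambda>h. h *\<^sub>R f' (?d n) s)) (at s within S)" if "s \<in> S" for n s
      using f'[OF that] by (auto simp: has_vector_derivative_def intro: has_derivative_at_withinI)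
    show "\<forall>\<^sub>F n in sequentially. \<forall>s\<in>S. \<forall>h. norm ((\<Sum>i<n. h *\<^sub>R f' (?d i) s) - h *\<^sub>R (\<Sum>\<^sub>\<infinity>k. f' k s)) \<le> e * norm h"
      if "e > 0" for e
      using ul[rule_format, OF that]
    proof eventually_elim
      case (elim n)
      show ?case
      proof (intro ballI allI)
        fix s h assume "s \<in> S"
        have "norm ((\<Sum>i<n. h *\<^sub>R f' (?d i) s) - h *\<^sub>R (\<Sum>\<^sub>\<infinity>k. f' k s))
            = norm h * norm ((\<Sum>i<n. f' (?d i) s) - (\<Sum>\<^sub>\<infinity>k. f' k s))"
          by (simp add: scaleR_sum_right[symmetric] scaleR_diff_right[symmetric] del: scaleR_diff_right)
        also have "\<dots> \<le> norm h * e"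
          using elim \<open>s \<in> S\<close> by (intro mult_left_mono) (auto intro: less_imp_le)
        finally show "norm ((\<Sum>i<n. h *\<^sub>R f' (?d i) s) - h *\<^sub>R (\<Sum>\<^sub>\<infinity>k. f' k s)) \<le> e * norm h"
          by (simp add: mult.commute)
      qed
    qed
    show "x \<in> S" by (rule S)
    show "(\<lambda>n. f (?d n) x) sums (\<Sum>\<^sub>\<infinity>k. f k x)" by (rule sums[OF S(3)])
  qed
  then obtain g where g: "\<And>s. s \<in> S \<Longrightarrow> (\<lambda>n. f (?d n) s) sums g s"
      "\<And>s. s \<in> S \<Longrightarrow> (g has_derivative (\<lambda>h. h *\<^sub>R (\<Sum>\<^sub>\<infinity>k. f' k s))) (at s within S)"
    by blast
  have "(g has_vector_derivative (\<Sum>\<^sub>\<infinity>k. f' k x)) (at x)"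
    using g(2)[OF S(3)] at_within_open[OF S(3,1)] by (simp add: has_vector_derivative_def)
  moreover have "g s = (\<Sum>\<^sub>\<infinity>k. f k s)" if "s \<in> S" for s
    using g(1)[OF that] sums[OF that] by (rule sums_unique2)
  ultimately show ?thesis
    by (rule has_vector_derivative_transform_within_open[OF _ S(1,3)])
qed


subsection \<open>The Schwartz module\<close>

text \<open>Membership speaks about all iterated partial derivatives. It suffices to find a set
  closed under both derivatives whose members satisfy the conditions of order zero.\<close>

lemma Xi_coinduct:
  assumes "f \<in> S"
    and "\<And>f. f \<in> S \<Longrightarrow> periodic_T f"
    and "\<And>f. f \<in> S \<Longrightarrow> continuous_on UNIV f"
    and "\<And>f x y. f \<in> S \<Longrightarrow> (\<lambda>s. f (s, y)) differentiable (at x)"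
    and "\<And>f x y. f \<in> S \<Longrightarrow> (\<lambda>s. f (x, s)) differentiable (at y)"
    and "\<And>f n. f \<in> S \<Longrightarrow> bounded (range (\<lambda>(x, y). of_real x ^ n * f (x, y)))"
    and "\<And>f. f \<in> S \<Longrightarrow> dx f \<in> S"
    and "\<And>f. f \<in> S \<Longrightarrow> dy f \<in> S"
  shows "f \<in> Xi"
proof -
  have "g \<in> S" if "g \<in> partials f" for g
    using that by induction (use assms in auto)
  then show ?thesis unfolding Xi_def smooth_def using assms by blast
qed

lemma smooth_coinduct:
  assumes "f \<in> S"
    and "\<And>f. f \<in> S \<Longrightarrow> continuous_on UNIV f"
    and "\<And>f x y. f \<in> S \<Longrightarrow> (\<lambda>s. f (s, y)) differentiable (at x)"
    and "\<And>f x y. f \<in> S \<Longrightarrow> (\<lambda>s. f (x, s)) differentiable (at y)"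
    and "\<And>f. f \<in> S \<Longrightarrow> dx f \<in> S"
    and "\<And>f. f \<in> S \<Longrightarrow> dy f \<in> S"
  shows "smooth f"
proof -
  have "g \<in> S" if "g \<in> partials f" for g
    using that by induction (use assms in auto)
  then show ?thesis unfolding smooth_def using assms by blast
qed

lemma partials_trans: "h \<in> partials g \<Longrightarrow> g \<in> partials f \<Longrightarrow> h \<in> partials f"
  by (induction rule: partials.induct) (auto intro: partials.intros)

lemma smooth_continuous: "smooth f \<Longrightarrow> continuous_on UNIV f"
  and smooth_differentiable_x: "smooth f \<Longrightarrow> (\<lambda>s. f (s, y)) differentiable (at x)"
  and smooth_differentiable_y: "smooth f \<Longrightarrow> (\<lambda>s. f (x, s)) differentiable (at y)"
  unfolding smooth_def using partials.intros(1) by blast+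

lemma smooth_dx: "smooth f \<Longrightarrow> smooth (dx f)"
  and smooth_dy: "smooth f \<Longrightarrow> smooth (dy f)"
  unfolding smooth_def using partials_trans partials.intros by blast+

lemma has_dx: "(\<lambda>s. f (s, y)) differentiable (at x) \<Longrightarrow>
    ((\<lambda>s. f (s, y)) has_vector_derivative dx f (x, y)) (at x)"
  by (simp add: dx_def vector_derivative_works[symmetric])

lemma has_dy: "(\<lambda>s. f (x, s)) differentiable (at y) \<Longrightarrow>
    ((\<lambda>s. f (x, s)) has_vector_derivative dy f (x, y)) (at y)"
  by (simp add: dy_def vector_derivative_works[symmetric])

lemma dx_eqI:
  assumes "\<And>x y. ((\<lambda>s. f (s, y)) has_vector_derivative g (x, y)) (at x)"
  shows "dx f = g"
  using assms by (auto simp: dx_def fun_eq_iff vector_derivative_at)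

lemma dy_eqI:
  assumes "\<And>x y. ((\<lambda>s. f (x, s)) has_vector_derivative g (x, y)) (at y)"
  shows "dy f = g"
  using assms by (auto simp: dy_def fun_eq_iff vector_derivative_at)

lemma Xi_smooth: "f \<in> Xi \<Longrightarrow> smooth f"
  and Xi_periodic: "f \<in> Xi \<Longrightarrow> f (x, y + 1) = f (x, y)"
  and Xi_decay: "f \<in> Xi \<Longrightarrow> bounded (range (\<lambda>(x, y). of_real x ^ n * f (x, y)))"
  unfolding Xi_def periodic_T_def using partials.intros(1) by blast+

lemma Xi_continuous: "f \<in> Xi \<Longrightarrow> continuous_on UNIV f"
  by (simp add: Xi_smooth smooth_continuous)

lemma Xi_has_dx: "f \<in> Xi \<Longrightarrow> ((\<lambda>s. f (s, y)) has_vector_derivative dx f (x, y)) (at x)"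
  by (intro has_dx smooth_differentiable_x Xi_smooth)

lemma Xi_has_dy: "f \<in> Xi \<Longrightarrow> ((\<lambda>s. f (x, s)) has_vector_derivative dy f (x, y)) (at y)"
  by (intro has_dy smooth_differentiable_y Xi_smooth)

lemma periodic_dx: "periodic_T f \<Longrightarrow> periodic_T (dx f)"
  by (simp add: periodic_T_def dx_def)

lemma periodic_dy:
  assumes "periodic_T f" "smooth f" shows "periodic_T (dy f)"
  unfolding periodic_T_def
proof (intro allI)
  fix x y
  have "((\<lambda>s. f (x, s)) has_vector_derivative dy f (x, y + 1)) (at (y + 1))"
    by (intro has_dy smooth_differentiable_y assms)
  then have "((\<lambda>s. f (x, s)) \<circ> (\<lambda>s. s + 1) has_vector_derivative (1::real) *\<^sub>R dy f (x, y + 1)) (at y)"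
    by (intro vector_diff_chain_at) (auto intro!: derivative_eq_intros)
  moreover have "(\<lambda>s. f (x, s)) \<circ> (\<lambda>s. s + 1) = (\<lambda>s. f (x, s))"
    using assms(1) by (auto simp: periodic_T_def)
  ultimately show "dy f (x, y + 1) = dy f (x, y)"
    using has_dy[OF smooth_differentiable_y[OF assms(2)]] by (auto dest: vector_derivative_unique_at)
qed

lemma Xi_dx: "f \<in> Xi \<Longrightarrow> dx f \<in> Xi"
  unfolding Xi_def using partials_trans partials.intros periodic_dx smooth_dx by blast

lemma Xi_dy: "f \<in> Xi \<Longrightarrow> dy f \<in> Xi"
  unfolding Xi_def using partials_trans partials.intros periodic_dy smooth_dy by blast

lemma Xi_add: "f \<in> Xi \<Longrightarrow> g \<in> Xi \<Longrightarrow> (\<lambda>m. f m + g m) \<in> Xi"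
proof (rule Xi_coinduct[where S = "{\<lambda>m. f m + g m | f g. f \<in> Xi \<and> g \<in> Xi}"], goal_cases)
  case (2 h)
  then show ?case by (auto simp: periodic_T_def Xi_periodic)
next
  case (3 h)
  then show ?case by (auto intro!: continuous_intros simp: Xi_continuous)
next
  case (4 h x y)
  then show ?case
    by (auto intro!: derivative_intros simp: smooth_differentiable_x Xi_smooth)
next
  case (5 h x y)
  then show ?case
    by (auto intro!: derivative_intros simp: smooth_differentiable_y Xi_smooth)
next
  case (6 h n)
  then obtain f g where h: "h = (\<lambda>m. f m + g m)" "f \<in> Xi" "g \<in> Xi" by blast
  show ?case
    using bounded_plus_comp[OF Xi_decay[OF h(2), of n] Xi_decay[OF h(3), of n]]
    by (simp add: h(1) case_prod_unfold distrib_left)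
next
  case (7 h)
  then obtain f g where h: "h = (\<lambda>m. f m + g m)" "f \<in> Xi" "g \<in> Xi" by blast
  have "dx h = (\<lambda>m. dx f m + dx g m)"
    by (rule dx_eqI) (use h in \<open>auto intro!: derivative_intros simp: Xi_has_dx\<close>)
  then show ?case using h Xi_dx by blast
next
  case (8 h)
  then obtain f g where h: "h = (\<lambda>m. f m + g m)" "f \<in> Xi" "g \<in> Xi" by blast
  have "dy h = (\<lambda>m. dy f m + dy g m)"
    by (rule dy_eqI) (use h in \<open>auto intro!: derivative_intros simp: Xi_has_dy\<close>)
  then show ?case using h Xi_dy by blast
qed auto

lemma Xi_cmult: "f \<in> Xi \<Longrightarrow> (\<lambda>m. a * f m) \<in> Xi"
proof (rule Xi_coinduct[where S = "{\<lambda>m. a * f m | f. f \<in> Xi}"], goal_cases)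
  case (2 h)
  then show ?case by (auto simp: periodic_T_def Xi_periodic)
next
  case (3 h)
  then show ?case by (auto intro!: continuous_intros simp: Xi_continuous)
next
  case (4 h x y)
  then show ?case
    by (auto intro!: derivative_intros simp: smooth_differentiable_x Xi_smooth)
next
  case (5 h x y)
  then show ?case
    by (auto intro!: derivative_intros simp: smooth_differentiable_y Xi_smooth)
next
  case (6 h n)
  then obtain f where h: "h = (\<lambda>m. a * f m)" "f \<in> Xi" by blast
  show ?case
    using bounded_linear_image[OF Xi_decay[OF h(2), of n] bounded_linear_mult_right[of a]]
    by (simp add: h(1) case_prod_unfold image_image mult_ac)
next
  case (7 h)
  then obtain f where h: "h = (\<lambda>m. a * f m)" "f \<in> Xi" by blast
  have "dx h = (\<lambda>m. a * dx f m)"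
    by (rule dx_eqI) (use h in \<open>auto intro!: derivative_intros simp: Xi_has_dx\<close>)
  then show ?case using h Xi_dx by blast
next
  case (8 h)
  then obtain f where h: "h = (\<lambda>m. a * f m)" "f \<in> Xi" by blast
  have "dy h = (\<lambda>m. a * dy f m)"
    by (rule dy_eqI) (use h in \<open>auto intro!: derivative_intros simp: Xi_has_dy\<close>)
  then show ?case using h Xi_dy by blast
qed auto

lemma Xi_0: "(\<lambda>m. 0) \<in> Xi"
proof (rule Xi_coinduct[where S = "{\<lambda>m. 0}"], goal_cases)
  case (7 f)
  then show ?case using dx_eqI[of "\<lambda>m. 0" "\<lambda>m. 0"] by auto
next
  case (8 f)
  then show ?case using dy_eqI[of "\<lambda>m. 0" "\<lambda>m. 0"] by auto
next
  case (6 f n)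
  then have "range (\<lambda>(x, y). complex_of_real x ^ n * f (x, y)) \<subseteq> {0}" by auto
  then show ?case by (rule bounded_subset[rotated]) simp
qed (auto simp: periodic_T_def)

lemma Xi_sum: "(\<And>i. i \<in> A \<Longrightarrow> f i \<in> Xi) \<Longrightarrow> (\<lambda>m. \<Sum>i\<in>A. f i m) \<in> Xi"
  by (induction A rule: infinite_finite_induct) (auto intro: Xi_0 Xi_add)

lemma Xi_uminus: "f \<in> Xi \<Longrightarrow> (\<lambda>m. - f m) \<in> Xi"
  using Xi_cmult[of f "-1"] by simp

lemma Xi_diff: "f \<in> Xi \<Longrightarrow> g \<in> Xi \<Longrightarrow> (\<lambda>m. f m - g m) \<in> Xi"
  using Xi_add[OF _ Xi_uminus] by simp

text \<open>The derivative of x f is x f' + f, so the invariant set must contain an extra summand g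
  besides the product.\<close>

lemma Xi_xmult: "f \<in> Xi \<Longrightarrow> (\<lambda>m. of_real (fst m) * f m) \<in> Xi"
proof (rule Xi_coinduct[where S = "{\<lambda>m. of_real (fst m) * f m + g m | f g. f \<in> Xi \<and> g \<in> Xi}"], goal_cases)
  case 1
  then show ?case using Xi_0 by force
next
  case (2 h)
  then show ?case by (auto simp: periodic_T_def Xi_periodic)
next
  case (3 h)
  then show ?case by (auto intro!: continuous_intros simp: Xi_continuous)
next
  case (4 h x y)
  then show ?case
    by (auto intro!: derivative_intros simp: smooth_differentiable_x Xi_smooth)
next
  case (5 h x y)
  then show ?case
    by (auto intro!: derivative_intros simp: smooth_differentiable_y Xi_smooth)
next
  case (6 h n)
  then obtain f g where h: "h = (\<lambda>m. of_real (fst m) * f m + g m)" "f \<in> Xi" "g \<in> Xi" by blast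
  show ?case
    using bounded_plus_comp[OF Xi_decay[OF h(2), of "Suc n"] Xi_decay[OF h(3), of n]]
    by (simp add: h(1) case_prod_unfold distrib_left mult_ac)
next
  case (7 h)
  then obtain f g where h: "h = (\<lambda>m. of_real (fst m) * f m + g m)" "f \<in> Xi" "g \<in> Xi" by blast
  have "dx h = (\<lambda>m. of_real (fst m) * dx f m + (f m + dx g m))"
    by (rule dx_eqI)
      (use h in \<open>auto intro!: has_vector_derivative_eq_rhs[OF has_vector_derivative_add[OF has_vector_derivative_mult[OF
        has_vector_derivative_of_real[OF DERIV_ident]]]] simp: Xi_has_dx\<close>)
  then show ?case using Xi_dx[OF h(2)] Xi_add[OF h(2) Xi_dx[OF h(3)]]
    by (intro CollectI exI[of _ "dx f"] exI[of _ "\<lambda>m. f m + dx g m"]) simp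
next
  case (8 h)
  then obtain f g where h: "h = (\<lambda>m. of_real (fst m) * f m + g m)" "f \<in> Xi" "g \<in> Xi" by blast
  have "dy h = (\<lambda>m. of_real (fst m) * dy f m + dy g m)"
    by (rule dy_eqI) (use h in \<open>auto intro!: derivative_intros simp: Xi_has_dy\<close>)
  then show ?case using h Xi_dy by blast
qed

text \<open>Each further power of the weight is gained by applying the bound to (1 + x^2) f, which
  is again in \<open>Xi\<close>.\<close>

lemma Xi_bound_pow: "f \<in> Xi \<Longrightarrow> \<exists>C\<ge>0. \<forall>x y. norm (f (x, y)) \<le> C * wt x ^ n"
proof (induction n arbitrary: f)
  case 0
  obtain C where C: "\<And>z. z \<in> range (\<lambda>(x, y). of_real x ^ 0 * f (x, y)) \<Longrightarrow> norm z \<le> C"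
    using Xi_decay[OF 0, of 0] unfolding bounded_iff by blast
  have "norm (f (x, y)) \<le> C" for x y
    by (rule C, rule image_eqI[of _ _ "(x, y)"]) auto
  then show ?case by (intro exI[of _ C]) (auto intro: order_trans[OF norm_ge_zero])
next
  case (Suc n)
  let ?g = "\<lambda>m. f m + of_real (fst m) * (of_real (fst m) * f m)"
  have "?g \<in> Xi" by (intro Xi_add Xi_xmult Suc.prems)
  from Suc.IH[OF this] obtain C where C: "C \<ge> 0" "\<And>x y. norm (?g (x, y)) \<le> C * wt x ^ n" by blast
  have "norm (f (x, y)) \<le> C * wt x ^ Suc n" for x y
  proof -
    have p: "1 + x\<^sup>2 > 0" by (simp add: add_pos_nonneg)
    have "?g (x, y) = of_real (1 + x\<^sup>2) * f (x, y)" by (simp add: power2_eq_square algebra_simps)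
    then have "norm (?g (x, y)) = (1 + x\<^sup>2) * norm (f (x, y))"
      using p by (simp only: norm_mult norm_of_real abs_of_pos)
    then have "(1 + x\<^sup>2) * norm (f (x, y)) \<le> C * wt x ^ n" using C(2)[of x y] by simp
    then have "norm (f (x, y)) \<le> C * wt x ^ n / (1 + x\<^sup>2)" using p by (simp add: field_simps)
    then show ?thesis by (simp add: wt_def field_simps)
  qed
  with C(1) show ?case by blast
qed

lemma Xi_bound: "f \<in> Xi \<Longrightarrow> \<exists>C\<ge>0. \<forall>x y. norm (f (x, y)) \<le> C * wt x"
  using Xi_bound_pow[of f 1] by simp


subsection \<open>Crossed products\<close>

lemma norm_ee [simp]: "norm (ee t) = 1"
proof -
  have "ee t = exp (\<i> * of_real (2 * pi * t))" by (simp add: ee_def mult_ac)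
  then show ?thesis by (simp only: norm_exp_i_times)
qed

lemma ee_add: "ee (a + b) = ee a * ee b"
  by (simp add: ee_def distrib_left exp_add)

lemma ee_0 [simp]: "ee 0 = 1"
  by (simp add: ee_def)

lemma ee_of_int [simp]: "ee (of_int n) = 1"
proof -
  have "ee (of_int n) = exp (2 * of_real pi * \<i> * of_int n)" by (simp add: ee_def)
  also have "\<dots> = 1" by (simp add: exp_eq_1)
  finally show ?thesis .
qed

lemma cnj_ee: "cnj (ee t) = ee (- t)"
  by (simp add: ee_def exp_cnj)

lemma ee_cancel [simp]: "ee t * cnj (ee t) = 1" "cnj (ee t) * ee t = 1"
  by (simp_all add: cnj_ee ee_add[symmetric])

lemma continuous_on_ee [continuous_intros]:
  "continuous_on S f \<Longrightarrow> continuous_on S (\<lambda>x. ee (f x))"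
  unfolding ee_def by (intro continuous_intros)

lemma ee_has_vector_derivative:
  "((\<lambda>y. ee (a * (y - b))) has_vector_derivative 2 * of_real pi * \<i> * of_real a * ee (a * (y - b))) (at y)"
proof -
  have "((\<lambda>z. exp (2 * of_real pi * \<i> * (of_real a * (z - of_real b)))) has_field_derivative
      exp (2 * of_real pi * \<i> * (of_real a * (of_real y - of_real b))) * (2 * of_real pi * \<i> * of_real a))
      (at (of_real y :: complex))"
    by (auto intro!: derivative_eq_intros)
  from has_vector_derivative_real_field[OF this, of UNIV] show ?thesis
    by (simp add: ee_def mult_ac)
qed

text \<open>The operator norm dominates the sup norm of the coefficients, so closures consist of
  uniform limits.\<close>

lemma cp_norm_le_coeff:
  assumes "cp_norm_le \<alpha> \<Phi> C" shows "norm (\<Phi> m p) \<le> C"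
proof -
  \<comment> \<open>The point mass whose convolution with \<Phi> takes the value
    \<open>\<Phi> m p\<close> at (m, p): only q = p contributes.\<close>
  let ?h = "\<lambda>m' p'. if m' = \<alpha> (- p) m \<and> p' = (0::int) then (1::complex) else 0"
  have supp: "{(m', p'). ?h m' p' \<noteq> 0} = {(\<alpha> (- p) m, 0)}" by auto
  have "conv \<alpha> \<Phi> ?h m p = (\<Sum>\<^sub>\<infinity>q\<in>{p}. \<Phi> m q * ?h (\<alpha> (- q) m) (p - q))"
    unfolding conv_def by (rule infsum_cong_neutral) auto
  then have conv: "conv \<alpha> \<Phi> ?h m p = \<Phi> m p" by simp
  have fin: "finite {(m', p'). ?h m' p' \<noteq> 0}" unfolding supp by simp
  have "(\<Sum>(m, p)\<in>{(m, p)}. (norm (conv \<alpha> \<Phi> ?h m p))\<^sup>2)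
      \<le> C\<^sup>2 * (\<Sum>(m, p)\<in>{(m', p'). ?h m' p' \<noteq> 0}. (norm (?h m p))\<^sup>2)"
    using assms[unfolded cp_norm_le_def, THEN conjunct2, rule_format, OF fin, of "{(m, p)}"] by simp
  then have "(norm (\<Phi> m p))\<^sup>2 \<le> C\<^sup>2" unfolding supp using conv by simp
  then show ?thesis by (rule power2_le_imp_le[OF _ assms[unfolded cp_norm_le_def, THEN conjunct1]])
qed

text \<open>The l1 norm dominates the operator norm, as in Young's inequality. Injectivity of each
  \<alpha> q makes the shifts contractive on l2.\<close>

lemma cp_norm_leI:
  assumes inj: "\<And>q. inj (\<alpha> q)" and a: "a summable_on UNIV"
    and le: "\<And>m p. norm (\<Phi> m p) \<le> a p"
  shows "cp_norm_le \<alpha> \<Phi> (infsum a UNIV)"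
  unfolding cp_norm_le_def
proof (intro conjI allI impI)
  have a0: "0 \<le> a p" for p using le[of undefined p] norm_ge_zero order_trans by blast
  show A0: "0 \<le> infsum a UNIV" by (rule infsum_nonneg) (rule a0)
  fix h :: alg and S :: "(pt \<times> int) set"
  define F where "F = {(m, p). h m p \<noteq> 0}"
  assume "finite {(m, p). h m p \<noteq> 0}" and S: "finite S"
  then have F: "finite F" by (simp add: F_def)
  \<comment> \<open>Outside Q every summand vanishes at the points of S, so the convolution is a
    finite sum there.\<close>
  define Q where "Q = (\<lambda>(s, t). snd s - snd t) ` (S \<times> F)"
  have Q: "finite Q" unfolding Q_def using S F by simp
  define N where "N = (\<Sum>s\<in>F. (norm (h (fst s) (snd s)))\<^sup>2)"
  have N0: "0 \<le> N" unfolding N_def by (intro sum_nonneg) auto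
  have AQ: "(\<Sum>q\<in>Q. a q) \<le> infsum a UNIV" by (rule finite_sum_le_infsum[OF a Q]) (use a0 in auto)
  have AQ0: "0 \<le> (\<Sum>q\<in>Q. a q)" by (intro sum_nonneg) (use a0 in auto)
  have conv: "conv \<alpha> \<Phi> h m p = (\<Sum>q\<in>Q. \<Phi> m q * h (\<alpha> (- q) m) (p - q))" if "(m, p) \<in> S" for m p
  proof -
    have "conv \<alpha> \<Phi> h m p = (\<Sum>\<^sub>\<infinity>q\<in>Q. \<Phi> m q * h (\<alpha> (- q) m) (p - q))"
      unfolding conv_def
    proof (rule infsum_cong_neutral)
      fix q assume q: "q \<in> UNIV - Q"
      have "h (\<alpha> (- q) m) (p - q) = 0"
      proof (rule ccontr)
        assume "h (\<alpha> (- q) m) (p - q) \<noteq> 0"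
        then have "((m, p), (\<alpha> (- q) m, p - q)) \<in> S \<times> F" using that by (simp add: F_def)
        then have "q \<in> Q" unfolding Q_def by (rule rev_image_eqI) simp
        with q show False by simp
      qed
      then show "\<Phi> m q * h (\<alpha> (- q) m) (p - q) = 0" by simp
    qed auto
    then show ?thesis using Q by simp
  qed
  have cs: "(norm (conv \<alpha> \<Phi> h m p))\<^sup>2 \<le> (\<Sum>q\<in>Q. a q) * (\<Sum>q\<in>Q. a q * (norm (h (\<alpha> (- q) m) (p - q)))\<^sup>2)"
    if "(m, p) \<in> S" for m p
  proof -
    have "norm (conv \<alpha> \<Phi> h m p) \<le> (\<Sum>q\<in>Q. a q * norm (h (\<alpha> (- q) m) (p - q)))"
      unfolding conv[OF that] by (rule sum_norm_le) (simp add: norm_mult le mult_right_mono)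
    \<comment> \<open>Half of the weight goes into each factor before Cauchy-Schwarz, which then
      yields the sum of a once more.\<close>
    also have "\<dots> = (\<Sum>q\<in>Q. sqrt (a q) * (sqrt (a q) * norm (h (\<alpha> (- q) m) (p - q))))"
      by (simp add: mult.assoc[symmetric] a0)
    finally have "(norm (conv \<alpha> \<Phi> h m p))\<^sup>2
        \<le> (\<Sum>q\<in>Q. sqrt (a q) * (sqrt (a q) * norm (h (\<alpha> (- q) m) (p - q))))\<^sup>2"
      by (intro power_mono) auto
    also have "\<dots> \<le> (\<Sum>q\<in>Q. (sqrt (a q))\<^sup>2) * (\<Sum>q\<in>Q. (sqrt (a q) * norm (h (\<alpha> (- q) m) (p - q)))\<^sup>2)"
      by (rule Cauchy_Schwarz_ineq_sum)
    finally show ?thesis by (simp add: power_mult_distrib a0)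
  qed
  have inner: "(\<Sum>(m, p)\<in>S. (norm (h (\<alpha> (- q) m) (p - q)))\<^sup>2) \<le> N" for q
  proof -
    let ?g = "\<lambda>(m, p). (\<alpha> (- q) m, p - q)" and ?f = "\<lambda>s. (norm (h (fst s) (snd s)))\<^sup>2"
    have g: "inj_on ?g S" using inj[of "- q"] by (auto simp: inj_on_def)
    have "(\<Sum>(m, p)\<in>S. (norm (h (\<alpha> (- q) m) (p - q)))\<^sup>2) = (\<Sum>s\<in>?g ` S. ?f s)"
      by (subst sum.reindex[OF g]) (auto intro!: sum.cong)
    also have "\<dots> = (\<Sum>s\<in>?g ` S \<inter> F. ?f s)"
      by (rule sum.mono_neutral_right) (use S in \<open>auto simp: F_def\<close>)
    also have "\<dots> \<le> N" unfolding N_def by (rule sum_mono2) (use F in auto)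
    finally show ?thesis .
  qed
  have "(\<Sum>(m, p)\<in>S. (norm (conv \<alpha> \<Phi> h m p))\<^sup>2)
      \<le> (\<Sum>(m, p)\<in>S. (\<Sum>q\<in>Q. a q) * (\<Sum>q\<in>Q. a q * (norm (h (\<alpha> (- q) m) (p - q)))\<^sup>2))"
    by (rule sum_mono) (use cs in auto)
  also have "\<dots> = (\<Sum>q\<in>Q. a q) * (\<Sum>q\<in>Q. a q * (\<Sum>(m, p)\<in>S. (norm (h (\<alpha> (- q) m) (p - q)))\<^sup>2))"
    by (simp only: case_prod_unfold sum_distrib_left) (rule sum.swap)
  also have "\<dots> \<le> (\<Sum>q\<in>Q. a q) * (\<Sum>q\<in>Q. a q * N)"
    by (intro mult_left_mono sum_mono AQ0 inner a0)
  also have "\<dots> = (\<Sum>q\<in>Q. a q)\<^sup>2 * N" by (simp add: sum_distrib_right[symmetric] power2_eq_square)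
  also have "\<dots> \<le> (infsum a UNIV)\<^sup>2 * N"
    by (intro mult_right_mono power_mono AQ AQ0 N0)
  finally show "(\<Sum>(m, p)\<in>S. (norm (conv \<alpha> \<Phi> h m p))\<^sup>2)
      \<le> (infsum a UNIV)\<^sup>2 * (\<Sum>(m, p)\<in>{(m, p). h m p \<noteq> 0}. (norm (h m p))\<^sup>2)"
    by (simp add: N_def F_def case_prod_unfold)
qed

lemma cp_norm_le_mono: "cp_norm_le \<alpha> \<Phi> C \<Longrightarrow> C \<le> C' \<Longrightarrow> cp_norm_le \<alpha> \<Phi> C'"
  unfolding cp_norm_le_def
proof (elim conjE, intro conjI allI impI)
  fix h :: alg and S :: "(pt \<times> int) set"
  assume le: "C \<le> C'" and C: "0 \<le> C"
    and h: "finite {(m, p). h m p \<noteq> 0}" and S: "finite S"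
    and *: "\<forall>h S. finite {(m, p). h m p \<noteq> 0} \<longrightarrow> finite S \<longrightarrow>
      (\<Sum>(m, p)\<in>S. (norm (conv \<alpha> \<Phi> h m p))\<^sup>2)
        \<le> C\<^sup>2 * (\<Sum>(m, p)\<in>{(m, p). h m p \<noteq> 0}. (norm (h m p))\<^sup>2)"
  have "C\<^sup>2 \<le> C'\<^sup>2" by (rule power_mono[OF le C])
  moreover have "0 \<le> (\<Sum>(m, p)\<in>{(m, p). h m p \<noteq> 0}. (norm (h m p))\<^sup>2)"
    by (rule sum_nonneg) (simp add: case_prod_unfold)
  ultimately have "C\<^sup>2 * (\<Sum>(m, p)\<in>{(m, p). h m p \<noteq> 0}. (norm (h m p))\<^sup>2)
      \<le> C'\<^sup>2 * (\<Sum>(m, p)\<in>{(m, p). h m p \<noteq> 0}. (norm (h m p))\<^sup>2)"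
    by (rule mult_right_mono)
  then show "(\<Sum>(m, p)\<in>S. (norm (conv \<alpha> \<Phi> h m p))\<^sup>2)
      \<le> C'\<^sup>2 * (\<Sum>(m, p)\<in>{(m, p). h m p \<noteq> 0}. (norm (h m p))\<^sup>2)"
    using *[rule_format, OF h S] by (rule order_trans[rotated])
qed auto

lemma cp_closure_uniform:
  assumes "\<Phi> \<in> cp_closure \<alpha> A" "\<epsilon> > 0"
  obtains \<Phi>0 where "\<Phi>0 \<in> A" "\<And>m p. norm (\<Phi> m p - \<Phi>0 m p) \<le> \<epsilon>"
proof -
  obtain \<Phi>0 where "\<Phi>0 \<in> A" "cp_norm_le \<alpha> (\<lambda>m p. \<Phi> m p - \<Phi>0 m p) \<epsilon>"
    using assms unfolding cp_closure_def by blast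
  then show thesis using cp_norm_le_coeff that by blast
qed

lemma cp_closure_bounded:
  assumes "\<Phi> \<in> cp_closure \<alpha> A" "A \<subseteq> Cb_finite_support"
  shows "\<exists>C\<ge>0. \<forall>m p. norm (\<Phi> m p) \<le> C"
proof -
  obtain \<Phi>0 where \<Phi>0: "\<Phi>0 \<in> A" "\<And>m p. norm (\<Phi> m p - \<Phi>0 m p) \<le> 1"
    using cp_closure_uniform[OF assms(1) zero_less_one] by blast
  then have "bounded (range (\<lambda>(m, p). \<Phi>0 m p))" using assms(2) by (auto simp: Cb_finite_support_def)
  then obtain B where B: "\<And>z. z \<in> range (\<lambda>(m, p). \<Phi>0 m p) \<Longrightarrow> norm z \<le> B"
    unfolding bounded_iff by blast
  have "norm (\<Phi> m p) \<le> B + 1" for m p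
  proof -
    have "norm (\<Phi>0 m p) \<le> B" by (rule B, rule image_eqI[of _ _ "(m, p)"]) auto
    then show ?thesis using \<Phi>0(2)[of m p] norm_triangle_sub[of "\<Phi> m p" "\<Phi>0 m p"] by linarith
  qed
  then show ?thesis by (intro exI[of _ "B + 1"]) (auto intro: order_trans[OF norm_ge_zero])
qed

text \<open>Coefficients converge uniformly on the closure and |u| = 1, so a covariance relation
  survives the limit.\<close>

lemma cp_closure_phase_relation:
  assumes "\<Phi> \<in> cp_closure \<alpha> A" "\<And>\<Phi>0. \<Phi>0 \<in> A \<Longrightarrow> u * \<Phi>0 m' p = \<Phi>0 m p" "norm u = 1"
  shows "u * \<Phi> m' p = \<Phi> m p"
proof -
  have "norm (u * \<Phi> m' p - \<Phi> m p) \<le> e" if e: "e > 0" for e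
  proof -
    obtain \<Phi>0 where \<Phi>0: "\<Phi>0 \<in> A" "\<And>m p. norm (\<Phi> m p - \<Phi>0 m p) \<le> e / 2"
      by (rule cp_closure_uniform[OF assms(1), of "e / 2"]) (use e in simp_all)
    have "u * \<Phi> m' p - \<Phi> m p = u * (\<Phi> m' p - \<Phi>0 m' p) - (\<Phi> m p - \<Phi>0 m p)"
      using assms(2)[OF \<Phi>0(1)] by (simp add: algebra_simps)
    also have "norm \<dots> \<le> norm (u * (\<Phi> m' p - \<Phi>0 m' p)) + norm (\<Phi> m p - \<Phi>0 m p)"
      by (rule norm_triangle_ineq4)
    also have "\<dots> \<le> e / 2 + e / 2"
      unfolding norm_mult assms(3) mult_1 by (intro add_mono \<Phi>0(2))
    finally show ?thesis by simp
  qed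
  then have "norm (u * \<Phi> m' p - \<Phi> m p) \<le> 0" by (rule field_le_epsilon) simp
  then show ?thesis by simp
qed

text \<open>The decay is merely quadratic in p: just enough for the l1 bound on the norm and for
  exchanging sums.\<close>

definition rapid :: "alg \<Rightarrow> bool" where
  "rapid \<Phi> \<longleftrightarrow> (\<forall>p. periodic_T (\<lambda>m. \<Phi> m p) \<and> continuous_on UNIV (\<lambda>m. \<Phi> m p)) \<and>
     (\<exists>C\<ge>0. \<forall>m p. norm (\<Phi> m p) \<le> C * wt (of_int p))"

lemma rapid_add: "rapid \<Phi> \<Longrightarrow> rapid \<Psi> \<Longrightarrow> rapid (\<lambda>m p. \<Phi> m p + \<Psi> m p)"
proof -
  assume r: "rapid \<Phi>" "rapid \<Psi>"
  obtain C where C: "0 \<le> C" "\<forall>m p. norm (\<Phi> m p) \<le> C * wt (of_int p)"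
    using r(1) unfolding rapid_def by blast
  obtain D where D: "0 \<le> D" "\<forall>m p. norm (\<Psi> m p) \<le> D * wt (of_int p)"
    using r(2) unfolding rapid_def by blast
  have "norm (\<Phi> m p + \<Psi> m p) \<le> (C + D) * wt (of_int p)" for m p
    using norm_triangle_ineq[of "\<Phi> m p" "\<Psi> m p"] C(2)[rule_format, of m p] D(2)[rule_format, of m p]
    by (simp add: algebra_simps)
  then have "\<exists>C\<ge>0. \<forall>m p. norm (\<Phi> m p + \<Psi> m p) \<le> C * wt (of_int p)"
    using C(1) D(1) by (intro exI[of _ "C + D"]) simp
  moreover have "periodic_T (\<lambda>m. \<Phi> m p + \<Psi> m p)" "continuous_on UNIV (\<lambda>m. \<Phi> m p + \<Psi> m p)" for p
    using r by (simp_all add: rapid_def periodic_T_def continuous_on_add)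
  ultimately show ?thesis by (simp add: rapid_def)
qed

text \<open>Cutting off to a finite set of p leaves an l1 tail, and \<open>cp_norm_leI\<close> makes
  it small in norm.\<close>

lemma rapid_in_closure:
  assumes inj: "\<And>q. inj (\<alpha> q)" and r: "rapid \<Phi>"
    and A: "\<And>P. finite P \<Longrightarrow> (\<lambda>m p. if p \<in> P then \<Phi> m p else 0) \<in> A"
  shows "\<Phi> \<in> cp_closure \<alpha> A"
  unfolding cp_closure_def
proof (intro CollectI allI impI)
  fix \<epsilon> :: real assume e: "\<epsilon> > 0"
  obtain C where C: "C \<ge> 0" "\<And>m p. norm (\<Phi> m p) \<le> C * wt (of_int p)"
    using r unfolding rapid_def by blast
  define a where "a = (\<lambda>p::int. C * wt (of_int p))"
  have a: "a summable_on UNIV" unfolding a_def by (intro summable_on_cmult_right summable_wt_int)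
  have a0: "0 \<le> a p" for p unfolding a_def using C(1) wt_nonneg by simp
  obtain P where P: "finite P" "dist (sum a P) (infsum a UNIV) \<le> \<epsilon>"
    using infsum_finite_approximation[OF a e] by auto
  let ?a = "\<lambda>p. if p \<in> P then 0 else a p"
  have sa: "?a summable_on UNIV"
    by (rule summable_on_comparison_test[OF a]) (use a0 in auto)
  have sP: "(\<lambda>p. if p \<in> P then a p else 0) summable_on UNIV"
    by (rule summable_on_comparison_test[OF a]) (use a0 in auto)
  have "infsum a UNIV = (\<Sum>\<^sub>\<infinity>p. (if p \<in> P then a p else 0) + ?a p)"
    by (rule infsum_cong) auto
  also have "\<dots> = (\<Sum>\<^sub>\<infinity>p. (if p \<in> P then a p else 0)) + infsum ?a UNIV"
    by (rule infsum_add[OF sP sa])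
  also have "(\<Sum>\<^sub>\<infinity>p. (if p \<in> P then a p else 0)) = (\<Sum>\<^sub>\<infinity>p\<in>P. a p)"
    by (rule infsum_cong_neutral) auto
  also have "\<dots> = sum a P" using P(1) by simp
  finally have "infsum ?a UNIV \<le> \<epsilon>" using P(2) by (simp add: dist_real_def)
  moreover have "cp_norm_le \<alpha> (\<lambda>m p. \<Phi> m p - (if p \<in> P then \<Phi> m p else 0)) (infsum ?a UNIV)"
    by (rule cp_norm_leI[OF inj sa]) (use C in \<open>auto simp: a_def\<close>)
  ultimately show "\<exists>\<Phi>0\<in>A. cp_norm_le \<alpha> (\<lambda>m p. \<Phi> m p - \<Phi>0 m p) \<epsilon>"
    using A[OF P(1)] by (intro bexI[rotated]) (auto intro: cp_norm_le_mono)
qed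

lemma rapid_truncate:
  assumes "rapid \<Phi>" "finite P"
  shows "(\<lambda>m p. if p \<in> P then \<Phi> m p else 0) \<in> Cb_finite_support"
proof -
  obtain C where C: "C \<ge> 0" "\<And>m p. norm (\<Phi> m p) \<le> C * wt (of_int p)"
    using assms(1) unfolding rapid_def by blast
  have le: "norm (\<Phi> m p) \<le> C" for m p
    using C(2)[of m p] mult_left_mono[OF wt_le_1 C(1), of "of_int p"] by simp
  have "bounded (range (\<lambda>(m, p). if p \<in> P then \<Phi> m p else 0))"
    unfolding bounded_iff by (intro exI[of _ C]) (use le C(1) in auto)
  moreover have "finite {p. \<exists>m. (if p \<in> P then \<Phi> m p else 0) \<noteq> 0}"
    by (rule finite_subset[OF _ assms(2)]) auto
  moreover have "continuous_on UNIV (\<lambda>m. if p \<in> P then \<Phi> m p else 0)"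
    "periodic_T (\<lambda>m. if p \<in> P then \<Phi> m p else 0)" for p
    using assms(1) by (cases "p \<in> P"; simp add: rapid_def periodic_T_def)+
  ultimately show ?thesis by (simp add: Cb_finite_support_def)
qed

section \<open>Membership in the two closures\<close>

lemma inj_lam: "inj (lam \<mu> \<nu> q)"
  by (auto simp: inj_on_def lam_def)

lemma inj_sig: "inj (sig q)"
  by (auto simp: inj_on_def sig_def)

text \<open>The covariance relation is separated from finite support and boundedness, because
  lattice sums satisfy it with infinitely many nonzero components.\<close>

definition D_per :: "int \<Rightarrow> real \<Rightarrow> alg \<Rightarrow> bool" where
  "D_per c \<nu> \<Phi> \<longleftrightarrow> (\<forall>(k::int) x y (p::int).
     cnj (ee (of_int (c * k * p) * (y - of_int p * \<nu>))) * \<Phi> (x + of_int k, y) p = \<Phi> (x, y) p)"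

definition E_per :: "int \<Rightarrow> real \<Rightarrow> real \<Rightarrow> alg \<Rightarrow> bool" where
  "E_per c \<mu> \<nu> \<Psi> \<longleftrightarrow> (\<forall>(k::int) x y (p::int).
     ee (of_int (c * p * k) * (y - of_int k * \<nu>))
       * \<Psi> (x - 2 * of_int k * \<mu>, y - 2 * of_int k * \<nu>) p = \<Psi> (x, y) p)"

lemma D0_eq: "D0 c \<mu> \<nu> = {\<Phi> \<in> Cb_finite_support. D_per c \<nu> \<Phi>}"
  unfolding D0_def D_per_def by (rule refl)

lemma E0_eq: "E0 c \<mu> \<nu> = {\<Psi> \<in> Cb_finite_support. E_per c \<mu> \<nu> \<Psi>}"
  unfolding E0_def E_per_def by (rule refl)

lemma rapid_D_alg:
  assumes "rapid \<Phi>" "D_per c \<nu> \<Phi>" shows "\<Phi> \<in> D_alg c \<mu> \<nu>"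
  unfolding D_alg_def
proof (rule rapid_in_closure[OF inj_lam assms(1)])
  fix P :: "int set" assume "finite P"
  moreover have "D_per c \<nu> (\<lambda>m p. if p \<in> P then \<Phi> m p else 0)"
    using assms(2) by (simp add: D_per_def)
  ultimately show "(\<lambda>m p. if p \<in> P then \<Phi> m p else 0) \<in> D0 c \<mu> \<nu>"
    unfolding D0_eq using rapid_truncate[OF assms(1)] by blast
qed

lemma rapid_E_alg:
  assumes "rapid \<Psi>" "E_per c \<mu> \<nu> \<Psi>" shows "\<Psi> \<in> E_alg c \<mu> \<nu>"
  unfolding E_alg_def
proof (rule rapid_in_closure[OF inj_sig assms(1)])
  fix P :: "int set" assume "finite P"
  moreover have "E_per c \<mu> \<nu> (\<lambda>m p. if p \<in> P then \<Psi> m p else 0)"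
    using assms(2) by (simp add: E_per_def)
  ultimately show "(\<lambda>m p. if p \<in> P then \<Psi> m p else 0) \<in> E0 c \<mu> \<nu>"
    unfolding E0_eq using rapid_truncate[OF assms(1)] by blast
qed

lemma D_alg_bounded: "\<Phi> \<in> D_alg c \<mu> \<nu> \<Longrightarrow> \<exists>C\<ge>0. \<forall>m p. norm (\<Phi> m p) \<le> C"
  unfolding D_alg_def D0_eq by (erule cp_closure_bounded) blast

lemma E_alg_bounded: "\<Psi> \<in> E_alg c \<mu> \<nu> \<Longrightarrow> \<exists>C\<ge>0. \<forall>m p. norm (\<Psi> m p) \<le> C"
  unfolding E_alg_def E0_eq by (erule cp_closure_bounded) blast

lemma E_alg_per:
  assumes "\<Psi> \<in> E_alg c \<mu> \<nu>" shows "E_per c \<mu> \<nu> \<Psi>"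
  unfolding E_per_def
proof (intro allI)
  fix k :: int and x y p
  show "ee (of_int (c * p * k) * (y - of_int k * \<nu>))
      * \<Psi> (x - 2 * of_int k * \<mu>, y - 2 * of_int k * \<nu>) p = \<Psi> (x, y) p"
    by (rule cp_closure_phase_relation[OF assms[unfolded E_alg_def]]) (simp_all add: E0_def)
qed


subsection \<open>Lattice sums\<close>

text \<open>The function u extracts the coordinate that the lattice moves: the first coordinate for
  joint continuity, the variable itself for derivatives in x, a constant for derivatives in
  y.\<close>

definition lattice_dominated :: "real \<Rightarrow> ('a \<Rightarrow> real) \<Rightarrow> (int \<Rightarrow> 'a \<Rightarrow> complex) \<Rightarrow> bool" where
  "lattice_dominated L u F \<longleftrightarrow> (\<exists>C. \<forall>k s. norm (F k s) \<le> C * wt (u s + of_int k * L))"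

lemma lattice_dominatedI:
  "(\<And>k s. norm (F k s) \<le> C * wt (u s + of_int k * L)) \<Longrightarrow> lattice_dominated L u F"
  unfolding lattice_dominated_def by blast

lemma lattice_dominatedE:
  assumes "lattice_dominated L u F"
  obtains C where "C \<ge> 0" "\<And>k s. norm (F k s) \<le> C * wt (u s + of_int k * L)"
proof -
  obtain C where C: "\<And>k s. norm (F k s) \<le> C * wt (u s + of_int k * L)"
    using assms unfolding lattice_dominated_def by blast
  have "norm (F k s) \<le> max C 0 * wt (u s + of_int k * L)" for k s
    using C by (rule order_trans) (simp add: mult_right_mono wt_nonneg)
  then show thesis using that[of "max C 0"] by simp
qed

lemma lattice_dominated_add:
  assumes "lattice_dominated L u F" "lattice_dominated L u G"
  shows "lattice_dominated L u (\<lambda>k s. F k s + G k s)"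
proof -
  obtain C where C: "\<And>k s. norm (F k s) \<le> C * wt (u s + of_int k * L)"
    by (rule lattice_dominatedE[OF assms(1)]) blast
  obtain D where D: "\<And>k s. norm (G k s) \<le> D * wt (u s + of_int k * L)"
    by (rule lattice_dominatedE[OF assms(2)]) blast
  show ?thesis
    by (rule lattice_dominatedI[of _ "C + D"]) (simp add: distrib_right norm_triangle_mono C D)
qed

lemma lattice_dominated_cmult:
  assumes "lattice_dominated L u F" shows "lattice_dominated L u (\<lambda>k s. a * F k s)"
proof -
  obtain C where C: "\<And>k s. norm (F k s) \<le> C * wt (u s + of_int k * L)"
    by (rule lattice_dominatedE[OF assms]) blast
  show ?thesis
    by (rule lattice_dominatedI[of _ "norm a * C"]) (simp add: norm_mult mult.assoc mult_left_mono C)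
qed

lemma lattice_dominated_diff:
  assumes "lattice_dominated L u F" "lattice_dominated L u G"
  shows "lattice_dominated L u (\<lambda>k s. F k s - G k s)"
  using lattice_dominated_add[OF assms(1) lattice_dominated_cmult[OF assms(2), of "- 1"]] by simp

lemma lattice_dominated_summable:
  assumes "L \<noteq> 0" "lattice_dominated L u F" shows "(\<lambda>k. F k s) summable_on UNIV"
proof -
  obtain C where C: "\<And>k s. norm (F k s) \<le> C * wt (u s + of_int k * L)"
    by (rule lattice_dominatedE[OF assms(2)]) blast
  show ?thesis
    by (rule summable_bounded[OF _ C]) (intro summable_on_cmult_right summable_wt_step assms(1))
qed

text \<open>The majorant moves with x, so it is frozen on the strip of radius 1 about a given point,
  at the price of the factor 4 from \<open>wt_add_le\<close>.\<close>

lemma continuous_on_lattice_sum: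
  fixes F :: "int \<Rightarrow> pt \<Rightarrow> complex"
  assumes L: "L \<noteq> 0" and F: "\<And>k. continuous_on UNIV (F k)" and dom: "lattice_dominated L fst F"
  shows "continuous_on UNIV (\<lambda>m. \<Sum>\<^sub>\<infinity>k. F k m)"
  unfolding continuous_on_eq_continuous_at[OF open_UNIV]
proof
  fix m0 :: pt
  obtain C where C: "C \<ge> 0" and b: "\<And>k m. norm (F k m) \<le> C * wt (fst m + of_int k * L)"
    by (rule lattice_dominatedE[OF dom]) blast
  obtain x0 y0 where m0: "m0 = (x0, y0)" by force
  let ?S = "{x0 - 1<..<x0 + 1} \<times> (UNIV :: real set)"
  have *: "continuous_on ?S (\<lambda>m. \<Sum>\<^sub>\<infinity>k. F k m)"
  proof (rule continuous_on_infsum)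
    show "continuous_on ?S (F k)" for k using F continuous_on_subset by blast
    show "(\<lambda>k::int. C * (4 * wt (x0 + of_int k * L))) summable_on UNIV"
      by (intro summable_on_cmult_right summable_wt_step L)
    fix k :: int and m assume "m \<in> ?S"
    then obtain x y where m: "m = (x, y)" "\<bar>x - x0\<bar> \<le> 1" by (auto simp: abs_le_iff)
    have "wt ((x - x0) + (x0 + of_int k * L)) \<le> 2 * (1 + (x - x0)\<^sup>2) * wt (x0 + of_int k * L)"
      by (rule wt_add_le)
    also have "\<dots> \<le> 4 * wt (x0 + of_int k * L)"
      using m(2) power_mono[of "\<bar>x - x0\<bar>" 1 2] wt_nonneg by (intro mult_right_mono) auto
    finally have "C * wt (x + of_int k * L) \<le> C * (4 * wt (x0 + of_int k * L))"
      using C by (intro mult_left_mono) (auto simp: algebra_simps)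
    then show "norm (F k m) \<le> C * (4 * wt (x0 + of_int k * L))"
      using b[of k m] m(1) by simp
  qed
  have S: "open ?S" "m0 \<in> ?S" by (auto simp: m0 open_Times)
  show "isCont (\<lambda>m. \<Sum>\<^sub>\<infinity>k. F k m) m0"
    using * S(2) unfolding continuous_on_eq_continuous_at[OF S(1)] by (rule bspec)
qed

text \<open>Local majorants as for continuity: on the interval of radius 1 about x the weight is at
  most 4 times its value at x.\<close>

lemma has_dx_lattice_sum:
  fixes F F' :: "int \<Rightarrow> real \<Rightarrow> complex"
  assumes L: "L \<noteq> 0" and F: "\<And>k s. (F k has_vector_derivative F' k s) (at s)"
    and dom: "lattice_dominated L (\<lambda>s. s) F" "lattice_dominated L (\<lambda>s. s) F'"
  shows "((\<lambda>s. \<Sum>\<^sub>\<infinity>k. F k s) has_vector_derivative (\<Sum>\<^sub>\<infinity>k. F' k x)) (at x)"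
proof -
  obtain C where C: "C \<ge> 0" and b: "\<And>k s. norm (F k s) \<le> C * wt (s + of_int k * L)"
    by (rule lattice_dominatedE[OF dom(1)]) blast
  obtain D where D: "D \<ge> 0" and b': "\<And>k s. norm (F' k s) \<le> D * wt (s + of_int k * L)"
    by (rule lattice_dominatedE[OF dom(2)]) blast
  have *: "wt (s + of_int k * L) \<le> 4 * wt (x + of_int k * L)" if "s \<in> {x - 1<..<x + 1}" for s k
  proof -
    have "wt ((s - x) + (x + of_int k * L)) \<le> 2 * (1 + (s - x)\<^sup>2) * wt (x + of_int k * L)"
      by (rule wt_add_le)
    also have "\<dots> \<le> 4 * wt (x + of_int k * L)"
    proof -
      have "\<bar>s - x\<bar> \<le> 1" using that by auto
      then show ?thesis
        using power_mono[of "\<bar>s - x\<bar>" 1 2] wt_nonneg by (intro mult_right_mono) auto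
    qed
    finally show ?thesis by simp
  qed
  show ?thesis
  proof (rule has_vector_derivative_infsum[where S = "{x - 1<..<x + 1}" and M = "\<lambda>k. (C + D) * (4 * wt (x + of_int k * L))"])
    fix k s assume s: "s \<in> {x - 1<..<x + 1}"
    have le: "C * wt (s + of_int k * L) \<le> C * (4 * wt (x + of_int k * L))"
      "D * wt (s + of_int k * L) \<le> D * (4 * wt (x + of_int k * L))"
      using C D *[OF s] by (simp_all add: mult_left_mono del: mult.commute)
    have "0 \<le> C * (4 * wt (x + of_int k * L))" "0 \<le> D * (4 * wt (x + of_int k * L))"
      using C D wt_nonneg by simp_all
    then show "norm (F k s) \<le> (C + D) * (4 * wt (x + of_int k * L))"
      "norm (F' k s) \<le> (C + D) * (4 * wt (x + of_int k * L))"
      using b[of k s] b'[of k s] le unfolding distrib_right by linarith+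
  qed (auto simp: F intro!: summable_on_cmult_right summable_wt_step L)
qed

text \<open>The weight involves only the fixed x, so one majorant works for all y.\<close>

lemma has_dy_lattice_sum:
  fixes F F' :: "int \<Rightarrow> real \<Rightarrow> complex"
  assumes L: "L \<noteq> 0" and F: "\<And>k s. (F k has_vector_derivative F' k s) (at s)"
    and dom: "lattice_dominated L (\<lambda>s. x) F" "lattice_dominated L (\<lambda>s. x) F'"
  shows "((\<lambda>s. \<Sum>\<^sub>\<infinity>k. F k s) has_vector_derivative (\<Sum>\<^sub>\<infinity>k. F' k y)) (at y)"
proof -
  obtain C where C: "C \<ge> 0" and b: "\<And>k s. norm (F k s) \<le> C * wt (x + of_int k * L)"
    by (rule lattice_dominatedE[OF dom(1)]) blast
  obtain D where D: "D \<ge> 0" and b': "\<And>k s. norm (F' k s) \<le> D * wt (x + of_int k * L)"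
    by (rule lattice_dominatedE[OF dom(2)]) blast
  show ?thesis
  proof (rule has_vector_derivative_infsum[where S = UNIV and M = "\<lambda>k. (C + D) * wt (x + of_int k * L)"])
    fix k s
    have "0 \<le> C * wt (x + of_int k * L)" "0 \<le> D * wt (x + of_int k * L)"
      using C D wt_nonneg by simp_all
    then show "norm (F k s) \<le> (C + D) * wt (x + of_int k * L)" "norm (F' k s) \<le> (C + D) * wt (x + of_int k * L)"
      using b[of k s] b'[of k s] unfolding distrib_right by linarith+
  qed (simp_all add: F summable_on_cmult_right summable_wt_step[OF L])
qed

text \<open>Two powers of decay are taken from f: one remains for the sum over the lattice, the
  other is traded by \<open>wt_mult_le\<close> for decay in the offset b.\<close>

lemma Xi_prod_bound:
  assumes "f \<in> Xi" "g \<in> Xi"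
  shows "\<exists>C\<ge>0. \<forall>a b y y'. norm (f (a, y)) * norm (g (a + b, y')) \<le> C * wt b * wt a"
proof -
  obtain C where C: "C \<ge> 0" "\<And>x y. norm (f (x, y)) \<le> C * wt x ^ 2"
    using Xi_bound_pow[OF assms(1), of 2] by blast
  obtain D where D: "D \<ge> 0" "\<And>x y. norm (g (x, y)) \<le> D * wt x"
    using Xi_bound[OF assms(2)] by blast
  have "norm (f (a, y)) * norm (g (a + b, y')) \<le> 2 * C * D * wt b * wt a" for a b y y'
  proof -
    have "norm (f (a, y)) * norm (g (a + b, y')) \<le> (C * wt a ^ 2) * (D * wt (a + b))"
      by (rule mult_mono[OF C(2) D(2)]) (use C(1) in simp_all)
    also have "\<dots> = C * D * wt a * (wt a * wt (a + b))" by (simp add: power2_eq_square)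
    also have "\<dots> \<le> C * D * wt a * (2 * wt b)"
      using C(1) D(1) wt_nonneg by (intro mult_left_mono wt_mult_le) auto
    finally show ?thesis by (simp add: mult_ac)
  qed
  then show ?thesis using C(1) D(1) by (intro exI[of _ "2 * C * D"]) auto
qed


subsection \<open>The inner products\<close>

definition xm :: "vec \<Rightarrow> vec" where
  "xm f = (\<lambda>m. of_real (fst m) * f m)"

lemma Xi_xm: "f \<in> Xi \<Longrightarrow> xm f \<in> Xi"
  unfolding xm_def by (rule Xi_xmult)

lemma summable_on_diff_complex:
  fixes f g :: "'a \<Rightarrow> complex"
  assumes "f summable_on A" "g summable_on A"
  shows "(\<lambda>k. f k - g k) summable_on A"
  using summable_on_add[OF assms(1), of "\<lambda>k. - g k"] assms(2) by (simp add: summable_on_uminus)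

lemma nabla0_eq: "nabla0 c \<mu> (a, b, d) \<xi> = (\<lambda>m.
     of_real a * (- dy \<xi> m + of_real pi * of_int c * \<i> / (2 * of_real \<mu>) * xm (xm \<xi>) m)
     + of_real b * (- dx \<xi> m)
     + of_real d * (of_real pi * \<i> / of_real \<mu> * xm \<xi> m))"
  by (auto simp: nabla0_def xm_def power2_eq_square fun_eq_iff mult_ac)

lemma Xi_nabla0: "\<xi> \<in> Xi \<Longrightarrow> nabla0 c \<mu> W \<xi> \<in> Xi"
  by (cases W) (simp only: nabla0_eq, intro Xi_xm Xi_dx Xi_dy Xi_add Xi_cmult Xi_uminus)

definition tD :: "int \<Rightarrow> real \<Rightarrow> real \<Rightarrow> vec \<Rightarrow> vec \<Rightarrow> real \<Rightarrow> real \<Rightarrow> int \<Rightarrow> int \<Rightarrow> complex" where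
  "tD c \<mu> \<nu> f g x y p k = cnj (ee (of_int (c * k * p) * (y - of_int p * \<nu>))) * f (x + of_int k, y)
       * cnj (g (x - 2 * of_int p * \<mu> + of_int k, y - 2 * of_int p * \<nu>))"

definition tE :: "int \<Rightarrow> real \<Rightarrow> real \<Rightarrow> vec \<Rightarrow> vec \<Rightarrow> real \<Rightarrow> real \<Rightarrow> int \<Rightarrow> int \<Rightarrow> complex" where
  "tE c \<mu> \<nu> f g x y p k = ee (of_int (c * p * k) * (y - of_int k * \<nu>))
       * cnj (f (x - 2 * of_int k * \<mu>, y - 2 * of_int k * \<nu>))
       * g (x - 2 * of_int k * \<mu> + of_int p, y - 2 * of_int k * \<nu>)"

lemma ip_D_eq: "ip_D c \<mu> \<nu> f g (x, y) p = (\<Sum>\<^sub>\<infinity>k. tD c \<mu> \<nu> f g x y p k)"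
  by (simp add: ip_D_def tD_def)

lemma ip_E_eq: "ip_E c \<mu> \<nu> f g (x, y) p = (\<Sum>\<^sub>\<infinity>k. tE c \<mu> \<nu> f g x y p k)"
  by (simp add: ip_E_def tE_def)

lemma has_dx_shift:
  "smooth f \<Longrightarrow> ((\<lambda>s. f (s + a, y)) has_vector_derivative dx f (x + a, y)) (at x)"
proof -
  assume "smooth f"
  have "((\<lambda>s. f (s, y)) \<circ> (\<lambda>s. s + a) has_vector_derivative (1::real) *\<^sub>R dx f (x + a, y)) (at x)"
    by (rule vector_diff_chain_at) (auto intro!: derivative_eq_intros simp: has_dx smooth_differentiable_x \<open>smooth f\<close>)
  then show ?thesis by (simp add: o_def)
qed

lemma has_dy_shift:
  "smooth f \<Longrightarrow> ((\<lambda>s. f (x, s + a)) has_vector_derivative dy f (x, y + a)) (at y)"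
proof -
  assume "smooth f"
  have "((\<lambda>s. f (x, s)) \<circ> (\<lambda>s. s + a) has_vector_derivative (1::real) *\<^sub>R dy f (x, y + a)) (at y)"
    by (rule vector_diff_chain_at) (auto intro!: derivative_eq_intros simp: has_dy smooth_differentiable_y \<open>smooth f\<close>)
  then show ?thesis by (simp add: o_def)
qed

lemma delta_add:
  assumes "\<And>p. smooth (\<lambda>m. \<Phi> m p)" "\<And>p. smooth (\<lambda>m. \<Psi> m p)"
  shows "delta c \<mu> W (\<lambda>m p. \<Phi> m p + \<Psi> m p) = (\<lambda>m p. delta c \<mu> W \<Phi> m p + delta c \<mu> W \<Psi> m p)"
proof -
  have x: "dx (\<lambda>m. \<Phi> m p + \<Psi> m p) = (\<lambda>m. dx (\<lambda>m. \<Phi> m p) m + dx (\<lambda>m. \<Psi> m p) m)" for p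
    by (rule dx_eqI) (intro has_vector_derivative_add has_dx
        smooth_differentiable_x[OF assms(1)] smooth_differentiable_x[OF assms(2)])
  have y: "dy (\<lambda>m. \<Phi> m p + \<Psi> m p) = (\<lambda>m. dy (\<lambda>m. \<Phi> m p) m + dy (\<lambda>m. \<Psi> m p) m)" for p
    by (rule dy_eqI) (intro has_vector_derivative_add has_dy
        smooth_differentiable_y[OF assms(1)] smooth_differentiable_y[OF assms(2)])
  show ?thesis
    by (cases W) (simp add: delta_X_def delta_Y_def delta_Z_def x y fun_eq_iff algebra_simps)
qed

text \<open>The bound separates p from k: the factor in k is summed uniformly in x, the factor in p
  survives. Both inner products fit this pattern.\<close>

lemma rapid_lattice_sum:
  assumes L: "L \<noteq> 0" and C: "C \<ge> 0"
    and le: "\<And>x y p k. norm (t x y p k) \<le> C * wt (of_int p) * wt (x + of_int k * L)"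
    and per: "\<And>x y p k. t x (y + 1) p k = t x y p k"
    and cont: "\<And>p k. continuous_on UNIV (\<lambda>m. t (fst m) (snd m) p k)"
    and \<Phi>: "\<And>x y p. \<Phi> (x, y) p = (\<Sum>\<^sub>\<infinity>k. t x y p k)"
  shows "rapid \<Phi>"
proof -
  define K where "K = (1 + 1 / L\<^sup>2) * (4 * wsum)"
  have "norm (\<Phi> (x, y) p) \<le> C * K * wt (of_int p)" for x y p
  proof -
    have "norm (\<Phi> (x, y) p) \<le> (\<Sum>\<^sub>\<infinity>k. C * wt (of_int p) * wt (x + of_int k * L))"
      unfolding \<Phi> by (rule norm_infsum_bounded[OF _ le])
        (intro summable_on_cmult_right summable_wt_step L)
    also have "\<dots> \<le> C * wt (of_int p) * K"
      unfolding infsum_cmult_right' K_def using C wt_nonneg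
      by (intro mult_left_mono infsum_wt_step L) auto
    finally show ?thesis by (simp add: mult_ac)
  qed
  then have "\<exists>C\<ge>0. \<forall>m p. norm (\<Phi> m p) \<le> C * wt (of_int p)"
    using C wsum_nonneg by (intro exI[of _ "C * K"]) (auto simp: K_def)
  moreover have "periodic_T (\<lambda>m. \<Phi> m p)" for p by (simp add: periodic_T_def \<Phi> per)
  moreover have "continuous_on UNIV (\<lambda>m. \<Phi> m p)" for p
  proof -
    have "continuous_on UNIV (\<lambda>m. \<Sum>\<^sub>\<infinity>k. t (fst m) (snd m) p k)"
      by (rule continuous_on_lattice_sum[OF L cont lattice_dominatedI]) (rule le)
    moreover have "(\<lambda>m. \<Phi> m p) = (\<lambda>m. \<Sum>\<^sub>\<infinity>k. t (fst m) (snd m) p k)"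
      by (auto simp: \<Phi>)
    ultimately show ?thesis by (simp only:)
  qed
  ultimately show ?thesis unfolding rapid_def by blast
qed

section \<open>Bounds, covariance and derivatives of the inner products\<close>

locale qhm =
  fixes c :: int and \<mu> \<nu> :: real
  assumes mu: "\<mu> \<noteq> 0"
begin

abbreviation ipD :: "vec \<Rightarrow> vec \<Rightarrow> alg" where "ipD \<equiv> ip_D c \<mu> \<nu>"
abbreviation ipE :: "vec \<Rightarrow> vec \<Rightarrow> alg" where "ipE \<equiv> ip_E c \<mu> \<nu>"
abbreviation nab0 :: conn where "nab0 \<equiv> nabla0 c \<mu>"

text \<open>The arguments of f and g differ by 2 p \<mu>, and rescaling turns decay in this offset
  into decay in p; this uses \<mu> nonzero.\<close>

lemma tD_bound:
  assumes "f \<in> Xi" "g \<in> Xi"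
  shows "\<exists>C\<ge>0. \<forall>x y p k. norm (tD c \<mu> \<nu> f g x y p k) \<le> C * wt (of_int p) * wt (x + of_int k * 1)"
proof -
  obtain C where C: "C \<ge> 0"
    "\<And>a b y y'. norm (f (a, y)) * norm (g (a + b, y')) \<le> C * wt b * wt a"
    using Xi_prod_bound[OF assms] by blast
  define D where "D = C * (1 + 1 / (2 * \<mu>)\<^sup>2)"
  have "norm (tD c \<mu> \<nu> f g x y p k) \<le> D * wt (of_int p) * wt (x + of_int k * 1)" for x y p k
  proof -
    have "norm (tD c \<mu> \<nu> f g x y p k) =
        norm (f (x + of_int k, y)) * norm (g (x + of_int k + - (2 * \<mu> * of_int p), y - 2 * of_int p * \<nu>))"
      by (simp add: tD_def norm_mult algebra_simps)
    also have "\<dots> \<le> C * wt (- (2 * \<mu> * of_int p)) * wt (x + of_int k)" by (rule C(2))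
    also have "\<dots> \<le> C * ((1 + 1 / (2 * \<mu>)\<^sup>2) * wt (of_int p)) * wt (x + of_int k)"
      unfolding wt_minus
      by (intro mult_right_mono mult_left_mono wt_scale_le C(1) wt_nonneg) (use mu in simp)
    finally show ?thesis by (simp add: D_def mult_ac)
  qed
  moreover have "D \<ge> 0" using C(1) by (simp add: D_def)
  ultimately show ?thesis by blast
qed

text \<open>The roles are exchanged: the offset is the integer p, and the lattice has step 2
  \<mu>.\<close>

lemma tE_bound:
  assumes "f \<in> Xi" "g \<in> Xi"
  shows "\<exists>C\<ge>0. \<forall>x y p k. norm (tE c \<mu> \<nu> f g x y p k)
    \<le> C * wt (of_int p) * wt (x + of_int k * (- 2 * \<mu>))"
proof -
  obtain C where C: "C \<ge> 0"
    "\<And>a b y y'. norm (f (a, y)) * norm (g (a + b, y')) \<le> C * wt b * wt a"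
    using Xi_prod_bound[OF assms] by blast
  have "norm (tE c \<mu> \<nu> f g x y p k) \<le> C * wt (of_int p) * wt (x + of_int k * (- 2 * \<mu>))" for x y p k
  proof -
    have "norm (tE c \<mu> \<nu> f g x y p k) =
        norm (f (x - 2 * of_int k * \<mu>, y - 2 * of_int k * \<nu>))
          * norm (g (x - 2 * of_int k * \<mu> + of_int p, y - 2 * of_int k * \<nu>))"
      by (simp add: tE_def norm_mult)
    also have "\<dots> \<le> C * wt (of_int p) * wt (x - 2 * of_int k * \<mu>)" by (rule C(2))
    finally show ?thesis by (simp add: algebra_simps)
  qed
  with C(1) show ?thesis by blast
qed

lemma tD_dominated:
  assumes "f \<in> Xi" "g \<in> Xi"
  shows "lattice_dominated 1 u (\<lambda>k s. tD c \<mu> \<nu> f g (u s) (v s) p k)"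
proof -
  obtain C where "\<And>x y p k. norm (tD c \<mu> \<nu> f g x y p k) \<le> C * wt (of_int p) * wt (x + of_int k * 1)"
    using tD_bound[OF assms] by blast
  then show ?thesis by (rule lattice_dominatedI)
qed

lemma tE_dominated:
  assumes "f \<in> Xi" "g \<in> Xi"
  shows "lattice_dominated (- 2 * \<mu>) u (\<lambda>k s. tE c \<mu> \<nu> f g (u s) (v s) p k)"
proof -
  obtain C where "\<And>x y p k. norm (tE c \<mu> \<nu> f g x y p k) \<le> C * wt (of_int p) * wt (x + of_int k * (- 2 * \<mu>))"
    using tE_bound[OF assms] by blast
  then show ?thesis by (rule lattice_dominatedI)
qed

lemma tD_summable: "f \<in> Xi \<Longrightarrow> g \<in> Xi \<Longrightarrow> tD c \<mu> \<nu> f g x y p summable_on UNIV"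
  using lattice_dominated_summable[OF one_neq_zero tD_dominated[of f g "\<lambda>s. x" "\<lambda>s. y" p]] by simp

lemma tE_summable: "f \<in> Xi \<Longrightarrow> g \<in> Xi \<Longrightarrow> tE c \<mu> \<nu> f g x y p summable_on UNIV"
  using lattice_dominated_summable[OF _ tE_dominated[of f g "\<lambda>s. x" "\<lambda>s. y" p]] mu by simp

lemma ipD_add_left:
  assumes "f \<in> Xi" "f' \<in> Xi" "g \<in> Xi"
  shows "ipD (\<lambda>m. f m + f' m) g m p = ipD f g m p + ipD f' g m p"
proof (cases m)
  case (Pair x y)
  have *: "tD c \<mu> \<nu> (\<lambda>m. f m + f' m) g x y p = (\<lambda>k. tD c \<mu> \<nu> f g x y p k + tD c \<mu> \<nu> f' g x y p k)"
    by (simp add: tD_def fun_eq_iff algebra_simps)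
  show ?thesis unfolding Pair ip_D_eq * by (simp add: infsum_add tD_summable assms)
qed

lemma ipD_add_right:
  assumes "f \<in> Xi" "g \<in> Xi" "g' \<in> Xi"
  shows "ipD f (\<lambda>m. g m + g' m) m p = ipD f g m p + ipD f g' m p"
proof (cases m)
  case (Pair x y)
  have *: "tD c \<mu> \<nu> f (\<lambda>m. g m + g' m) x y p = (\<lambda>k. tD c \<mu> \<nu> f g x y p k + tD c \<mu> \<nu> f g' x y p k)"
    by (simp add: tD_def fun_eq_iff algebra_simps)
  show ?thesis unfolding Pair ip_D_eq * by (simp add: infsum_add tD_summable assms)
qed

lemma ipD_cmult_left: "ipD (\<lambda>m. a * f m) g m p = a * ipD f g m p"
proof (cases m)
  case (Pair x y)
  have *: "tD c \<mu> \<nu> (\<lambda>m. a * f m) g x y p = (\<lambda>k. a * tD c \<mu> \<nu> f g x y p k)"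
    by (simp add: tD_def fun_eq_iff algebra_simps)
  show ?thesis unfolding Pair ip_D_eq * by (simp add: infsum_cmult_right')
qed

lemma ipD_cmult_right: "ipD f (\<lambda>m. a * g m) m p = cnj a * ipD f g m p"
proof (cases m)
  case (Pair x y)
  have *: "tD c \<mu> \<nu> f (\<lambda>m. a * g m) x y p = (\<lambda>k. cnj a * tD c \<mu> \<nu> f g x y p k)"
    by (simp add: tD_def fun_eq_iff algebra_simps)
  show ?thesis unfolding Pair ip_D_eq * by (simp add: infsum_cmult_right')
qed

lemma ipD_uminus_left: "ipD (\<lambda>m. - f m) g m p = - ipD f g m p"
  using ipD_cmult_left[of "- 1"] by simp

lemma ipD_uminus_right: "ipD f (\<lambda>m. - g m) m p = - ipD f g m p"
  using ipD_cmult_right[of f "- 1"] by simp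

text \<open>In every summand the two first coordinates differ by 2 p \<mu>, so this is the price of
  moving multiplication by x to the other slot.\<close>

lemma ipD_xm:
  assumes "f \<in> Xi" "g \<in> Xi"
  shows "ipD (xm f) g m p - ipD f (xm g) m p = 2 * of_int p * of_real \<mu> * ipD f g m p"
proof (cases m)
  case (Pair x y)
  have "tD c \<mu> \<nu> (xm f) g x y p k - tD c \<mu> \<nu> f (xm g) x y p k
      = 2 * of_int p * of_real \<mu> * tD c \<mu> \<nu> f g x y p k" for k
    by (simp add: tD_def xm_def algebra_simps)
  then have "(\<Sum>\<^sub>\<infinity>k. tD c \<mu> \<nu> (xm f) g x y p k - tD c \<mu> \<nu> f (xm g) x y p k)
      = 2 * of_int p * of_real \<mu> * (\<Sum>\<^sub>\<infinity>k. tD c \<mu> \<nu> f g x y p k)"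
    by (simp add: infsum_cmult_right')
  then show ?thesis unfolding Pair ip_D_eq
    by (simp add: infsum_diff tD_summable assms Xi_xm)
qed

lemma rapid_ipD:
  assumes f: "f \<in> Xi" and g: "g \<in> Xi" shows "rapid (ipD f g)"
proof -
  obtain C where C: "C \<ge> 0"
    "\<And>x y p k. norm (tD c \<mu> \<nu> f g x y p k) \<le> C * wt (of_int p) * wt (x + of_int k * 1)"
    using tD_bound[OF assms] by blast
  show ?thesis
  proof (rule rapid_lattice_sum[OF _ C _ _ ip_D_eq])
    fix x y :: real and p k :: int
    have "ee (of_int (c * k * p) * (y + 1 - of_int p * \<nu>)) = ee (of_int (c * k * p) * (y - of_int p * \<nu>) + of_int (c * k * p))"
      by (simp add: algebra_simps)
    also have "\<dots> = ee (of_int (c * k * p) * (y - of_int p * \<nu>))"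
      unfolding ee_add ee_of_int by simp
    finally show "tD c \<mu> \<nu> f g x (y + 1) p k = tD c \<mu> \<nu> f g x y p k"
      using Xi_periodic[OF f, of "x + of_int k" y] Xi_periodic[OF g, of "x - 2 * of_int p * \<mu> + of_int k" "y - 2 * of_int p * \<nu>"]
      by (simp add: tD_def algebra_simps)
    show "continuous_on UNIV (\<lambda>m. tD c \<mu> \<nu> f g (fst m) (snd m) p k)"
      unfolding tD_def
      by (intro continuous_intros continuous_on_compose2[OF Xi_continuous[OF f]]
          continuous_on_compose2[OF Xi_continuous[OF g]]) auto
  qed (use mu in simp)
qed

lemma rapid_ipE:
  assumes f: "f \<in> Xi" and g: "g \<in> Xi" shows "rapid (ipE f g)"
proof -
  obtain C where C: "C \<ge> 0"
    "\<And>x y p k. norm (tE c \<mu> \<nu> f g x y p k) \<le> C * wt (of_int p) * wt (x + of_int k * (- 2 * \<mu>))"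
    using tE_bound[OF assms] by blast
  show ?thesis
  proof (rule rapid_lattice_sum[OF _ C _ _ ip_E_eq])
    fix x y :: real and p k :: int
    have "ee (of_int (c * p * k) * (y + 1 - of_int k * \<nu>)) = ee (of_int (c * p * k) * (y - of_int k * \<nu>) + of_int (c * p * k))"
      by (simp add: algebra_simps)
    also have "\<dots> = ee (of_int (c * p * k) * (y - of_int k * \<nu>))"
      unfolding ee_add ee_of_int by simp
    finally show "tE c \<mu> \<nu> f g x (y + 1) p k = tE c \<mu> \<nu> f g x y p k"
      using Xi_periodic[OF f, of "x - 2 * of_int k * \<mu>" "y - 2 * of_int k * \<nu>"] Xi_periodic[OF g, of "x - 2 * of_int k * \<mu> + of_int p" "y - 2 * of_int k * \<nu>"]
      by (simp add: tE_def algebra_simps)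
    show "continuous_on UNIV (\<lambda>m. tE c \<mu> \<nu> f g (fst m) (snd m) p k)"
      unfolding tE_def
      by (intro continuous_intros continuous_on_compose2[OF Xi_continuous[OF f]]
          continuous_on_compose2[OF Xi_continuous[OF g]]) auto
  qed (use mu in simp)
qed

lemma D_per_ipD: "D_per c \<nu> (ipD f g)"
  unfolding D_per_def
proof (intro allI)
  fix k0 p :: int and x y :: real
  have "cnj (ee (of_int (c * k0 * p) * (y - of_int p * \<nu>))) * tD c \<mu> \<nu> f g (x + of_int k0) y p k
      = tD c \<mu> \<nu> f g x y p (k + k0)" for k
  proof -
    have "ee (of_int (c * (k + k0) * p) * (y - of_int p * \<nu>))
        = ee (of_int (c * k0 * p) * (y - of_int p * \<nu>)) * ee (of_int (c * k * p) * (y - of_int p * \<nu>))"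
      by (simp add: ee_add[symmetric] algebra_simps)
    then show ?thesis by (simp add: tD_def algebra_simps)
  qed
  then show "cnj (ee (of_int (c * k0 * p) * (y - of_int p * \<nu>))) * ipD f g (x + of_int k0, y) p = ipD f g (x, y) p"
    unfolding ip_D_eq
    by (simp add: infsum_cmult_right'[symmetric] infsum_int_shift[of "tD c \<mu> \<nu> f g x y p" k0])
qed

text \<open>Reindexing by k0 absorbs the translation. The phases match because shifting y by 2 k0
  \<nu> supplies the cross term of the square of k + k0.\<close>

lemma E_per_ipE: "E_per c \<mu> \<nu> (ipE f g)"
  unfolding E_per_def
proof (intro allI)
  fix k0 p :: int and x y :: real
  have "ee (of_int (c * p * k0) * (y - of_int k0 * \<nu>))
      * tE c \<mu> \<nu> f g (x - 2 * of_int k0 * \<mu>) (y - 2 * of_int k0 * \<nu>) p k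
      = tE c \<mu> \<nu> f g x y p (k + k0)" for k
  proof -
    have "ee (of_int (c * p * (k + k0)) * (y - of_int (k + k0) * \<nu>))
        = ee (of_int (c * p * k0) * (y - of_int k0 * \<nu>))
          * ee (of_int (c * p * k) * (y - 2 * of_int k0 * \<nu> - of_int k * \<nu>))"
      by (simp add: ee_add[symmetric] algebra_simps)
    then show ?thesis by (simp add: tE_def algebra_simps)
  qed
  then show "ee (of_int (c * p * k0) * (y - of_int k0 * \<nu>))
      * ipE f g (x - 2 * of_int k0 * \<mu>, y - 2 * of_int k0 * \<nu>) p = ipE f g (x, y) p"
    unfolding ip_E_eq
    by (simp add: infsum_cmult_right'[symmetric] infsum_int_shift[of "tE c \<mu> \<nu> f g x y p" k0])
qed

lemma ipD_has_dx:
  assumes f: "f \<in> Xi" and g: "g \<in> Xi"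
  shows "((\<lambda>s. ipD f g (s, y) p) has_vector_derivative
    ipD (dx f) g (x, y) p + ipD f (dx g) (x, y) p) (at x)"
proof -
  note f' = Xi_dx[OF f] and g' = Xi_dx[OF g]
  have "((\<lambda>s. \<Sum>\<^sub>\<infinity>k. tD c \<mu> \<nu> f g s y p k) has_vector_derivative
      (\<Sum>\<^sub>\<infinity>k. tD c \<mu> \<nu> (dx f) g x y p k + tD c \<mu> \<nu> f (dx g) x y p k)) (at x)"
  proof (rule has_dx_lattice_sum[where L = 1])
    fix k :: int and s :: real
    let ?e = "cnj (ee (of_int (c * k * p) * (y - of_int p * \<nu>)))"
    have "((\<lambda>s. ?e * (f (s + of_int k, y) * cnj (g (s + (of_int k - 2 * of_int p * \<mu>), y - 2 * of_int p * \<nu>))))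
       has_vector_derivative ?e * (f (s + of_int k, y) * cnj (dx g (s + (of_int k - 2 * of_int p * \<mu>), y - 2 * of_int p * \<nu>))
         + dx f (s + of_int k, y) * cnj (g (s + (of_int k - 2 * of_int p * \<mu>), y - 2 * of_int p * \<nu>)))) (at s)"
      by (intro has_vector_derivative_mult_right has_vector_derivative_mult has_vector_derivative_cnj
          has_dx_shift Xi_smooth f g)
    then show "((\<lambda>s. tD c \<mu> \<nu> f g s y p k) has_vector_derivative
        tD c \<mu> \<nu> (dx f) g s y p k + tD c \<mu> \<nu> f (dx g) s y p k) (at s)"
      by (simp add: tD_def algebra_simps)
  qed (intro lattice_dominated_add tD_dominated f g f' g' one_neq_zero)+
  then show ?thesis unfolding ip_D_eq by (simp add: infsum_add tD_summable f g f' g')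
qed

text \<open>Differentiating the phase brings out an unbounded factor k. Writing it as (x + k) - x
  turns it into multiplication by the coordinate inside f, which the Schwartz decay controls, and a
  factor x outside the sum.\<close>

lemma ipD_has_dy:
  assumes f: "f \<in> Xi" and g: "g \<in> Xi"
  shows "((\<lambda>s. ipD f g (x, s) p) has_vector_derivative
    ipD (dy f) g (x, y) p + ipD f (dy g) (x, y) p
      - 2 * of_real pi * \<i> * of_int (c * p) * (ipD (xm f) g (x, y) p - of_real x * ipD f g (x, y) p)) (at y)"
proof -
  note f' = Xi_dy[OF f] and g' = Xi_dy[OF g] and xf = Xi_xm[OF f]
  let ?t = "\<lambda>f g s k. tD c \<mu> \<nu> f g x s p k"
  let ?a = "2 * of_real pi * \<i> * of_int (c * p) :: complex"
  have "((\<lambda>s. \<Sum>\<^sub>\<infinity>k. ?t f g s k) has_vector_derivative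
      (\<Sum>\<^sub>\<infinity>k. (?t (dy f) g y k + ?t f (dy g) y k) - ?a * (?t (xm f) g y k - of_real x * ?t f g y k))) (at y)"
  proof (rule has_dy_lattice_sum[where L = 1 and x = x])
    fix k :: int and s :: real
    have "((\<lambda>s. cnj (ee (of_int (c * k * p) * (s - of_int p * \<nu>))) *
          (f (x + of_int k, s + 0) * cnj (g (x - 2 * of_int p * \<mu> + of_int k, s + - (2 * of_int p * \<nu>)))))
       has_vector_derivative
          cnj (ee (of_int (c * k * p) * (s - of_int p * \<nu>))) *
          (f (x + of_int k, s + 0) * cnj (dy g (x - 2 * of_int p * \<mu> + of_int k, s + - (2 * of_int p * \<nu>)))
          + dy f (x + of_int k, s + 0) * cnj (g (x - 2 * of_int p * \<mu> + of_int k, s + - (2 * of_int p * \<nu>))))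
         + cnj (2 * of_real pi * \<i> * of_real (of_int (c * k * p)) * ee (of_int (c * k * p) * (s - of_int p * \<nu>))) *
          (f (x + of_int k, s + 0) * cnj (g (x - 2 * of_int p * \<mu> + of_int k, s + - (2 * of_int p * \<nu>))))) (at s)"
      by (intro has_vector_derivative_mult has_vector_derivative_cnj has_dy_shift Xi_smooth f g ee_has_vector_derivative)
    then show "((\<lambda>s. ?t f g s k) has_vector_derivative
        (?t (dy f) g s k + ?t f (dy g) s k) - ?a * (?t (xm f) g s k - of_real x * ?t f g s k)) (at s)"
      by (simp add: tD_def xm_def algebra_simps)
  qed (intro lattice_dominated_add lattice_dominated_diff lattice_dominated_cmult tD_dominated
      f g f' g' xf one_neq_zero)+
  moreover have "(\<Sum>\<^sub>\<infinity>k. (?t (dy f) g y k + ?t f (dy g) y k) - ?a * (?t (xm f) g y k - of_real x * ?t f g y k))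
      = ((\<Sum>\<^sub>\<infinity>k. ?t (dy f) g y k) + (\<Sum>\<^sub>\<infinity>k. ?t f (dy g) y k))
        - ?a * ((\<Sum>\<^sub>\<infinity>k. ?t (xm f) g y k) - of_real x * (\<Sum>\<^sub>\<infinity>k. ?t f g y k))"
    by (subst infsum_diff infsum_add infsum_cmult_right' |
        (intro summable_on_add summable_on_cmult_right summable_on_diff_complex tD_summable f g f' g' xf; fail))+ (rule refl)
  ultimately show ?thesis unfolding ip_D_eq by simp
qed


lemma ipD_diff_left:
  "f \<in> Xi \<Longrightarrow> f' \<in> Xi \<Longrightarrow> g \<in> Xi \<Longrightarrow> ipD (\<lambda>m. f m - f' m) g m p = ipD f g m p - ipD f' g m p"
  using ipD_add_left[of f "\<lambda>m. - f' m" g] by (simp add: ipD_uminus_left Xi_uminus)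

lemma ipD_diff_right:
  "f \<in> Xi \<Longrightarrow> g \<in> Xi \<Longrightarrow> g' \<in> Xi \<Longrightarrow> ipD f (\<lambda>m. g m - g' m) m p = ipD f g m p - ipD f g' m p"
  using ipD_add_right[of f g "\<lambda>m. - g' m"] by (simp add: ipD_uminus_right Xi_uminus)

lemma ipD_dx: "f \<in> Xi \<Longrightarrow> g \<in> Xi \<Longrightarrow>
    dx (\<lambda>m. ipD f g m p) = (\<lambda>m. ipD (dx f) g m p + ipD f (dx g) m p)"
  by (rule dx_eqI) (rule ipD_has_dx)

lemma ipD_dy: "f \<in> Xi \<Longrightarrow> g \<in> Xi \<Longrightarrow>
    dy (\<lambda>m. ipD f g m p) = (\<lambda>m. ipD (dy f) g m p + ipD f (dy g) m p
      - 2 * of_real pi * \<i> * of_int (c * p) * (ipD (xm f) g m p - of_real (fst m) * ipD f g m p))"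
  by (rule dy_eqI) (use ipD_has_dy in simp)

text \<open>Compatibility of \<open>nab0\<close>. The multiplication parts have imaginary
  coefficients, so conjugation in the second slot yields differences between the slots, and
  \<open>ipD_xm\<close> evaluates these as the multipliers in \<open>delta_X\<close> and
  \<open>delta_Z\<close>.\<close>

lemma delta_ipD:
  assumes f: "f \<in> Xi" and g: "g \<in> Xi"
  shows "delta c \<mu> W (ipD f g) = (\<lambda>m p. ipD (nab0 W f) g m p + ipD f (nab0 W g) m p)"
proof -
  obtain a b d where W: "W = (a, b, d)" by (cases W)
  note X = f g Xi_dx[OF f] Xi_dy[OF f] Xi_dx[OF g] Xi_dy[OF g] Xi_xm[OF f] Xi_xm[OF g]
    Xi_xm[OF Xi_xm[OF f]] Xi_xm[OF Xi_xm[OF g]]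
  define K :: complex where "K = of_real pi * of_int c * \<i> / (2 * of_real \<mu>)"
  define L :: complex where "L = of_real pi * \<i> / of_real \<mu>"
  have mu': "complex_of_real \<mu> \<noteq> 0" using mu by simp
  have K: "K * (2 * of_int p * of_real \<mu>) * 2 = 2 * of_real pi * \<i> * of_int (c * p)" for p
    using mu' by (simp add: K_def field_simps)
  have L: "L * (2 * of_int p * of_real \<mu>) = 2 * of_real pi * \<i> * of_int p" for p
    using mu' by (simp add: L_def field_simps)
  have cK: "cnj K = - K" and cL: "cnj L = - L" by (simp_all add: K_def L_def)
  have left: "ipD (nab0 W f) g m p = of_real a * (- ipD (dy f) g m p + K * ipD (xm (xm f)) g m p)
      - of_real b * ipD (dx f) g m p + of_real d * L * ipD (xm f) g m p" for m p
    unfolding W nabla0_eq K_def[symmetric] L_def[symmetric]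
    by (simp add: ipD_add_left ipD_diff_left ipD_cmult_left ipD_uminus_left X Xi_diff Xi_add Xi_cmult Xi_uminus del: mult_minus_right)
  have right: "ipD f (nab0 W g) m p = of_real a * (- ipD f (dy g) m p - K * ipD f (xm (xm g)) m p)
      - of_real b * ipD f (dx g) m p - of_real d * L * ipD f (xm g) m p" for m p
    unfolding W nabla0_eq K_def[symmetric] L_def[symmetric]
    by (simp add: ipD_add_right ipD_diff_right ipD_cmult_right ipD_uminus_right Xi_diff cK cL X Xi_add Xi_cmult Xi_uminus del: mult_minus_right)
  have "delta c \<mu> W (ipD f g) m p = ipD (nab0 W f) g m p + ipD f (nab0 W g) m p" for m p
  proof -
    define u where "u = ipD (xm f) g m p"
    define v where "v = ipD f g m p"
    have x1: "ipD f (xm g) m p = u - 2 * of_int p * of_real \<mu> * v"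
      using ipD_xm[OF f g, of m p] by (simp add: u_def v_def algebra_simps)
    \<comment> \<open>A difference of squares: with t = x + k, t^2 - (t - 2 p \<mu>)^2 = 2 p \<mu>
      (2 t - 2 p \<mu>).\<close>
    have x2: "ipD (xm (xm f)) g m p - ipD f (xm (xm g)) m p
        = 2 * of_int p * of_real \<mu> * (2 * u - 2 * of_int p * of_real \<mu> * v)"
      using ipD_xm[OF X(7) g, of m p] ipD_xm[OF f X(8), of m p] unfolding x1
      by (simp add: u_def[symmetric] algebra_simps)
    have dXX: "delta_X c \<mu> (ipD f g) m p = K * (ipD (xm (xm f)) g m p - ipD f (xm (xm g)) m p)
        - ipD (dy f) g m p - ipD f (dy g) m p"
    proof (cases m)
      case (Pair x y)
      have "delta_X c \<mu> (ipD f g) m p = 2 * of_real pi * \<i> * of_int (c * p) * (u - of_int p * of_real \<mu> * v)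
          - ipD (dy f) g m p - ipD f (dy g) m p"
        unfolding delta_X_def Pair by (simp add: ipD_dy[OF f g] Pair u_def v_def algebra_simps)
      also have "2 * of_real pi * \<i> * of_int (c * p) * (u - of_int p * of_real \<mu> * v)
          = K * (ipD (xm (xm f)) g m p - ipD f (xm (xm g)) m p)"
        unfolding x2 K[symmetric] by (simp add: algebra_simps)
      finally show ?thesis .
    qed
    have dYY: "delta_Y (ipD f g) m p = - ipD (dx f) g m p - ipD f (dx g) m p"
      by (simp add: delta_Y_def ipD_dx[OF f g])
    have dZZ: "delta_Z (ipD f g) m p = L * (ipD (xm f) g m p - ipD f (xm g) m p)"
      unfolding delta_Z_def x1 L[symmetric] by (simp add: u_def v_def algebra_simps)
    show ?thesis
      unfolding W delta.simps dXX dYY dZZ left[unfolded W] right[unfolded W] by (simp add: algebra_simps)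
  qed
  then show ?thesis by blast
qed

text \<open>Closure under multiplication by x is forced by \<open>ipD_dy\<close>, whose right-hand
  side contains x times an inner product. This makes the span stable under both derivatives.\<close>

inductive_set ipD_span :: "int \<Rightarrow> vec set" for p where
  ipD: "f \<in> Xi \<Longrightarrow> g \<in> Xi \<Longrightarrow> (\<lambda>m. ipD f g m p) \<in> ipD_span p"
| add: "u \<in> ipD_span p \<Longrightarrow> v \<in> ipD_span p \<Longrightarrow> (\<lambda>m. u m + v m) \<in> ipD_span p"
| cmult: "u \<in> ipD_span p \<Longrightarrow> (\<lambda>m. a * u m) \<in> ipD_span p"
| xmult: "u \<in> ipD_span p \<Longrightarrow> (\<lambda>m. of_real (fst m) * u m) \<in> ipD_span p"

lemma ipD_span_derivs:
  assumes "u \<in> ipD_span p"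
  shows "continuous_on UNIV u \<and> (\<forall>x y. (\<lambda>s. u (s, y)) differentiable (at x)) \<and>
    (\<forall>x y. (\<lambda>s. u (x, s)) differentiable (at y)) \<and> dx u \<in> ipD_span p \<and> dy u \<in> ipD_span p"
  using assms
proof induction
  case (ipD f g)
  have "continuous_on UNIV (\<lambda>m. ipD f g m p)"
    using rapid_ipD[OF ipD] unfolding rapid_def by blast
  moreover have "(\<lambda>s. ipD f g (s, y) p) differentiable (at x)" for x y
    by (rule differentiableI_vector[OF ipD_has_dx[OF ipD]])
  moreover have "(\<lambda>s. ipD f g (x, s) p) differentiable (at y)" for x y
    by (rule differentiableI_vector[OF ipD_has_dy[OF ipD]])
  moreover have "dx (\<lambda>m. ipD f g m p) \<in> ipD_span p"
    unfolding ipD_dx[OF ipD] by (intro ipD_span.intros Xi_dx ipD)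
  moreover have "dy (\<lambda>m. ipD f g m p) \<in> ipD_span p"
  proof -
    have "(\<lambda>m. (ipD (dy f) g m p + ipD f (dy g) m p) + (- (2 * of_real pi * \<i> * of_int (c * p))) *
        (ipD (xm f) g m p + (- 1) * (of_real (fst m) * ipD f g m p))) \<in> ipD_span p"
      by (rule ipD_span.add[OF ipD_span.add ipD_span.cmult[OF ipD_span.add[OF _ ipD_span.cmult[OF ipD_span.xmult]]]])
        (intro ipD_span.ipD Xi_dy Xi_xm ipD)+
    then show ?thesis unfolding ipD_dy[OF ipD] by (simp add: algebra_simps)
  qed
  ultimately show ?case by blast
next
  case (add u v)
  have "dx (\<lambda>m. u m + v m) = (\<lambda>m. dx u m + dx v m)" "dy (\<lambda>m. u m + v m) = (\<lambda>m. dy u m + dy v m)"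
    by (rule dx_eqI dy_eqI; intro has_vector_derivative_add has_dx has_dy; use add.IH in simp)+
  then show ?case using add.IH by (auto intro: ipD_span.add continuous_on_add differentiable_add)
next
  case (cmult u a)
  have "dx (\<lambda>m. a * u m) = (\<lambda>m. a * dx u m)" "dy (\<lambda>m. a * u m) = (\<lambda>m. a * dy u m)"
    by (rule dx_eqI dy_eqI; intro has_vector_derivative_mult_right has_dx has_dy; use cmult.IH in simp)+
  then show ?case using cmult.IH
    by (auto intro: ipD_span.cmult continuous_on_mult_left differentiable_mult)
next
  case (xmult u)
  have "dx (\<lambda>m. of_real (fst m) * u m) = (\<lambda>m. of_real (fst m) * dx u m + 1 * u m)"
  proof (rule dx_eqI)
    fix x y
    have "((\<lambda>s. of_real s * u (s, y)) has_vector_derivative of_real x * dx u (x, y) + of_real 1 * u (x, y)) (at x)"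
      by (intro has_vector_derivative_mult has_vector_derivative_of_real DERIV_ident has_dx) (use xmult.IH in simp)
    then show "((\<lambda>s. of_real (fst (s, y)) * u (s, y)) has_vector_derivative
        of_real (fst (x, y)) * dx u (x, y) + 1 * u (x, y)) (at x)" by simp
  qed
  moreover have "dy (\<lambda>m. of_real (fst m) * u m) = (\<lambda>m. of_real (fst m) * dy u m)"
    by (rule dy_eqI) (simp, intro has_vector_derivative_mult_right has_dy, use xmult.IH in simp)
  moreover have "(\<lambda>s. complex_of_real s * u (s, y)) differentiable (at x)" for x y
    using xmult.IH by (intro differentiable_mult) auto
  moreover have "(\<lambda>s. complex_of_real x * u (x, s)) differentiable (at y)" for x y
    using xmult.IH by (intro differentiable_mult) auto
  ultimately show ?case using xmult.IH xmult.hyps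
    by (auto intro!: ipD_span.add ipD_span.xmult continuous_intros)
qed

lemma smooth_ipD: "f \<in> Xi \<Longrightarrow> g \<in> Xi \<Longrightarrow> smooth (\<lambda>m. ipD f g m p)"
  by (rule smooth_coinduct[where S = "ipD_span p"]) (use ipD_span_derivs ipD_span.ipD in blast)+

text \<open>By \<open>delta_ipD\<close> a derivation turns one inner product into a sum of two, so
  this set is stable under the whole Lie algebra, and its members lie in
  \<open>D_smooth\<close>.\<close>

inductive_set ipD_sums :: "alg set" where
  ipD: "f \<in> Xi \<Longrightarrow> g \<in> Xi \<Longrightarrow> ipD f g \<in> ipD_sums"
| add: "\<Phi> \<in> ipD_sums \<Longrightarrow> \<Psi> \<in> ipD_sums \<Longrightarrow> (\<lambda>m p. \<Phi> m p + \<Psi> m p) \<in> ipD_sums"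

lemma ipD_sums_props:
  assumes "\<Phi> \<in> ipD_sums"
  shows "rapid \<Phi> \<and> D_per c \<nu> \<Phi> \<and> (\<forall>p. smooth (\<lambda>m. \<Phi> m p)) \<and> (\<forall>p. (\<lambda>m. \<Phi> m p) \<in> ipD_span p)
    \<and> (\<forall>W. delta c \<mu> W \<Phi> \<in> ipD_sums)"
  using assms
proof induction
  case (ipD f g)
  then show ?case
    by (simp add: rapid_ipD D_per_ipD smooth_ipD ipD_span.ipD delta_ipD ipD_sums.intros Xi_nabla0)
next
  case (add \<Phi> \<Psi>)
  have "(\<lambda>m. \<Phi> m p + \<Psi> m p) \<in> ipD_span p" for p
    using add.IH by (intro ipD_span.add) auto
  moreover from this have "smooth (\<lambda>m. \<Phi> m p + \<Psi> m p)" for p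
    by (rule smooth_coinduct[where S = "ipD_span p"]) (use ipD_span_derivs in blast)+
  moreover have "D_per c \<nu> (\<lambda>m p. \<Phi> m p + \<Psi> m p)"
    using add.IH by (simp add: D_per_def distrib_left)
  moreover have "delta c \<mu> W (\<lambda>m p. \<Phi> m p + \<Psi> m p) \<in> ipD_sums" for W
  proof -
    have "delta c \<mu> W \<Phi> \<in> ipD_sums" "delta c \<mu> W \<Psi> \<in> ipD_sums" using add.IH by blast+
    then show ?thesis by (subst delta_add) (use add.IH in blast, use add.IH in blast, rule ipD_sums.add)
  qed
  ultimately show ?case using add.IH rapid_add by blast
qed

lemma ipD_sums_D_smooth: "\<Phi> \<in> ipD_sums \<Longrightarrow> \<Phi> \<in> D_smooth c \<mu> \<nu>"
proof -
  have "fold (delta c \<mu>) Ws \<Phi> \<in> ipD_sums" if "\<Phi> \<in> ipD_sums" for Ws \<Phi>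
    using that by (induction Ws arbitrary: \<Phi>) (simp_all add: ipD_sums_props)
  then show "\<Phi> \<in> ipD_sums \<Longrightarrow> \<Phi> \<in> D_smooth c \<mu> \<nu>"
    unfolding D_smooth_def using ipD_sums_props rapid_D_alg by blast
qed

lemma ipD_D_smooth: "f \<in> Xi \<Longrightarrow> g \<in> Xi \<Longrightarrow> ipD f g \<in> D_smooth c \<mu> \<nu>"
  by (intro ipD_sums_D_smooth ipD_sums.ipD)

end


subsection \<open>The actions\<close>

text \<open>This is the size estimate available for elements of the closures: no decay in p is
  known, so the actions converge by the decay of the module element.\<close>

definition bdd_alg :: "alg \<Rightarrow> bool" where
  "bdd_alg \<Phi> \<longleftrightarrow> (\<exists>C\<ge>0. \<forall>m p. norm (\<Phi> m p) \<le> C)"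

lemma rapid_bdd: "rapid \<Phi> \<Longrightarrow> bdd_alg \<Phi>"
proof -
  assume "rapid \<Phi>"
  then obtain C where C: "C \<ge> 0" "\<And>m p. norm (\<Phi> m p) \<le> C * wt (of_int p)"
    unfolding rapid_def by blast
  have "norm (\<Phi> m p) \<le> C" for m p
    using C(2)[of m p] mult_left_mono[OF wt_le_1 C(1), of "of_int p"] by simp
  with C(1) show ?thesis unfolding bdd_alg_def by blast
qed

text \<open>The majorant b may depend on the outer index as long as its sums stay below B.
  Translated weights have this property by \<open>infsum_wt_shift\<close>.\<close>

lemma infsum_swap_dominated:
  fixes f :: "'a \<Rightarrow> 'b \<Rightarrow> complex"
  assumes a: "a summable_on UNIV" "\<And>k. 0 \<le> a k"
    and b: "\<And>k. b k summable_on UNIV" "\<And>k. infsum (b k) UNIV \<le> B"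
    and le: "\<And>k q. norm (f k q) \<le> a k * b k q"
  shows "(\<Sum>\<^sub>\<infinity>k. \<Sum>\<^sub>\<infinity>q. f k q) = (\<Sum>\<^sub>\<infinity>q. \<Sum>\<^sub>\<infinity>k. f k q)"
proof (rule infsum_swap_banach, rule abs_summable_summable)
  have s: "(\<lambda>q. norm (f k q)) summable_on UNIV" for k
    by (rule abs_summable_bounded[OF summable_on_cmult_right[OF b(1)]]) (rule le)
  have "(\<lambda>k. \<Sum>\<^sub>\<infinity>q. norm (f k q)) summable_on UNIV"
  proof (rule summable_on_comparison_test[OF summable_on_cmult_left[OF a(1), of B]])
    fix k
    have "(\<Sum>\<^sub>\<infinity>q. norm (f k q)) \<le> (\<Sum>\<^sub>\<infinity>q. a k * b k q)"
      by (rule infsum_mono[OF s summable_on_cmult_right[OF b(1)]]) (rule le)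
    also have "\<dots> \<le> a k * B" unfolding infsum_cmult_right' by (rule mult_left_mono[OF b(2) a(2)])
    finally show "(\<Sum>\<^sub>\<infinity>q. norm (f k q)) \<le> a k * B" .
  qed (auto intro: infsum_nonneg)
  then show "(\<lambda>z. norm (case z of (k, q) \<Rightarrow> f k q)) summable_on UNIV \<times> UNIV"
    by (subst Infinite_Sum.abs_summable_on_Sigma_iff) (use s in \<open>auto simp: infsum_nonneg\<close>)
qed

lemma act_E_summable:
  assumes "bdd_alg \<Psi>" "f \<in> Xi"
  shows "(\<lambda>q::int. cnj (\<Psi> m q) * f (x + of_int q, y)) summable_on UNIV"
proof -
  obtain C where C: "C \<ge> 0" "\<And>m p. norm (\<Psi> m p) \<le> C" using assms(1) unfolding bdd_alg_def by blast
  obtain D where D: "D \<ge> 0" "\<And>x y. norm (f (x, y)) \<le> D * wt x" using Xi_bound[OF assms(2)] by blast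
  show ?thesis
  proof (rule summable_bounded[where M = "\<lambda>q. C * D * wt (x + of_int q)"])
    show "norm (cnj (\<Psi> m q) * f (x + of_int q, y)) \<le> C * D * wt (x + of_int q)" for q
      using mult_mono[OF C(2)[of m q] D(2)[of "x + of_int q" y]] C(1) by (simp add: norm_mult mult_ac)
  qed (intro summable_on_cmult_right summable_wt_shift)
qed

lemma act_E_add:
  assumes "bdd_alg \<Psi>" "f \<in> Xi" "g \<in> Xi"
  shows "act_E \<Psi> (\<lambda>m. f m + g m) = (\<lambda>m. act_E \<Psi> f m + act_E \<Psi> g m)"
  by (auto simp: act_E_def fun_eq_iff distrib_left infsum_add act_E_summable assms)

lemma act_E_cmult: "act_E \<Psi> (\<lambda>m. a * f m) = (\<lambda>m. a * act_E \<Psi> f m)"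
  by (auto simp: act_E_def fun_eq_iff mult.left_commute infsum_cmult_right')

lemma act_E_add_alg:
  assumes "bdd_alg \<Psi>" "bdd_alg \<Psi>'" "f \<in> Xi"
  shows "act_E (\<lambda>m p. \<Psi> m p + \<Psi>' m p) f = (\<lambda>m. act_E \<Psi> f m + act_E \<Psi>' f m)"
  by (auto simp: act_E_def fun_eq_iff distrib_right infsum_add act_E_summable assms)

lemma act_E_cmult_alg: "act_E (\<lambda>m p. a * \<Psi> m p) f = (\<lambda>m. cnj a * act_E \<Psi> f m)"
  by (auto simp: act_E_def fun_eq_iff mult.assoc infsum_cmult_right')

lemma act_E_delta0: "act_E (\<lambda>m p. h m * delta0 p) f = (\<lambda>m. cnj (h m) * f m)"
proof (rule ext, clarify)
  fix x y
  have "act_E (\<lambda>m p. h m * delta0 p) f (x, y)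
      = (\<Sum>\<^sub>\<infinity>q\<in>{0::int}. cnj (h (x, y) * delta0 q) * f (x + of_int q, y))"
    unfolding act_E_def case_prod_conv by (rule infsum_cong_neutral) (auto simp: delta0_def)
  then show "act_E (\<lambda>m p. h m * delta0 p) f (x, y) = cnj (h (x, y)) * f (x, y)"
    by (simp add: delta0_def)
qed

lemma act_E_Id: "act_E (\<lambda>m p. a * Id_E m p) f = (\<lambda>m. cnj a * f m)"
  unfolding Id_E_def using act_E_delta0[of "\<lambda>m. a"] by simp

lemma act_E_Id_E [simp]: "act_E Id_E f = f"
  using act_E_Id[of 1] by simp

text \<open>Substituting p = q + r in the double sum separates the two actions; conjugation keeps
  the order of the factors. In the exchange of sums the decay in p comes from f and the decay in p -
  q from \<Psi>', while \<Psi> is only bounded.\<close>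

lemma act_E_conv:
  assumes "bdd_alg \<Psi>" "rapid \<Psi>'" "f \<in> Xi"
  shows "act_E (conv sig \<Psi> \<Psi>') f = act_E \<Psi> (act_E \<Psi>' f)"
proof (rule ext, clarify)
  fix x y
  obtain A where A: "A \<ge> 0" "\<And>m p. norm (\<Psi> m p) \<le> A" using assms(1) unfolding bdd_alg_def by blast
  obtain C where C: "C \<ge> 0" "\<And>m p. norm (\<Psi>' m p) \<le> C * wt (of_int p)"
    using assms(2) unfolding rapid_def by blast
  obtain D where D: "D \<ge> 0" "\<And>x y. norm (f (x, y)) \<le> D * wt x" using Xi_bound[OF assms(3)] by blast
  let ?t = "\<lambda>p q. cnj (\<Psi> (x, y) q) * (cnj (\<Psi>' (x + of_int q, y) (p - q)) * f (x + of_int p, y))"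
  have "act_E (conv sig \<Psi> \<Psi>') f (x, y) = (\<Sum>\<^sub>\<infinity>p. \<Sum>\<^sub>\<infinity>q. ?t p q)"
    by (simp add: act_E_def conv_def sig_def infsum_cmult_left'[symmetric] infsum_cnj[symmetric]
        mult.assoc del: infsum_cnj)
  also have "\<dots> = (\<Sum>\<^sub>\<infinity>q. \<Sum>\<^sub>\<infinity>p. ?t p q)"
  proof (rule infsum_swap_dominated[where a = "\<lambda>p. A * C * D * wt (x + of_int p)"
        and b = "\<lambda>p q. wt (of_int (p - q))" and B = "4 * wsum"])
    show "(\<lambda>p::int. A * C * D * wt (x + of_int p)) summable_on UNIV"
      by (intro summable_on_cmult_right summable_wt_shift)
    show "0 \<le> A * C * D * wt (x + of_int p)" for p using A(1) C(1) D(1) wt_nonneg by simp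
    have *: "(\<lambda>q. wt (of_int (p - q))) = (\<lambda>q. wt (of_int (- p) + of_int q))" for p
      using wt_minus[of "of_int (p - q)" for q] by (simp add: fun_eq_iff)
    show "(\<lambda>q. wt (of_int (p - q))) summable_on UNIV" for p :: int
      unfolding * by (rule summable_wt_shift)
    show "(\<Sum>\<^sub>\<infinity>q. wt (of_int (p - q))) \<le> 4 * wsum" for p :: int
      unfolding * by (rule infsum_wt_shift)
    fix p q :: int
    have "norm (?t p q) \<le> A * ((C * wt (of_int (p - q))) * (D * wt (x + of_int p)))"
      unfolding norm_mult complex_mod_cnj
      by (intro mult_mono A C D mult_nonneg_nonneg wt_nonneg) auto
    then show "norm (?t p q) \<le> A * C * D * wt (x + of_int p) * wt (of_int (p - q))"
      by (simp add: mult_ac)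
  qed
  also have "\<dots> = (\<Sum>\<^sub>\<infinity>q. cnj (\<Psi> (x, y) q) * act_E \<Psi>' f (x + of_int q, y))"
  proof (rule infsum_cong)
    fix q :: int
    have "(\<Sum>\<^sub>\<infinity>p. ?t p q) = cnj (\<Psi> (x, y) q) *
        (\<Sum>\<^sub>\<infinity>p. cnj (\<Psi>' (x + of_int q, y) (p - q)) * f (x + of_int p, y))"
      by (rule infsum_cmult_right')
    also have "(\<Sum>\<^sub>\<infinity>p. cnj (\<Psi>' (x + of_int q, y) (p - q)) * f (x + of_int p, y))
        = (\<Sum>\<^sub>\<infinity>r. cnj (\<Psi>' (x + of_int q, y) r) * f (x + of_int q + of_int r, y))"
      using infsum_int_shift[of "\<lambda>p. cnj (\<Psi>' (x + of_int q, y) (p - q)) * f (x + of_int p, y)" q]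
      by (simp add: add_ac)
    finally show "(\<Sum>\<^sub>\<infinity>p. ?t p q) = cnj (\<Psi> (x, y) q) * act_E \<Psi>' f (x + of_int q, y)"
      by (simp add: act_E_def)
  qed
  also have "\<dots> = act_E \<Psi> (act_E \<Psi>' f) (x, y)" by (simp add: act_E_def)
  finally show "act_E (conv sig \<Psi> \<Psi>') f (x, y) = act_E \<Psi> (act_E \<Psi>' f) (x, y)" .
qed

context qhm
begin

text \<open>The linking identity of the bimodule. Both sides are one double sum, the index of the
  right action being minus the lattice index of the left inner product. Decay in that index comes
  from f, decay in q from z.\<close>

lemma act_E_ipE:
  assumes f: "f \<in> Xi" and g: "g \<in> Xi" and z: "z \<in> Xi"
  shows "act_E (ipE f g) z = act_D \<mu> \<nu> f (ipD g z)"
proof (rule ext, clarify)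
  fix x y
  have L: "- 2 * \<mu> \<noteq> 0" using mu by simp
  obtain F where F: "F \<ge> 0" "\<And>x y. norm (f (x, y)) \<le> F * wt x" using Xi_bound[OF f] by blast
  obtain G where G: "G \<ge> 0" "\<And>x y. norm (g (x, y)) \<le> G * wt x" using Xi_bound[OF g] by blast
  obtain D where D: "D \<ge> 0" "\<And>x y. norm (z (x, y)) \<le> D * wt x" using Xi_bound[OF z] by blast
  have G': "norm (g (x, y)) \<le> G" for x y
    using G(2)[of x y] mult_left_mono[OF wt_le_1 G(1), of x] by simp
  let ?t = "\<lambda>k q. cnj (tE c \<mu> \<nu> f g x y q k) * z (x + of_int q, y)"
  have "act_D \<mu> \<nu> f (ipD g z) (x, y) = (\<Sum>\<^sub>\<infinity>k. f (x + 2 * of_int (- k) * \<mu>, y + 2 * of_int (- k) * \<nu>)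
      * cnj (ipD g z (x + 2 * of_int (- k) * \<mu>, y + 2 * of_int (- k) * \<nu>) (- k)))"
    unfolding act_D_def case_prod_conv
    by (rule infsum_int_minus[of "\<lambda>q. f (x + 2 * of_int q * \<mu>, y + 2 * of_int q * \<nu>)
         * cnj (ipD g z (x + 2 * of_int q * \<mu>, y + 2 * of_int q * \<nu>) q)", symmetric])
  also have "\<dots> = (\<Sum>\<^sub>\<infinity>k. \<Sum>\<^sub>\<infinity>q. ?t k q)"
  proof (rule infsum_cong)
    fix k :: int
    have "f (x + 2 * of_int (- k) * \<mu>, y + 2 * of_int (- k) * \<nu>)
        * cnj (tD c \<mu> \<nu> g z (x + 2 * of_int (- k) * \<mu>) (y + 2 * of_int (- k) * \<nu>) (- k) q) = ?t k q" for q
      by (simp add: tD_def tE_def cnj_ee algebra_simps)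
    then show "f (x + 2 * of_int (- k) * \<mu>, y + 2 * of_int (- k) * \<nu>)
      * cnj (ipD g z (x + 2 * of_int (- k) * \<mu>, y + 2 * of_int (- k) * \<nu>) (- k)) = (\<Sum>\<^sub>\<infinity>q. ?t k q)"
      unfolding ip_D_eq infsum_cnj[symmetric] infsum_cmult_right'[symmetric] by presburger
  qed
  also have "\<dots> = (\<Sum>\<^sub>\<infinity>q. \<Sum>\<^sub>\<infinity>k. ?t k q)"
  proof (rule infsum_swap_dominated[where a = "\<lambda>k. F * G * D * wt (x + of_int k * (- 2 * \<mu>))"
        and b = "\<lambda>k q. wt (x + of_int q)" and B = "4 * wsum"])
    show "(\<lambda>k::int. F * G * D * wt (x + of_int k * (- 2 * \<mu>))) summable_on UNIV"
      by (intro summable_on_cmult_right summable_wt_step L)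
    show "0 \<le> F * G * D * wt (x + of_int k * (- 2 * \<mu>))" for k :: int
      using F(1) G(1) D(1) wt_nonneg by simp
    fix k q :: int
    have "norm (?t k q) = norm (f (x - 2 * of_int k * \<mu>, y - 2 * of_int k * \<nu>)) *
        norm (g (x - 2 * of_int k * \<mu> + of_int q, y - 2 * of_int k * \<nu>)) * norm (z (x + of_int q, y))"
      by (simp add: tE_def norm_mult)
    also have "\<dots> \<le> (F * wt (x - 2 * of_int k * \<mu>)) * G * (D * wt (x + of_int q))"
      by (intro mult_mono F D G' mult_nonneg_nonneg wt_nonneg G) auto
    finally show "norm (?t k q) \<le> F * G * D * wt (x + of_int k * (- 2 * \<mu>)) * wt (x + of_int q)"
      by (simp add: algebra_simps)
  qed (rule summable_wt_shift infsum_wt_shift)+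
  also have "\<dots> = act_E (ipE f g) z (x, y)"
    by (simp add: act_E_def ip_E_eq infsum_cmult_left'[symmetric] infsum_cnj[symmetric] del: infsum_cnj)
  finally show "act_E (ipE f g) z (x, y) = act_D \<mu> \<nu> f (ipD g z) (x, y)" by simp
qed

text \<open>Covariance of \<Psi> moves its argument to the k-th lattice translate, and the two
  phases multiply to the phase of the inner product. Hence \<Psi> acts inside the first
  slot.\<close>

lemma conv_ipE:
  assumes P: "bdd_alg \<Psi>" "E_per c \<mu> \<nu> \<Psi>" and f: "f \<in> Xi" and g: "g \<in> Xi"
  shows "conv sig \<Psi> (ipE f g) = ipE (act_E \<Psi> f) g"
proof (rule ext, rule ext, clarify)
  fix x y p
  have L: "- 2 * \<mu> \<noteq> 0" using mu by simp
  obtain A where A: "A \<ge> 0" "\<And>m p. norm (\<Psi> m p) \<le> A" using P(1) unfolding bdd_alg_def by blast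
  obtain F where F: "F \<ge> 0" "\<And>x y. norm (f (x, y)) \<le> F * wt x" using Xi_bound[OF f] by blast
  obtain G where G: "G \<ge> 0" "\<And>x y. norm (g (x, y)) \<le> G * wt x" using Xi_bound[OF g] by blast
  let ?t = "\<lambda>k q. \<Psi> (x, y) q * tE c \<mu> \<nu> f g (x + of_int q) y (p - q) k"
  have t: "?t k q = ee (of_int (c * p * k) * (y - of_int k * \<nu>)) *
      cnj (cnj (\<Psi> (x - 2 * of_int k * \<mu>, y - 2 * of_int k * \<nu>) q)
        * f (x - 2 * of_int k * \<mu> + of_int q, y - 2 * of_int k * \<nu>))
      * g (x - 2 * of_int k * \<mu> + of_int p, y - 2 * of_int k * \<nu>)" for k q
  proof -
    have "\<Psi> (x, y) q = ee (of_int (c * q * k) * (y - of_int k * \<nu>))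
        * \<Psi> (x - 2 * of_int k * \<mu>, y - 2 * of_int k * \<nu>) q"
      using P(2) unfolding E_per_def by simp
    moreover have "ee (of_int (c * p * k) * (y - of_int k * \<nu>))
        = ee (of_int (c * q * k) * (y - of_int k * \<nu>)) * ee (of_int (c * (p - q) * k) * (y - of_int k * \<nu>))"
      by (simp add: ee_add[symmetric] algebra_simps)
    ultimately show ?thesis by (simp add: tE_def algebra_simps)
  qed
  have "conv sig \<Psi> (ipE f g) (x, y) p = (\<Sum>\<^sub>\<infinity>q. \<Sum>\<^sub>\<infinity>k. ?t k q)"
    by (simp add: conv_def sig_def ip_E_eq infsum_cmult_right')
  also have "\<dots> = (\<Sum>\<^sub>\<infinity>k. \<Sum>\<^sub>\<infinity>q. ?t k q)"
  \<comment> \<open>Decay in k is taken from g, whose argument is free of q; the sum over q is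
    controlled by f.\<close>
  proof (rule infsum_swap_dominated[where a = "\<lambda>k. A * F * G * wt ((x + of_int p) + of_int k * (- 2 * \<mu>))"
        and b = "\<lambda>k q. wt ((x - 2 * of_int k * \<mu>) + of_int q)" and B = "4 * wsum", symmetric])
    show "(\<lambda>k::int. A * F * G * wt ((x + of_int p) + of_int k * (- 2 * \<mu>))) summable_on UNIV"
      by (intro summable_on_cmult_right summable_wt_step L)
    show "0 \<le> A * F * G * wt ((x + of_int p) + of_int k * (- 2 * \<mu>))" for k :: int
      using A(1) F(1) G(1) wt_nonneg by simp
    fix k q :: int
    have "norm (?t k q) \<le> A * (F * wt (x - 2 * of_int k * \<mu> + of_int q)) * (G * wt (x - 2 * of_int k * \<mu> + of_int p))"
      unfolding t norm_mult complex_mod_cnj norm_ee mult_1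
      by (intro mult_mono A F G mult_nonneg_nonneg wt_nonneg) auto
    also have "x - 2 * of_int k * \<mu> + of_int p = (x + of_int p) + of_int k * (- 2 * \<mu>)"
      by (simp add: algebra_simps)
    finally show "norm (?t k q) \<le> A * F * G * wt ((x + of_int p) + of_int k * (- 2 * \<mu>))
        * wt ((x - 2 * of_int k * \<mu>) + of_int q)"
      by (simp add: mult_ac)
  qed (rule summable_wt_shift infsum_wt_shift)+
  also have "\<dots> = ipE (act_E \<Psi> f) g (x, y) p"
    unfolding ip_E_eq
  proof (rule infsum_cong)
    show "(\<Sum>\<^sub>\<infinity>q. ?t k q) = tE c \<mu> \<nu> (act_E \<Psi> f) g x y p k" for k
      unfolding t
      unfolding tE_def act_E_def case_prod_conv infsum_cnj[symmetric]
        infsum_cmult_right'[symmetric] infsum_cmult_left'[symmetric] by (rule refl)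
  qed
  finally show "conv sig \<Psi> (ipE f g) (x, y) p = ipE (act_E \<Psi> f) g (x, y) p" .
qed

lemma act_E_act_ipE:
  assumes "bdd_alg \<Psi>" "E_per c \<mu> \<nu> \<Psi>" "f \<in> Xi" "g \<in> Xi" "z \<in> Xi"
  shows "act_E \<Psi> (act_E (ipE f g) z) = act_E (ipE (act_E \<Psi> f) g) z"
  using act_E_conv[OF assms(1) rapid_ipE[OF assms(3,4)] assms(5)] conv_ipE[OF assms(1-4)] by simp

end


subsection \<open>Bump functions\<close>

text \<open>Infinite differentiability in coinductive form: a set closed under derivatives is the
  witness.\<close>

definition smooth1 :: "(real \<Rightarrow> real) \<Rightarrow> bool" where
  "smooth1 u \<longleftrightarrow> (\<exists>U. u \<in> U \<and> (\<forall>v\<in>U. \<exists>v'\<in>U. \<forall>x. (v has_real_derivative v' x) (at x)))"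

lemma smooth1_deriv:
  assumes "smooth1 u"
  obtains u' where "smooth1 u'" "\<And>x. (u has_real_derivative u' x) (at x)"
  using assms unfolding smooth1_def by metis

lemma smooth1I:
  assumes "u \<in> U" "\<And>v. v \<in> U \<Longrightarrow> \<exists>v'\<in>U. \<forall>x. (v has_real_derivative v' x) (at x)"
  shows "smooth1 u"
  unfolding smooth1_def using assms by blast

lemma smooth1_antiderivative:
  assumes "smooth1 u'" "\<And>x. (u has_real_derivative u' x) (at x)"
  shows "smooth1 u"
proof -
  obtain U where U: "u' \<in> U" "\<And>v. v \<in> U \<Longrightarrow> \<exists>v'\<in>U. \<forall>x. (v has_real_derivative v' x) (at x)"
    using assms(1) unfolding smooth1_def by blast
  show ?thesis
    by (rule smooth1I[of _ "insert u U"]) (use U assms(2) in blast)+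
qed

lemma smooth1_0: "smooth1 (\<lambda>x. 0)"
  by (rule smooth1I[of _ "{\<lambda>x. 0}"]) auto

text \<open>The scalar r varies within the invariant set, because each derivative multiplies it by
  s.\<close>

lemma smooth1_affine: "smooth1 u \<Longrightarrow> smooth1 (\<lambda>x. r * u (s * x + t))"
proof (rule smooth1I[of _ "{\<lambda>x. r * u (s * x + t) | r u. smooth1 u}"])
  fix v assume "v \<in> {\<lambda>x. r * u (s * x + t) | r u. smooth1 u}"
  then obtain r u where v: "v = (\<lambda>x. r * u (s * x + t))" "smooth1 u" by blast
  obtain u' where u': "smooth1 u'" "\<And>x. (u has_real_derivative u' x) (at x)"
    using smooth1_deriv[OF v(2)] by blast
  have "(v has_real_derivative (r * s) * u' (s * x + t)) (at x)" for x
    unfolding v(1) by (rule derivative_eq_intros DERIV_chain2[OF u'(2)] refl | simp)+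
  moreover have "(\<lambda>x. (r * s) * u' (s * x + t)) \<in> {\<lambda>x. r * u (s * x + t) | r u. smooth1 u}"
    using u'(1) by blast
  ultimately show "\<exists>v'\<in>{\<lambda>x. r * u (s * x + t) | r u. smooth1 u}. \<forall>x. (v has_real_derivative v' x) (at x)"
    by (rule_tac bexI) (rule allI)
qed blast

lemma smooth1_diff: "smooth1 u \<Longrightarrow> smooth1 v \<Longrightarrow> smooth1 (\<lambda>x. u x - v x)"
proof (rule smooth1I[of _ "{\<lambda>x. u x - v x | u v. smooth1 u \<and> smooth1 v}"])
  fix w assume "w \<in> {\<lambda>x. u x - v x | u v. smooth1 u \<and> smooth1 v}"
  then obtain u v where w: "w = (\<lambda>x. u x - v x)" "smooth1 u" "smooth1 v" by blast
  obtain u' where u': "smooth1 u'" "\<And>x. (u has_real_derivative u' x) (at x)"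
    using smooth1_deriv[OF w(2)] by blast
  obtain v' where v': "smooth1 v'" "\<And>x. (v has_real_derivative v' x) (at x)"
    using smooth1_deriv[OF w(3)] by blast
  have "(w has_real_derivative u' x - v' x) (at x)" for x
    unfolding w(1) by (rule DERIV_diff[OF u'(2) v'(2)])
  moreover have "(\<lambda>x. u' x - v' x) \<in> {\<lambda>x. u x - v x | u v. smooth1 u \<and> smooth1 v}"
    using u'(1) v'(1) by blast
  ultimately show "\<exists>v'\<in>{\<lambda>x. u x - v x | u v. smooth1 u \<and> smooth1 v}. \<forall>x. (w has_real_derivative v' x) (at x)"
    by (rule_tac bexI) (rule allI)
qed blast

text \<open>Compactly supported smooth functions of x alone. The derivative vanishes wherever |x| >
  R because that set is open, so the class is stable, and compactness bounds every x^n v.\<close>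

lemma Xi_smooth1:
  assumes "smooth1 u" "\<And>x. \<bar>x\<bar> > R \<Longrightarrow> u x = 0"
  shows "(\<lambda>m. of_real (u (fst m))) \<in> Xi"
proof -
  let ?V = "{v. smooth1 v \<and> (\<exists>R. \<forall>x. \<bar>x\<bar> > R \<longrightarrow> v x = 0)}"
  let ?S = "{\<lambda>m. complex_of_real (v (fst m)) | v. v \<in> ?V} :: vec set"
  have der: "\<exists>v'\<in>?V. \<forall>x. (v has_real_derivative v' x) (at x)" if v: "v \<in> ?V" for v
  proof -
    obtain R where R: "\<And>x. \<bar>x\<bar> > R \<Longrightarrow> v x = 0" using v by blast
    obtain v' where v': "smooth1 v'" "\<And>x. (v has_real_derivative v' x) (at x)"
      using smooth1_deriv v by blast
    have "v' x = 0" if "\<bar>x\<bar> > R" for x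
    proof -
      have "((\<lambda>x. 0) has_real_derivative 0) (at x)" by simp
      then have "(v has_real_derivative 0) (at x)"
        by (rule has_field_derivative_transform_within_open[where S = "{x. \<bar>x\<bar> > R}"])
          (use that R in simp_all, rule open_Collect_less, (intro continuous_intros)+)
      then show ?thesis using v'(2) DERIV_unique by blast
    qed
    with v' show ?thesis by blast
  qed
  have cont: "continuous_on UNIV v" if v: "v \<in> ?V" for v
  proof -
    obtain v' where "\<And>x. (v has_real_derivative v' x) (at x)" using der[OF v] by blast
    then show ?thesis by (intro continuous_at_imp_continuous_on ballI DERIV_isCont)
  qed
  have dx: "((\<lambda>s. complex_of_real (v s)) has_vector_derivative of_real (v' x)) (at x)"
    if "\<And>x. (v has_real_derivative v' x) (at x)" for v v' :: "real \<Rightarrow> real" and x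
    by (rule has_vector_derivative_of_real[OF that])
  show ?thesis
  proof (rule Xi_coinduct[where S = ?S])
    show "(\<lambda>m. of_real (u (fst m))) \<in> ?S" using assms by blast
    fix f assume "f \<in> ?S"
    then obtain v where f: "f = (\<lambda>m. of_real (v (fst m)))" and v: "v \<in> ?V" by blast
    obtain v' where v': "v' \<in> ?V" "\<And>x. (v has_real_derivative v' x) (at x)" using der[OF v] by blast
    show "periodic_T f" by (simp add: f periodic_T_def)
    show "continuous_on UNIV f" unfolding f
      by (intro continuous_on_of_real continuous_on_compose2[OF cont[OF v]] continuous_on_fst continuous_on_id) auto
    show "(\<lambda>s. f (s, y)) differentiable at x" for x y
      using dx[OF v'(2)] by (auto simp: f intro: differentiableI_vector)
    show "(\<lambda>s. f (x, s)) differentiable at y" for x y by (simp add: f)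
    have "dx f = (\<lambda>m. of_real (v' (fst m)))"
      by (rule dx_eqI) (use dx[OF v'(2)] in \<open>simp add: f\<close>)
    then show "dx f \<in> ?S" using v'(1) by blast
    have "dy f = (\<lambda>m. of_real ((\<lambda>x. 0) (fst m)))"
      by (rule dy_eqI) (simp add: f)
    then show "dy f \<in> ?S" using smooth1_0 by (intro CollectI exI[of _ "\<lambda>x. 0"]) simp
    fix n
    obtain R where R: "\<And>x. \<bar>x\<bar> > R \<Longrightarrow> v x = 0" using v by blast
    have "compact ((\<lambda>x. x ^ n * v x) ` {-R..R})"
      by (intro compact_continuous_image continuous_intros continuous_on_subset[OF cont[OF v]]) auto
    from compact_imp_bounded[OF this] obtain B where "\<forall>z\<in>(\<lambda>x. x ^ n * v x) ` {-R..R}. norm z \<le> B"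
      by (auto simp only: bounded_iff)
    then have B: "norm (x ^ n * v x) \<le> B" if "x \<in> {-R..R}" for x
      using that by (rule bspec[OF _ imageI])
    have "norm (of_real x ^ n * f (x, y)) \<le> max B 0" for x y
    proof (cases "\<bar>x\<bar> > R")
      case False
      then have "norm (x ^ n * v x) \<le> B" by (intro B) auto
      then show ?thesis by (simp add: f norm_mult norm_power abs_mult power_abs)
    qed (simp add: R f)
    then show "bounded (range (\<lambda>(x, y). of_real x ^ n * f (x, y)))"
      unfolding bounded_iff by (intro exI[of _ "max B 0"]) auto
  qed
qed

section \<open>The bump exp(-1 / (x (1 - x))) and a smooth step\<close>

definition bump_poly :: "real poly" where "bump_poly = [:0, 1, -1:]"

lemma poly_bump_poly: "poly bump_poly x = x * (1 - x)"
  by (simp add: bump_poly_def algebra_simps)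

text \<open>The polynomial factor and the power make the family closed under differentiation.\<close>

definition bumpf :: "real poly \<Rightarrow> nat \<Rightarrow> real \<Rightarrow> real" where
  "bumpf P n x = (if 0 < x \<and> x < 1 then poly P x * exp (- 1 / poly bump_poly x) / poly bump_poly x ^ n else 0)"

text \<open>The exponential beats every power of x (1 - x). Quadratic vanishing at both endpoints
  forces the derivative there to be zero.\<close>

lemma bumpf_quadratic:
  obtains K where "\<And>x x0. x0 \<in> {0, 1} \<Longrightarrow> \<bar>bumpf P n x\<bar> \<le> K * (x - x0)\<^sup>2"
proof -
  have "compact (poly P ` {0..1})" by (intro compact_continuous_image continuous_intros) auto
  from compact_imp_bounded[OF this] obtain M where "\<forall>z\<in>poly P ` {0..1}. norm z \<le> M"
    by (auto simp only: bounded_iff)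
  then have M: "norm (poly P x) \<le> M" if "x \<in> {0..1}" for x
    using that by (rule bspec[OF _ imageI])
  have M0: "0 \<le> M" using order_trans[OF norm_ge_zero M[of 0]] by simp
  have "\<bar>bumpf P n x\<bar> \<le> (M * fact (n + 2)) * (x - x0)\<^sup>2" if "x0 \<in> {0, 1}" for x x0
  proof (cases "0 < x \<and> x < 1")
    case True
    define v where "v = poly bump_poly x"
    have v: "0 < v" using True by (simp add: v_def poly_bump_poly)
    have vx: "v \<le> \<bar>x - x0\<bar>" using that True by (auto simp: v_def poly_bump_poly mult_le_cancel_left1)
    \<comment> \<open>A single term of the exponential series gives v^-(n+2) at most (n+2)!
      exp(1/v); the two extra powers become the factor v^2.\<close>
    have "(\<Sum>k\<in>{n + 2}. inverse (fact k) * (1 / v) ^ k) \<le> (\<Sum>k. inverse (fact k) * (1 / v) ^ k)"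
      by (rule sum_le_suminf[OF summable_exp]) (use v in simp_all)
    then have "(1 / v) ^ (n + 2) / fact (n + 2) \<le> exp (1 / v)"
      by (simp add: exp_def divide_inverse mult.commute)
    then have "(1 / v) ^ (n + 2) \<le> fact (n + 2) * exp (1 / v)"
      by (simp only: pos_divide_le_eq[OF fact_gt_zero] mult.commute)
    then have "(1 / v) ^ n * (1 / v)\<^sup>2 * v\<^sup>2 \<le> fact (n + 2) * exp (1 / v) * v\<^sup>2"
      unfolding power_add by (rule mult_right_mono) simp
    then have 1: "exp (- 1 / v) / v ^ n \<le> fact (n + 2) * v\<^sup>2"
      using v by (simp add: exp_minus field_simps)
    have "\<bar>bumpf P n x\<bar> = \<bar>poly P x\<bar> * (exp (- 1 / v) / v ^ n)"
      using True v by (simp add: bumpf_def v_def[symmetric] abs_mult)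
    also have "\<dots> \<le> M * (fact (n + 2) * v\<^sup>2)"
      using M[of x] True v by (intro mult_mono 1 M0) auto
    also have "\<dots> \<le> M * (fact (n + 2) * (x - x0)\<^sup>2)"
    proof -
      have "v\<^sup>2 \<le> \<bar>x - x0\<bar>\<^sup>2" by (rule power_mono[OF vx]) (use v in simp)
      then show ?thesis using M0 by (intro mult_left_mono) auto
    qed
    finally show ?thesis by (simp add: mult_ac)
  next
    case False
    then have "bumpf P n x = 0" by (auto simp: bumpf_def)
    then show ?thesis using M0 by simp
  qed
  then show thesis by (rule that)
qed

text \<open>With v = x (1 - x), differentiating P exp(-1/v) / v^n gives P' v^-n - n P v' v^-(n+1) +
  P v' v^-(n+2) times the exponential; the polynomial collects these over v^(n+2).\<close>

lemma bumpf_deriv: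
  "(bumpf P n has_real_derivative
    bumpf (pderiv P * bump_poly\<^sup>2 - smult (of_nat n) (P * pderiv bump_poly * bump_poly) + P * pderiv bump_poly) (n + 2) x) (at x)"
  (is "(_ has_real_derivative bumpf ?Q _ _) _")
proof -
  consider "0 < x \<and> x < 1" | "x < 0 \<or> 1 < x" | "x \<in> {0, 1}" by force
  then show ?thesis
  proof cases
    case 1
    define v where "v = poly bump_poly x"
    have v: "v \<noteq> 0" using 1 by (simp add: v_def poly_bump_poly)
    have "((\<lambda>x. poly P x * exp (- 1 / poly bump_poly x) / poly bump_poly x ^ n) has_real_derivative
        poly ?Q x * exp (- 1 / poly bump_poly x) / poly bump_poly x ^ (n + 2)) (at x)"
    proof -
      have d: "((\<lambda>x. poly P x * exp (- inverse (poly bump_poly x)) * inverse (poly bump_poly x) ^ n) has_real_derivative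
        poly P x * exp (- inverse v) * (of_nat n * (- (inverse v * poly (pderiv bump_poly) x * inverse v)) * inverse v ^ (n - 1))
        + (poly P x * (exp (- inverse v) * - (- (inverse v * poly (pderiv bump_poly) x * inverse v)))
          + poly (pderiv P) x * exp (- inverse v)) * inverse v ^ n) (at x)"
        unfolding v_def
        by (rule derivative_eq_intros poly_DERIV refl | use v in \<open>simp add: v_def\<close>)+
      \<comment> \<open>Here i, j, k stand for v^-1, v^-(n-1), v^-n. The relation between j and k
        carries the factor nn because at n = 0 the exponent n - 1 truncates to 0.\<close>
      have ring: "(B * v\<^sup>2 - nn * A * w * v + A * w) * e * k * i\<^sup>2
          = A * e * (nn * (- (i * w * i)) * j) + (A * (e * - (- (i * w * i))) + B * e) * k"
        if "v * i = 1" "nn * j = nn * v * k" for A B e i j k nn v w :: real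
        using that by algebra
      have "poly ?Q x * exp (- 1 / v) / v ^ (n + 2)
          = (poly (pderiv P) x * v\<^sup>2 - of_nat n * poly P x * poly (pderiv bump_poly) x * v + poly P x * poly (pderiv bump_poly) x)
            * exp (- inverse v) * inverse v ^ n * (inverse v)\<^sup>2"
        by (simp add: v_def[symmetric] power_add divide_inverse power_inverse mult.assoc power2_eq_square)
      also have "\<dots> = poly P x * exp (- inverse v) * (of_nat n * (- (inverse v * poly (pderiv bump_poly) x * inverse v)) * inverse v ^ (n - 1))
        + (poly P x * (exp (- inverse v) * - (- (inverse v * poly (pderiv bump_poly) x * inverse v)))
          + poly (pderiv P) x * exp (- inverse v)) * inverse v ^ n"
        by (rule ring) (use v in \<open>cases n; simp\<close>)+
      finally have "poly ?Q x * exp (- 1 / poly bump_poly x) / poly bump_poly x ^ (n + 2) = \<dots>" by (simp add: v_def)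
      with d show ?thesis by (simp add: divide_inverse power_inverse)
    qed
    then have "(bumpf P n has_real_derivative poly ?Q x * exp (- 1 / poly bump_poly x) / poly bump_poly x ^ (n + 2)) (at x)"
      by (rule has_field_derivative_transform_within_open[where S = "{0<..<1}"]) (use 1 in \<open>auto simp: bumpf_def\<close>)
    then show ?thesis using 1 by (simp add: bumpf_def)
  next
    case 2
    have "((\<lambda>x. 0) has_real_derivative 0) (at x)" by simp
    then have "(bumpf P n has_real_derivative 0) (at x)"
      by (rule has_field_derivative_transform_within_open[where S = "{..<0} \<union> {1<..}"])
        (use 2 in \<open>auto simp: bumpf_def\<close>)
    then show ?thesis using 2 by (auto simp: bumpf_def)
  next
    case 3
    obtain K where K: "\<And>x x0. x0 \<in> {0, 1} \<Longrightarrow> \<bar>bumpf P n x\<bar> \<le> K * (x - x0)\<^sup>2"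
      using bumpf_quadratic by blast
    have 0: "bumpf P n x = 0" using 3 by (auto simp: bumpf_def)
    have "((\<lambda>h. bumpf P n (x + h) / h) \<longlongrightarrow> 0) (at 0)"
    proof (rule Lim_null_comparison[where g = "\<lambda>h. \<bar>K * h\<bar>"])
      show "\<forall>\<^sub>F h in at 0. norm (bumpf P n (x + h) / h) \<le> \<bar>K * h\<bar>"
      proof (rule eventually_at_filter[THEN iffD2], intro always_eventually allI impI)
        fix h :: real assume "h \<noteq> 0"
        have "\<bar>bumpf P n (x + h)\<bar> \<le> \<bar>K * h\<bar> * \<bar>h\<bar>"
          using K[OF 3, of "x + h"] by (simp add: power2_eq_square abs_mult[symmetric] mult.assoc)
        then show "norm (bumpf P n (x + h) / h) \<le> \<bar>K * h\<bar>"
          using \<open>h \<noteq> 0\<close> by (simp add: abs_divide pos_divide_le_eq)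
      qed
      show "((\<lambda>h. \<bar>K * h\<bar>) \<longlongrightarrow> 0) (at 0)" by (auto intro!: tendsto_eq_intros)
    qed
    then have "(bumpf P n has_real_derivative 0) (at x)" unfolding DERIV_def 0 by simp
    then show ?thesis using 3 by (auto simp: bumpf_def)
  qed
qed

lemma smooth1_bumpf: "smooth1 (bumpf P n)"
  by (rule smooth1I[of _ "{bumpf P n | P n. True}"]) (use bumpf_deriv in blast)+

text \<open>The normalized antiderivative of a bump supported in [0, 1].\<close>

lemma smooth_step: "\<exists>\<sigma>. smooth1 \<sigma> \<and> (\<forall>x\<le>0. \<sigma> x = 0) \<and> (\<forall>x\<ge>1. \<sigma> x = 1)"
proof -
  define b where "b = bumpf 1 0"
  \<comment> \<open>The integral starts at -1, so that points x at or above 0 are interior to the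
    interval on which it is differentiated.\<close>
  define s where "s = (\<lambda>x. integral {-1..x} b)"
  have b: "continuous_on A b" for A
    unfolding b_def by (rule DERIV_continuous_on) (rule has_field_derivative_at_within[OF bumpf_deriv])
  have b0: "b x = 0" if "x \<le> 0 \<or> x \<ge> 1" for x using that by (auto simp: b_def bumpf_def)
  have bp: "b x > 0" if "0 < x" "x < 1" for x using that by (simp add: b_def bumpf_def)
  have bn: "b x \<ge> 0" for x by (simp add: b_def bumpf_def)
  have s0: "s x = 0" if "x \<le> 0" for x
  proof -
    have "integral {-1..x} b = integral {-1..x} (\<lambda>x. 0)"
      by (rule integral_cong) (use that b0 in auto)
    then show ?thesis by (simp add: s_def)
  qed
  have s': "(s has_real_derivative b x) (at x)" for x
  proof (cases "x < 0")
    case True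
    have "((\<lambda>x. 0) has_real_derivative 0) (at x)" by simp
    then have "(s has_real_derivative 0) (at x)"
      by (rule has_field_derivative_transform_within_open[where S = "{..<0}"]) (use True s0 in auto)
    then show ?thesis using True b0 by simp
  next
    case False
    have "(s has_real_derivative b x) (at x within {-1..x+1})"
      unfolding s_def by (rule integral_has_real_derivative[OF b]) (use False in auto)
    moreover have "at x within {-1..x+1} = at x"
      by (rule at_within_interior) (use False in auto)
    ultimately show ?thesis by simp
  qed
  have mono: "s x \<le> s y" if "x \<le> y" for x y
    by (rule DERIV_nonneg_imp_nondecreasing[OF that]) (use s' bn in blast)
  \<comment> \<open>The bump vanishes at 0 and 1, so strict growth is read off on a closed
    subinterval of (0, 1).\<close>
  have "s (1/4) < s (3/4)"
    by (rule DERIV_pos_imp_increasing) (use s' bp in \<open>auto intro!: exI\<close>)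
  then have I: "s 1 > 0" using mono[of 0 "1/4"] mono[of "3/4" 1] s0[of 0] by simp
  have s1: "s x = s 1" if "x \<ge> 1" for x
  proof (cases "x = 1")
    case False
    then have "1 < x" using that by simp
    then obtain z where "1 < z" "z < x" "s x - s 1 = (x - 1) * b z"
      using MVT2[of 1 x s b] s' by auto
    then show ?thesis using b0[of z] by simp
  qed simp
  have "smooth1 s" by (rule smooth1_antiderivative[OF _ s']) (simp add: b_def smooth1_bumpf)
  then have "smooth1 (\<lambda>x. (1 / s 1) * s (1 * x + 0))" by (rule smooth1_affine)
  moreover have "(1 / s 1) * s (1 * x + 0) = 0" if "x \<le> 0" for x using s0[OF that] by simp
  moreover have "(1 / s 1) * s (1 * x + 0) = 1" if "x \<ge> 1" for x
    using I unfolding mult_1 add_0_right s1[OF that] by simp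
  ultimately show ?thesis by blast
qed

definition step :: "real \<Rightarrow> real" where
  "step = (SOME \<sigma>. smooth1 \<sigma> \<and> (\<forall>x\<le>0. \<sigma> x = 0) \<and> (\<forall>x\<ge>1. \<sigma> x = 1))"

lemma smooth1_step: "smooth1 step"
  and step_0: "x \<le> 0 \<Longrightarrow> step x = 0"
  and step_1: "x \<ge> 1 \<Longrightarrow> step x = 1"
  using someI_ex[OF smooth_step] unfolding step_def by blast+

text \<open>Far to the left both steps are 0, far to the right both are 1, so the difference has
  compact support.\<close>

lemma Xi_step_diff:
  assumes "r > 0"
  shows "(\<lambda>m. complex_of_real (step (r * fst m + s) - step (r * fst m + t))) \<in> Xi"
proof (rule Xi_smooth1[where R = "(1 + \<bar>s\<bar> + \<bar>t\<bar>) / r"])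
  have "smooth1 (\<lambda>x. 1 * step (r * x + s) - 1 * step (r * x + t))"
    by (intro smooth1_diff smooth1_affine smooth1_step)
  then show "smooth1 (\<lambda>x. step (r * x + s) - step (r * x + t))" by simp
  fix x assume "\<bar>x\<bar> > (1 + \<bar>s\<bar> + \<bar>t\<bar>) / r"
  then have x: "\<bar>r * x\<bar> > 1 + \<bar>s\<bar> + \<bar>t\<bar>" using assms by (simp add: field_simps abs_mult)
  show "step (r * x + s) - step (r * x + t) = 0"
  proof (cases "r * x > 0")
    case True
    then show ?thesis using x by (subst (1 2) step_1) auto
  next
    case False
    then show ?thesis using x by (subst (1 2) step_0) auto
  qed
qed

text \<open>A function that is 1 at x + q0 and 0 at the other points of x + Z reads off the
  coefficient at q0. This gives uniqueness of the element inducing a curvature operator.\<close>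

lemma act_E_faithful:
  assumes "\<And>\<xi>. \<xi> \<in> Xi \<Longrightarrow> act_E \<Psi> \<xi> = act_E \<Psi>' \<xi>"
  shows "\<Psi> = \<Psi>'"
proof (rule ext, rule ext, clarify)
  fix x y :: real and q0 :: int
  \<comment> \<open>In t, the distance from x + q0, this is step(5t + 1) - step(5t - 1): it is 1 at
    t = 0 and supported in [-1/5, 2/5], which contains no other integer.\<close>
  define \<xi> :: vec where "\<xi> = (\<lambda>m. of_real (step (5 * fst m + (1 - 5 * (x + of_int q0))) - step (5 * fst m + (- 1 - 5 * (x + of_int q0)))))"
  have Xi: "\<xi> \<in> Xi" unfolding \<xi>_def by (rule Xi_step_diff) simp
  have \<xi>: "\<xi> (x + of_int q, y) = (if q = q0 then 1 else 0)" for q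
  proof -
    have eq: "5 * (x + of_int q) + (1 - 5 * (x + of_int q0)) = of_int (5 * (q - q0) + 1)"
      "5 * (x + of_int q) + (- 1 - 5 * (x + of_int q0)) = of_int (5 * (q - q0) - 1)"
      by simp_all
    consider "q = q0" | "q \<ge> q0 + 1" | "q \<le> q0 - 1" by linarith
    then show ?thesis
    proof cases
      case 1 then show ?thesis unfolding \<xi>_def fst_conv eq by (simp add: step_0 step_1)
    next
      case 2
      then have "real_of_int (5 * (q - q0) + 1) \<ge> real_of_int 1" "real_of_int (5 * (q - q0) - 1) \<ge> real_of_int 1"
        unfolding of_int_le_iff by simp_all
      then show ?thesis unfolding \<xi>_def fst_conv eq using 2 by (simp add: step_1)
    next
      case 3
      then have "real_of_int (5 * (q - q0) + 1) \<le> real_of_int 0" "real_of_int (5 * (q - q0) - 1) \<le> real_of_int 0"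
        unfolding of_int_le_iff by simp_all
      then show ?thesis unfolding \<xi>_def fst_conv eq using 3 by (simp add: step_0)
    qed
  qed
  have act: "act_E \<Psi> \<xi> (x, y) = cnj (\<Psi> (x, y) q0)" for \<Psi>
  proof -
    have "act_E \<Psi> \<xi> (x, y) = (\<Sum>\<^sub>\<infinity>q\<in>{q0}. cnj (\<Psi> (x, y) q) * \<xi> (x + of_int q, y))"
      unfolding act_E_def case_prod_conv by (rule infsum_cong_neutral) (auto simp: \<xi>)
    then show ?thesis by (simp add: \<xi>)
  qed
  show "\<Psi> (x, y) q0 = \<Psi>' (x, y) q0"
    using assms[OF Xi] act[of \<Psi>] act[of \<Psi>'] by simp
qed


subsection \<open>A frame of the module\<close>

lemma sum_telescope_int:
  fixes T :: "int \<Rightarrow> complex"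
  shows "(\<Sum>k\<in>{a..<a + int n}. T k - T (k + 1)) = T a - T (a + int n)"
proof (induction n)
  case (Suc n)
  have "{a..<a + int (Suc n)} = insert (a + int n) {a..<a + int n}" by auto
  then show ?case using Suc by (simp add: algebra_simps)
qed simp

lemma infsum_telescope_int:
  fixes T :: "int \<Rightarrow> complex"
  assumes "\<And>k. k \<le> - int K \<Longrightarrow> T k = 1" "\<And>k. k \<ge> int K \<Longrightarrow> T k = 0"
  shows "(\<Sum>\<^sub>\<infinity>k. T k - T (k + 1)) = 1"
proof -
  have "(\<Sum>\<^sub>\<infinity>k. T k - T (k + 1)) = (\<Sum>\<^sub>\<infinity>k\<in>{- int K..<- int K + int (2 * K)}. T k - T (k + 1))"
    by (rule infsum_cong_neutral) (use assms in auto)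
  also have "\<dots> = T (- int K) - T (- int K + int (2 * K))"
    unfolding infsum_finite[OF finite_atLeastLessThan_int] by (rule sum_telescope_int)
  also have "\<dots> = 1" using assms(1)[of "- int K"] assms(2)[of "int K"] by simp
  finally show ?thesis .
qed

lemma infsum_sum:
  fixes f :: "'i \<Rightarrow> 'a \<Rightarrow> complex"
  assumes "finite I" "\<And>i. i \<in> I \<Longrightarrow> f i summable_on A"
  shows "(\<Sum>\<^sub>\<infinity>k\<in>A. \<Sum>i\<in>I. f i k) = (\<Sum>i\<in>I. infsum (f i) A) \<and> (\<lambda>k. \<Sum>i\<in>I. f i k) summable_on A"
  using assms by (induction I rule: finite_induct) (auto simp: infsum_add intro: summable_on_add)

context qhm
begin

text \<open>The supports of \<open>f i\<close> and \<open>g i\<close> have no common point modulo nontrivial integer translations, which kills the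
  components with \<open>p \<noteq> 0\<close>; for \<open>p = 0\<close> the sum telescopes over the translates by \<open>2\<mu>\<close>.\<close>

lemma frame_exists:
  "\<exists>(N::nat) f g. (\<forall>i<N. f i \<in> Xi \<and> g i \<in> Xi) \<and> (\<forall>m p. (\<Sum>i<N. ipE (f i) (g i) m p) = Id_E m p)"
proof -
  define L where "L = 2 * \<bar>\<mu>\<bar>"
  have L: "L > 0" using mu by (simp add: L_def)
  \<comment> \<open>With h = L / N this makes h at most 1/5, which keeps the supports below shorter
    than the integer spacing.\<close>
  define N where "N = nat \<lceil>5 * L\<rceil>"
  have N: "real N \<ge> 5 * L" unfolding N_def by linarith
  then have N0: "real N > 0" using L by linarith
  define h where "h = L / real N"
  have h: "0 < h" "h \<le> 1 / 5" using N N0 L by (simp_all add: h_def field_simps)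
  have hN: "real N * h = L" using N0 by (simp add: h_def)
  \<comment> \<open>The function \<open>ph\<close> vanishes outside (0, h + 1/5), and
    \<open>ch\<close> is 1 there. As \<open>ch\<close> vanishes outside (-1/5, 3/5), no nonzero
    integer translate of the support of \<open>ph\<close> meets its support.\<close>
  define ch where "ch = (\<lambda>x. step (5 * x + 1) - step (5 * x + (- 1 - 5 * h)))"
  define ph where "ph = (\<lambda>x. step (5 * x) - step (5 * x - 5 * h))"
  define f :: "nat \<Rightarrow> vec" where "f = (\<lambda>i m. of_real (ch (fst m - real i * h)))"
  define g :: "nat \<Rightarrow> vec" where "g = (\<lambda>i m. of_real (ph (fst m - real i * h)))"
  have f: "f i \<in> Xi" for i
    using Xi_step_diff[of 5 "1 - 5 * (real i * h)" "- 1 - 5 * h - 5 * (real i * h)"]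
    by (simp add: f_def ch_def algebra_simps)
  have g: "g i \<in> Xi" for i
    using Xi_step_diff[of 5 "- 5 * (real i * h)" "- 5 * h - 5 * (real i * h)"]
    by (simp add: g_def ph_def algebra_simps)
  have prod: "ch x * ph (x + of_int p) = (if p = 0 then ph x else 0)" for x p
  proof (cases "p = 0")
    case True
    have "ch x = 1" if "ph x \<noteq> 0"
    proof -
      have "0 < x" using that h by (auto simp: ph_def step_0 intro: ccontr)
      moreover have "5 * x < 5 * h + 1" using that h by (auto simp: ph_def step_1 intro: ccontr)
      ultimately show ?thesis by (simp add: ch_def step_0 step_1)
    qed
    then show ?thesis using True by auto
  next
    case False
    have "ph (x + of_int p) = 0" if "ch x \<noteq> 0"
    proof -
      have lower: "- 1 < 5 * x"
      proof (rule ccontr)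
        assume "\<not> - 1 < 5 * x"
        then have "ch x = 0" using h by (simp add: ch_def step_0)
        with that show False by simp
      qed
      have upper: "5 * x < 2 + 5 * h"
      proof (rule ccontr)
        assume "\<not> 5 * x < 2 + 5 * h"
        then have "ch x = 0" using h by (simp add: ch_def step_1)
        with that show False by simp
      qed
      consider "p \<ge> 1" | "p \<le> - 1" using False by linarith
      then show ?thesis
      proof cases
        case 1
        then have "real_of_int p \<ge> real_of_int 1" unfolding of_int_le_iff .
        then show ?thesis using lower h by (simp add: ph_def step_1)
      next
        case 2
        then have "real_of_int p \<le> real_of_int (- 1)" unfolding of_int_le_iff .
        then show ?thesis using upper h by (simp add: ph_def step_0)
      qed
    qed
    then show ?thesis using False by auto
  qed
  have sum_ph: "(\<Sum>i<n. ph (x - real i * h)) = step (5 * x) - step (5 * (x - real n * h))" for n x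
    by (induction n) (simp_all add: ph_def algebra_simps)
  have "(\<Sum>i<N. ipE (f i) (g i) (x, y) p) = Id_E (x, y) p" for x y p
  proof -
    have t: "tE c \<mu> \<nu> (f i) (g i) x y p k = (if p = 0 then of_real (ph (x - 2 * of_int k * \<mu> - real i * h)) else 0)" for i k
    proof -
      have "tE c \<mu> \<nu> (f i) (g i) x y p k = ee (of_int (c * p * k) * (y - of_int k * \<nu>)) *
          of_real (ch (x - 2 * of_int k * \<mu> - real i * h) * ph (x - 2 * of_int k * \<mu> - real i * h + of_int p))"
        by (simp add: tE_def f_def g_def algebra_simps)
      then show ?thesis unfolding prod by simp
    qed
    have "(\<Sum>i<N. ipE (f i) (g i) (x, y) p) = (\<Sum>\<^sub>\<infinity>k. \<Sum>i<N. tE c \<mu> \<nu> (f i) (g i) x y p k)"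
      unfolding ip_E_eq using infsum_sum[of "{..<N}" "\<lambda>i. tE c \<mu> \<nu> (f i) (g i) x y p" UNIV] tE_summable[OF f g]
      by simp
    also have "\<dots> = Id_E (x, y) p"
    proof (cases "p = 0")
      case True
      define T where "T = (\<lambda>k::int. complex_of_real (step (5 * (x - of_int k * L))))"
      define F where "F = (\<lambda>k. T k - T (k + 1))"
      \<comment> \<open>The sum over i telescopes over N steps of length h, that is over one period
        L = 2|\<mu>|. For negative \<mu> the lattice is traversed in the opposite direction.\<close>
      have eq: "(\<Sum>i<N. tE c \<mu> \<nu> (f i) (g i) x y p k) = F (if \<mu> > 0 then k else - k)" for k
      proof -
        have "(\<Sum>i<N. tE c \<mu> \<nu> (f i) (g i) x y p k)
            = of_real (\<Sum>i<N. ph (x - 2 * of_int k * \<mu> - real i * h))"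
          unfolding t using True by simp
        also have "\<dots> = F (if \<mu> > 0 then k else - k)"
          unfolding sum_ph hN by (simp add: F_def T_def L_def algebra_simps)
        finally show ?thesis .
      qed
      have "(\<Sum>\<^sub>\<infinity>k. \<Sum>i<N. tE c \<mu> \<nu> (f i) (g i) x y p k) = (\<Sum>\<^sub>\<infinity>k. F k)"
        unfolding eq using infsum_int_minus[of F] by (cases "\<mu> > 0") simp_all
      also have "\<dots> = 1"
      proof -
        obtain K :: nat where K: "real K > (\<bar>x\<bar> + 1) / L" using reals_Archimedean2 by blast
        then have KL: "real K * L > \<bar>x\<bar> + 1" using L by (simp add: field_simps)
        show ?thesis unfolding F_def
        proof (rule infsum_telescope_int[where K = K])
          fix k :: int
          {
            assume "k \<le> - int K"
            then have "real_of_int k * L \<le> real_of_int (- int K) * L"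
              using L by (intro mult_right_mono) auto
            then have "5 * (x - of_int k * L) \<ge> 1" using KL by simp
            then show "T k = 1" by (simp add: T_def step_1)
          next
            assume "k \<ge> int K"
            then have "real_of_int k * L \<ge> real_of_int (int K) * L"
              using L by (intro mult_right_mono) auto
            then have "5 * (x - of_int k * L) \<le> 0" using KL by simp
            then show "T k = 0" by (simp add: T_def step_0)
          }
        qed
      qed
      finally show ?thesis using True by (simp add: Id_E_def delta0_def)
    qed (simp add: t Id_E_def delta0_def)
    finally show ?thesis .
  qed
  then show ?thesis using f g by (intro exI[of _ N] exI[of _ f] exI[of _ g]) auto
qed

end


subsection \<open>Integrals of lattice sums\<close>

text \<open>The majorant gives uniform convergence along the finite index sets, and uniform limits
  commute with the integral over a box.\<close>

lemma has_sum_integral: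
  fixes F :: "int \<Rightarrow> 'a::euclidean_space \<Rightarrow> complex"
  assumes F: "\<And>k. continuous_on (cbox a b) (F k)" and M: "M summable_on UNIV"
    and b: "\<And>k s. s \<in> cbox a b \<Longrightarrow> norm (F k s) \<le> M k"
  shows "((\<lambda>k. integral (cbox a b) (F k)) has_sum integral (cbox a b) (\<lambda>s. \<Sum>\<^sub>\<infinity>k. F k s)) UNIV"
proof -
  have u: "uniform_limit (cbox a b) (\<lambda>X s. \<Sum>k\<in>X. F k s) (\<lambda>s. \<Sum>\<^sub>\<infinity>k. F k s) (finite_subsets_at_top UNIV)"
    by (rule Weierstrass_m_test_general[OF _ M]) (use b in auto)
  obtain I J where I: "\<And>X. ((\<lambda>s. \<Sum>k\<in>X. F k s) has_integral I X) (cbox a b)"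
    and J: "((\<lambda>s. \<Sum>\<^sub>\<infinity>k. F k s) has_integral J) (cbox a b)"
    and lim: "(I \<longlongrightarrow> J) (finite_subsets_at_top UNIV)"
    by (rule uniform_limit_integral_cbox[OF u]) (auto intro: continuous_on_sum F)
  have "I X = (\<Sum>k\<in>X. integral (cbox a b) (F k))" if "finite X" for X
  proof -
    have "((\<lambda>s. \<Sum>k\<in>X. F k s) has_integral (\<Sum>k\<in>X. integral (cbox a b) (F k))) (cbox a b)"
      by (rule has_integral_sum[OF that]) (intro integrable_integral integrable_continuous F)
    with I[of X] show ?thesis by (rule has_integral_unique)
  qed
  then have "((\<lambda>X. \<Sum>k\<in>X. integral (cbox a b) (F k)) \<longlongrightarrow> J) (finite_subsets_at_top UNIV)"
    by (intro Lim_transform_eventually[OF lim] eventually_finite_subsets_at_top_weakI) auto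
  then show ?thesis using integral_unique[OF J] by (simp add: has_sum_def)
qed

lemma integral_period_real:
  fixes f :: "real \<Rightarrow> complex"
  assumes f: "continuous_on UNIV f" and per: "\<And>y. f (y + 1) = f y"
  shows "integral {t..t + 1} f = integral {0..1} f"
proof -
  have int: "f integrable_on {a..b}" for a b
    by (intro integrable_continuous_real continuous_on_subset[OF f]) auto
  have shift: "integral {a..b} f = integral {a + 1..b + 1} f" for a b
    using integral_shift_real_ivl[of "a + 1" 1 "b + 1" f] per by simp
  have up: "integral {t..t + 1} f = integral {0..1} f" if "0 \<le> t" "t \<le> 1" for t
  proof -
    have "integral {t..1} f + integral {1..t + 1} f = integral {t..t + 1} f"
      by (rule Henstock_Kurzweil_Integration.integral_combine) (use that int in auto)
    moreover have "integral {0..t} f + integral {t..1} f = integral {0..1} f"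
      by (rule Henstock_Kurzweil_Integration.integral_combine) (use that int in auto)
    moreover have "integral {0..t} f = integral {1..t + 1} f" using shift[of 0 t] by simp
    ultimately show ?thesis by (simp add: algebra_simps)
  qed
  have nat: "integral {t + real n..t + real n + 1} f = integral {t..t + 1} f" for t n
  proof (induction n)
    case (Suc n)
    then show ?case using shift[of "t + real n" "t + real n + 1"] by (simp add: algebra_simps)
  qed simp
  have "integral {t..t + 1} f = integral {frac t..frac t + 1} f"
  proof (cases "\<lfloor>t\<rfloor> \<ge> 0")
    case True
    then have "t = frac t + real (nat \<lfloor>t\<rfloor>)" by (simp add: frac_def)
    then show ?thesis using nat[of "frac t" "nat \<lfloor>t\<rfloor>"] by simp
  next
    case False
    then have "frac t = t + real (nat (- \<lfloor>t\<rfloor>))" by (simp add: frac_def)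
    then show ?thesis using nat[of t "nat (- \<lfloor>t\<rfloor>)"] by simp
  qed
  also have "\<dots> = integral {0..1} f" by (rule up) (auto simp: frac_ge_0 less_imp_le[OF frac_lt_1])
  finally show ?thesis .
qed

text \<open>The antiderivative of the weight is arctan, whose convergence at infinity controls the
  tails of the integral.\<close>

lemma integral_wt_bound:
  fixes U :: "real \<Rightarrow> complex"
  assumes U: "continuous_on UNIV U" and b: "\<And>x. norm (U x) \<le> C * wt x" and "a \<le> b"
  shows "norm (integral {a..b} U) \<le> C * (arctan b - arctan a)"
proof -
  have I: "((\<lambda>x. C * wt x) has_integral C * (arctan b - arctan a)) {a..b}"
  proof (rule has_integral_mult_right, rule fundamental_theorem_of_calculus[OF \<open>a \<le> b\<close>])
    fix x
    have "(arctan has_real_derivative wt x) (at x)"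
      using DERIV_arctan[of x] by (simp add: wt_def divide_inverse)
    then show "(arctan has_vector_derivative wt x) (at x within {a..b})"
      by (simp add: has_real_derivative_iff_has_vector_derivative has_vector_derivative_at_within)
  qed
  have "U integrable_on {a..b}"
    by (intro integrable_continuous_real continuous_on_subset[OF U]) auto
  then have "norm (integral {a..b} U) \<le> integral {a..b} (\<lambda>x. C * wt x)"
    by (rule Henstock_Kurzweil_Integration.integral_norm_bound_integral[OF _ has_integral_integrable[OF I] b])
  then show ?thesis unfolding integral_unique[OF I] .
qed

text \<open>The index set is half open: the intervals with k from -n + 1 to n tile
  [-n L, n L].\<close>

lemma sum_intervals:
  fixes U :: "real \<Rightarrow> complex"
  assumes U: "continuous_on UNIV U" and L: "L > 0"
  shows "(\<Sum>k\<in>{- int n<..int n}. integral {- of_int k * L..- of_int k * L + L} U)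
    = integral {- real n * L..real n * L} U"
proof (induction n)
  case (Suc n)
  have int: "U integrable_on {a..b}" for a b
    by (intro integrable_continuous_real continuous_on_subset[OF U]) auto
  have "{- int (Suc n)<..int (Suc n)} = insert (- int n) (insert (int (Suc n)) {- int n<..int n})" by auto
  then have "(\<Sum>k\<in>{- int (Suc n)<..int (Suc n)}. integral {- of_int k * L..- of_int k * L + L} U)
      = integral {real n * L..real n * L + L} U + (integral {- real (Suc n) * L..- real n * L} U
        + integral {- real n * L..real n * L} U)"
    using Suc by (simp add: algebra_simps)
  also have "\<dots> = integral {real n * L..real n * L + L} U + integral {- real (Suc n) * L..real n * L} U"
  proof (subst Henstock_Kurzweil_Integration.integral_combine)
    show "- real (Suc n) * L \<le> - real n * L" using L by (intro mult_right_mono) auto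
    have "0 \<le> real n * L" using L by simp
    then show "- real n * L \<le> real n * L" by simp
  qed (rule int refl)+
  also have "\<dots> = integral {- real (Suc n) * L..real n * L} U + integral {real n * L..real (Suc n) * L} U"
    by (simp add: algebra_simps)
  also have "\<dots> = integral {- real (Suc n) * L..real (Suc n) * L} U"
  proof (rule Henstock_Kurzweil_Integration.integral_combine)
    have "- real (Suc n) * L \<le> 0" "0 \<le> real n * L" using L by (auto intro: mult_nonpos_nonneg)
    then show "- real (Suc n) * L \<le> real n * L" by linarith
    show "real n * L \<le> real (Suc n) * L" using L by (intro mult_right_mono) auto
  qed (rule int)
  finally show ?case .
qed simp

text \<open>Along symmetric partial sums the two totals are limits of integrals over [-n L, n L] and
  [-n L', n L']. These differ by at most a multiple of |arctan(n L) - arctan(n L')|, which tends to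
  0.\<close>

lemma has_sum_intervals_unique:
  fixes U :: "real \<Rightarrow> complex"
  assumes U: "continuous_on UNIV U" "\<And>x. norm (U x) \<le> C * wt x"
    and L: "L > 0" "L' > 0"
    and S: "((\<lambda>k::int. integral {- of_int k * L..- of_int k * L + L} U) has_sum S) UNIV"
    and S': "((\<lambda>k::int. integral {- of_int k * L'..- of_int k * L' + L'} U) has_sum S') UNIV"
  shows "S = S'"
proof -
  have sets: "filterlim (\<lambda>n. {- int n<..int n}) (finite_subsets_at_top UNIV) sequentially"
    unfolding filterlim_finite_subsets_at_top
  proof (intro allI impI)
    fix X :: "int set" assume X: "finite X \<and> X \<subseteq> UNIV"
    define m where "m = nat (Max (insert 0 (abs ` X)))"
    have m: "\<bar>x\<bar> \<le> int m" if "x \<in> X" for x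
    proof -
      have "\<bar>x\<bar> \<le> Max (insert 0 (abs ` X))" using X that by (intro Max_ge) auto
      moreover have "0 \<le> Max (insert 0 (abs ` X))" using X by (intro Max_ge) auto
      ultimately show ?thesis by (simp add: m_def)
    qed
    \<comment> \<open>At least \<open>Suc m\<close>, since the left endpoint is excluded.\<close>
    have "finite {- int n<..int n} \<and> X \<subseteq> {- int n<..int n} \<and> {- int n<..int n} \<subseteq> UNIV" if "n \<ge> Suc m" for n
      using m that by fastforce
    then show "\<forall>\<^sub>F n in sequentially. finite {- int n<..int n} \<and> X \<subseteq> {- int n<..int n} \<and> {- int n<..int n} \<subseteq> UNIV"
      unfolding eventually_sequentially by blast
  qed
  have lim: "(\<lambda>n. integral {- real n * L..real n * L} U) \<longlonglongrightarrow> S"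
    if "((\<lambda>k::int. integral {- of_int k * L..- of_int k * L + L} U) has_sum S) UNIV" "L > 0" for S L
    using filterlim_compose[OF that(1)[unfolded has_sum_def] sets] sum_intervals[OF U(1) that(2)] by simp
  have le: "norm (integral {- R'..R'} U - integral {- R..R} U) \<le> 2 * C * (arctan R' - arctan R)"
    if "0 \<le> R" "R \<le> R'" for R R'
  proof -
    have int: "U integrable_on {a..b}" for a b
      by (intro integrable_continuous_real continuous_on_subset[OF U(1)]) auto
    have e1: "integral {- R'..- R} U + integral {- R..R'} U = integral {- R'..R'} U"
      by (rule Henstock_Kurzweil_Integration.integral_combine) (use that int in auto)
    have e2: "integral {- R..R} U + integral {R..R'} U = integral {- R..R'} U"
      by (rule Henstock_Kurzweil_Integration.integral_combine) (use that int in auto)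
    have "integral {- R'..R'} U - integral {- R..R} U = integral {- R'..- R} U + integral {R..R'} U"
      unfolding e1[symmetric] e2[symmetric] by simp
    also have "norm \<dots> \<le> norm (integral {- R'..- R} U) + norm (integral {R..R'} U)"
      by (rule norm_triangle_ineq)
    also have "\<dots> \<le> C * (arctan (- R) - arctan (- R')) + C * (arctan R' - arctan R)"
      by (intro add_mono integral_wt_bound[OF U]) (use that in auto)
    also have "\<dots> = 2 * C * (arctan R' - arctan R)" by (simp add: arctan_minus algebra_simps)
    finally show ?thesis .
  qed
  have C: "C \<ge> 0" using order_trans[OF norm_ge_zero U(2)[of 0]] by (simp add: wt_0)
  have le': "norm (integral {- real n * L..real n * L} U - integral {- real n * L'..real n * L'} U)
      \<le> 2 * C * \<bar>arctan (real n * L) - arctan (real n * L')\<bar>" for n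
  proof (cases "real n * L \<le> real n * L'")
    case True
    have "arctan (real n * L) \<le> arctan (real n * L')" using True by (rule arctan_monotone')
    then show ?thesis using le[OF _ True] L by (simp add: norm_minus_commute)
  next
    case False
    then have F: "real n * L' \<le> real n * L" by simp
    have "arctan (real n * L') \<le> arctan (real n * L)" using F by (rule arctan_monotone')
    then show ?thesis using le[OF _ F] L by simp
  qed
  have at: "(\<lambda>n. arctan (real n * L)) \<longlonglongrightarrow> pi / 2" if "L > 0" for L
    by (rule filterlim_compose[OF tendsto_arctan_at_top])
      (rule filterlim_at_top_mult_tendsto_pos[OF tendsto_const that filterlim_real_sequentially])
  have "(\<lambda>n. 2 * C * \<bar>arctan (real n * L) - arctan (real n * L')\<bar>) \<longlonglongrightarrow> 2 * C * \<bar>pi / 2 - pi / 2\<bar>"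
    by (intro tendsto_intros at L)
  then have "(\<lambda>n. 2 * C * \<bar>arctan (real n * L) - arctan (real n * L')\<bar>) \<longlonglongrightarrow> 0" by simp
  then have "(\<lambda>n. integral {- real n * L..real n * L} U - integral {- real n * L'..real n * L'} U) \<longlonglongrightarrow> 0"
    by (rule Lim_null_comparison[rotated]) (intro always_eventually allI le')
  moreover have "(\<lambda>n. integral {- real n * L..real n * L} U - integral {- real n * L'..real n * L'} U) \<longlonglongrightarrow> S - S'"
    by (intro tendsto_diff lim S S' L)
  ultimately have "S - S' = 0" using LIMSEQ_unique by blast
  then show ?thesis by simp
qed

text \<open>Both sides are the integral of \<open>u\<close> over \<open>\<real> \<times> \<real>/\<int>\<close>, unfolded along two different lattices.\<close>

lemma integral_lattice_sum_eq:
  fixes u :: vec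
  assumes u: "continuous_on UNIV u" "\<And>x y. u (x, y + 1) = u (x, y)" "\<And>x y. norm (u (x, y)) \<le> C * wt x"
    and L: "L > 0" "L' > 0"
  shows "integral (cbox (0, 0) (L, 1)) (\<lambda>(x, y). \<Sum>\<^sub>\<infinity>k::int. u (x - of_int k * L, y - of_int k * \<kappa>))
    = integral (cbox (0, 0) (L', 1)) (\<lambda>(x, y). \<Sum>\<^sub>\<infinity>k::int. u (x - of_int k * L', y - of_int k * \<kappa>'))"
proof -
  define U where "U = (\<lambda>x. integral {0..1} (\<lambda>y. u (x, y)))"
  have Uc: "continuous_on UNIV U"
  proof -
    have "continuous_on UNIV (\<lambda>x. integral (cbox 0 1) (\<lambda>y. u (x, y)))"
      by (rule integral_continuous_on_param, unfold case_prod_unfold prod.collapse)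
        (rule continuous_on_subset[OF u(1)], simp)
    then show ?thesis by (simp add: U_def)
  qed
  have ucy: "continuous_on A (\<lambda>y. u (x, y))" for x A
    by (rule continuous_on_compose2[OF u(1)]) (auto intro!: continuous_intros)
  have Ub: "norm (U x) \<le> C * wt x" for x
    using integral_bound[of 0 1 "\<lambda>y. u (x, y)" "C * wt x"] u(3) ucy by (simp add: U_def)
  have C: "C \<ge> 0" using order_trans[OF norm_ge_zero u(3)[of 0 0]] by (simp add: wt_0)
  have sum: "((\<lambda>k::int. integral {- of_int k * L..- of_int k * L + L} U) has_sum
      integral (cbox (0, 0) (L, 1)) (\<lambda>m. \<Sum>\<^sub>\<infinity>k::int. u (fst m - of_int k * L, snd m - of_int k * \<kappa>))) UNIV"
    if L: "L > 0" for L \<kappa>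
  proof -
    have "integral {- of_int k * L..- of_int k * L + L} U
        = integral (cbox (0, 0) (L, 1)) (\<lambda>m. u (fst m - of_int k * L, snd m - of_int k * \<kappa>))" for k :: int
    proof -
      have "integral (cbox (0, 0) (L, 1)) (\<lambda>m. u (fst m - of_int k * L, snd m - of_int k * \<kappa>))
          = integral (cbox ((0, 0) + (- (of_int k * L), - (of_int k * \<kappa>))) ((L, 1) + (- (of_int k * L), - (of_int k * \<kappa>)))) u"
        unfolding integral_shift_cbox_plus[symmetric]
        by (rule integral_cong) (auto simp: plus_prod_def)
      also have "\<dots> = integral (cbox (- of_int k * L) (- of_int k * L + L))
          (\<lambda>x. integral (cbox (- of_int k * \<kappa>) (- of_int k * \<kappa> + 1)) (\<lambda>y. u (x, y)))"
        using integral_prod_continuous[of "- of_int k * L" "- of_int k * \<kappa>" "- of_int k * L + L" "- of_int k * \<kappa> + 1" u,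
            OF continuous_on_subset[OF u(1)]]
        by (simp add: add.commute)
      \<comment> \<open>The inner integral runs over a full period wherever it starts, so the skew
        of the lattice in y drops out.\<close>
      also have "\<dots> = integral {- of_int k * L..- of_int k * L + L} U"
        unfolding U_def cbox_interval integral_period_real[OF ucy u(2)] by (rule refl)
      finally show ?thesis by simp
    qed
    moreover have "((\<lambda>k::int. integral (cbox (0, 0) (L, 1)) (\<lambda>m. u (fst m - of_int k * L, snd m - of_int k * \<kappa>))) has_sum
        integral (cbox (0, 0) (L, 1)) (\<lambda>m. \<Sum>\<^sub>\<infinity>k::int. u (fst m - of_int k * L, snd m - of_int k * \<kappa>))) UNIV"
    proof (rule has_sum_integral[where M = "\<lambda>k. C * (2 * (1 + L\<^sup>2) * wt (0 + of_int k * (- L)))"])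
      show "continuous_on (cbox (0, 0) (L, 1)) (\<lambda>m. u (fst m - of_int k * L, snd m - of_int k * \<kappa>))" for k :: int
        by (rule continuous_on_compose2[OF u(1)]) (auto intro!: continuous_intros)
      show "(\<lambda>k::int. C * (2 * (1 + L\<^sup>2) * wt (0 + of_int k * (- L)))) summable_on UNIV"
        by (intro summable_on_cmult_right summable_wt_step) (use L in simp)
      fix k :: int and m :: pt assume m: "m \<in> cbox (0, 0) (L, 1)"
      then have x: "0 \<le> fst m" "fst m \<le> L" by (auto simp: mem_box cbox_Pair_eq)
      have "wt (fst m + of_int k * (- L)) \<le> 2 * (1 + (fst m)\<^sup>2) * wt (of_int k * (- L))" by (rule wt_add_le)
      also have "\<dots> \<le> 2 * (1 + L\<^sup>2) * wt (of_int k * (- L))"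
        using x by (intro mult_right_mono mult_left_mono add_left_mono power_mono wt_nonneg) auto
      finally have "C * wt (fst m + of_int k * (- L)) \<le> C * (2 * (1 + L\<^sup>2) * wt (of_int k * (- L)))"
        using C by (rule mult_left_mono)
      then show "norm (u (fst m - of_int k * L, snd m - of_int k * \<kappa>)) \<le> C * (2 * (1 + L\<^sup>2) * wt (0 + of_int k * (- L)))"
        using u(3)[of "fst m - of_int k * L" "snd m - of_int k * \<kappa>"] by simp
    qed
    ultimately show ?thesis by simp
  qed
  show ?thesis
    using has_sum_intervals_unique[OF Uc Ub L sum[OF L(1), of \<kappa>] sum[OF L(2), of \<kappa>']]
    by (simp add: case_prod_unfold)
qed


subsection \<open>Symmetry of second derivatives\<close>

text \<open>Smoothness is given through separate partial derivatives. So f is recovered as the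
  x-integral of \<open>dx f\<close>, differentiated in y under the integral, and then in x by the
  fundamental theorem.\<close>

lemma dx_dy_commute:
  assumes f: "smooth f" shows "dx (dy f) = dy (dx f)"
proof (rule ext, clarify)
  fix x y :: real
  let ?g = "dx f"
  note g = smooth_dx[OF f]
  have dyg: "continuous_on UNIV (dy ?g)" by (intro smooth_continuous smooth_dy g)
  have gc: "continuous_on A (\<lambda>s. ?g (s, t))" for t A
    by (rule continuous_on_compose2[OF smooth_continuous[OF g]]) (auto intro!: continuous_intros)
  have dygc: "continuous_on A (\<lambda>s. dy ?g (s, y))" for A
    by (rule continuous_on_compose2[OF dyg]) (auto intro!: continuous_intros)
  \<comment> \<open>The base point x - 1 lies to the left of x, so the formula holds on a
    neighbourhood of x.\<close>
  have eq: "dy f (u, y) = dy f (x - 1, y) + integral {x - 1..u} (\<lambda>s. dy ?g (s, y))" if "x - 1 \<le> u" for u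
  proof -
    have "f (u, t) - f (x - 1, t) = integral {x - 1..u} (\<lambda>s. ?g (s, t))" for t
      by (rule integral_unique[symmetric], rule fundamental_theorem_of_calculus[OF that])
        (rule has_vector_derivative_at_within, intro has_dx smooth_differentiable_x f)
    then have "(\<lambda>t. f (u, t)) = (\<lambda>t. f (x - 1, t) + integral (cbox (x - 1) u) (\<lambda>s. ?g (s, t)))"
      by (simp add: fun_eq_iff algebra_simps)
    moreover have "((\<lambda>t. f (x - 1, t) + integral (cbox (x - 1) u) (\<lambda>s. ?g (s, t))) has_vector_derivative
        dy f (x - 1, y) + integral (cbox (x - 1) u) (\<lambda>s. dy ?g (s, y))) (at y within UNIV)"
    proof (intro has_vector_derivative_add leibniz_rule_vector_derivative)
      show "((\<lambda>t. f (x - 1, t)) has_vector_derivative dy f (x - 1, y)) (at y)"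
        by (intro has_dy smooth_differentiable_y f)
      show "((\<lambda>t. ?g (s, t)) has_vector_derivative dy ?g (s, t)) (at t)" for s t
        by (intro has_dy smooth_differentiable_y g)
      show "(\<lambda>s. ?g (s, t)) integrable_on cbox (x - 1) u" for t
        by (intro integrable_continuous gc)
      show "continuous_on (UNIV \<times> cbox (x - 1) u) (\<lambda>(t, s). dy ?g (s, t))"
        unfolding case_prod_unfold
        by (rule continuous_on_compose2[OF dyg]) (auto intro!: continuous_intros)
    qed auto
    ultimately have "((\<lambda>t. f (u, t)) has_vector_derivative
        dy f (x - 1, y) + integral (cbox (x - 1) u) (\<lambda>s. dy ?g (s, y))) (at y)" by simp
    then show ?thesis
      using has_dy[OF smooth_differentiable_y[OF f]] by (auto dest: vector_derivative_unique_at)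
  qed
  have "((\<lambda>u. dy f (x - 1, y) + integral {x - 1..u} (\<lambda>s. dy ?g (s, y))) has_vector_derivative 0 + dy ?g (x, y))
      (at x within {x - 1..x + 1})"
    by (intro has_vector_derivative_add has_vector_derivative_const integral_has_vector_derivative dygc) auto
  then have "((\<lambda>u. dy f (x - 1, y) + integral {x - 1..u} (\<lambda>s. dy ?g (s, y))) has_vector_derivative dy ?g (x, y)) (at x)"
    using at_within_interior[of x "{x - 1..x + 1}"] by simp
  then have "((\<lambda>u. dy f (u, y)) has_vector_derivative dy ?g (x, y)) (at x)"
    by (rule has_vector_derivative_transform_within_open[where S = "{x - 1<..}"])
      (simp, simp, rule eq[symmetric], simp)
  moreover have "((\<lambda>u. dy f (u, y)) has_vector_derivative dx (dy f) (x, y)) (at x)"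
    by (intro has_dx smooth_differentiable_x smooth_dy f)
  ultimately show "dx (dy f) (x, y) = dy ?g (x, y)" by (auto dest: vector_derivative_unique_at)
qed


subsection \<open>Traces\<close>

context qhm
begin

text \<open>A candidate for the induced trace that depends on the element alone, not on a
  representation of it.\<close>

definition trE :: "alg \<Rightarrow> complex" where
  "trE \<Psi> = integral (cbox (0, 0) (2 * \<bar>\<mu>\<bar>, 1)) (\<lambda>m. \<Psi> m 0)"

text \<open>Both sides are the integral of \<open>cnj f\<close> times g over the cylinder, unfolded
  along the integers on the left and along the multiples of (2 \<mu>, 2 \<nu>) on the right.\<close>

lemma trace_D_ipD:
  assumes f: "f \<in> Xi" and g: "g \<in> Xi"
  shows "trace_D (ipD g f) = trE (ipE f g)"
proof -
  define u where "u = (\<lambda>m. cnj (f m) * g m)"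
  obtain A where A: "A \<ge> 0" "\<And>x y. norm (f (x, y)) \<le> A * wt x" using Xi_bound[OF f] by blast
  obtain B where B: "B \<ge> 0" "\<And>x y. norm (g (x, y)) \<le> B * wt x" using Xi_bound[OF g] by blast
  have u1: "continuous_on UNIV u" unfolding u_def
    by (intro continuous_intros continuous_on_cnj Xi_continuous f g)
  have u2: "u (x, y + 1) = u (x, y)" for x y by (simp add: u_def Xi_periodic f g)
  have u3: "norm (u (x, y)) \<le> (A * B) * wt x" for x y
  proof -
    have "norm (u (x, y)) \<le> (A * wt x) * (B * wt x)"
      unfolding u_def norm_mult complex_mod_cnj
      by (intro mult_mono A B mult_nonneg_nonneg wt_nonneg) auto
    also have "\<dots> = (A * B * wt x) * wt x" by simp
    also have "\<dots> \<le> (A * B * wt x) * 1"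
      by (intro mult_left_mono wt_le_1 mult_nonneg_nonneg wt_nonneg A B)
    finally show ?thesis by simp
  qed
  \<comment> \<open>The sign of \<mu>: unfolding uses a positive step, so for negative \<mu> the
    lattice index is reversed.\<close>
  define s where "s = (if \<mu> > 0 then 1 else - 1 :: real)"
  have D: "ipD g f (x, y) 0 = (\<Sum>\<^sub>\<infinity>k::int. u (x - of_int k * 1, y - of_int k * 0))" for x y
    using infsum_int_minus[of "\<lambda>k. u (x + of_int k, y)"]
    by (simp add: ip_D_eq tD_def u_def mult.commute)
  have E: "ipE f g (x, y) 0 = (\<Sum>\<^sub>\<infinity>k::int. u (x - of_int k * (2 * \<bar>\<mu>\<bar>), y - of_int k * (2 * s * \<nu>)))" for x y
  proof -
    let ?F = "\<lambda>k::int. u (x - of_int k * (2 * \<mu>), y - of_int k * (2 * \<nu>))"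
    have "ipE f g (x, y) 0 = (\<Sum>\<^sub>\<infinity>k. ?F k)" by (simp add: ip_E_eq tE_def u_def mult_ac)
    also have "\<dots> = (\<Sum>\<^sub>\<infinity>k::int. u (x - of_int k * (2 * \<bar>\<mu>\<bar>), y - of_int k * (2 * s * \<nu>)))"
      using infsum_int_minus[of ?F] by (cases "\<mu> > 0") (simp_all add: s_def)
    finally show ?thesis .
  qed
  have "trace_D (ipD g f) = integral (cbox (0, 0) (1, 1)) (\<lambda>(x, y). \<Sum>\<^sub>\<infinity>k::int. u (x - of_int k * 1, y - of_int k * 0))"
    unfolding trace_D_def by (rule integral_cong) (auto simp: D)
  also have "\<dots> = integral (cbox (0, 0) (2 * \<bar>\<mu>\<bar>, 1)) (\<lambda>(x, y). \<Sum>\<^sub>\<infinity>k::int. u (x - of_int k * (2 * \<bar>\<mu>\<bar>), y - of_int k * (2 * s * \<nu>)))"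
    by (rule integral_lattice_sum_eq[OF u1 u2 u3]) (use mu in auto)
  also have "\<dots> = trE (ipE f g)"
    unfolding trE_def by (rule integral_cong) (auto simp: E)
  finally show ?thesis .
qed

lemma rapid_integrable: "rapid \<Psi> \<Longrightarrow> (\<lambda>m. \<Psi> m p) integrable_on cbox a b"
  unfolding rapid_def by (intro integrable_continuous) (blast intro: continuous_on_subset)

lemma trE_add: "rapid \<Psi> \<Longrightarrow> rapid \<Psi>' \<Longrightarrow> trE (\<lambda>m p. \<Psi> m p + \<Psi>' m p) = trE \<Psi> + trE \<Psi>'"
  unfolding trE_def by (intro Henstock_Kurzweil_Integration.integral_add rapid_integrable)

lemma trE_0: "trE (\<lambda>m p. 0) = 0"
  by (simp add: trE_def)

lemma rapid_0: "rapid (\<lambda>m p. 0)"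
  unfolding rapid_def periodic_T_def by (auto intro: exI[of _ 0])

lemma trE_list:
  assumes "set xs \<subseteq> Xi \<times> Xi"
  shows "rapid (\<lambda>m p. \<Sum>(\<xi>, \<eta>)\<leftarrow>xs. ipE \<xi> \<eta> m p) \<and>
    trE (\<lambda>m p. \<Sum>(\<xi>, \<eta>)\<leftarrow>xs. ipE \<xi> \<eta> m p) = (\<Sum>(\<xi>, \<eta>)\<leftarrow>xs. trace_D (ipD \<eta> \<xi>))"
  using assms
proof (induction xs)
  case (Cons z xs)
  obtain \<xi> \<eta> where z: "z = (\<xi>, \<eta>)" "\<xi> \<in> Xi" "\<eta> \<in> Xi" using Cons.prems by auto
  have IH: "rapid (\<lambda>m p. \<Sum>(\<xi>, \<eta>)\<leftarrow>xs. ipE \<xi> \<eta> m p)"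
    "trE (\<lambda>m p. \<Sum>(\<xi>, \<eta>)\<leftarrow>xs. ipE \<xi> \<eta> m p) = (\<Sum>(\<xi>, \<eta>)\<leftarrow>xs. trace_D (ipD \<eta> \<xi>))"
    using Cons by auto
  show ?case
    using rapid_add[OF rapid_ipE[OF z(2,3)] IH(1)] trE_add[OF rapid_ipE[OF z(2,3)] IH(1)] IH(2)
      trace_D_ipD[OF z(2,3)] by (simp add: z(1))
qed (simp add: rapid_0 trE_0)

text \<open>The description is unique because every representing list gives the value of
  \<open>trE\<close> at the same element.\<close>

lemma trace_E_list:
  assumes "set xs \<subseteq> Xi \<times> Xi"
  shows "trace_E c \<mu> \<nu> (\<lambda>m p. \<Sum>(\<xi>, \<eta>)\<leftarrow>xs. ipE \<xi> \<eta> m p)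
    = trE (\<lambda>m p. \<Sum>(\<xi>, \<eta>)\<leftarrow>xs. ipE \<xi> \<eta> m p)"
  unfolding trace_E_def
proof (rule the_equality)
  show "\<exists>ys. set ys \<subseteq> Xi \<times> Xi \<and>
     (\<lambda>m p. \<Sum>(\<xi>, \<eta>)\<leftarrow>xs. ipE \<xi> \<eta> m p) = (\<lambda>m p. \<Sum>(\<xi>, \<eta>)\<leftarrow>ys. ipE \<xi> \<eta> m p) \<and>
     trE (\<lambda>m p. \<Sum>(\<xi>, \<eta>)\<leftarrow>xs. ipE \<xi> \<eta> m p) = (\<Sum>(\<xi>, \<eta>)\<leftarrow>ys. trace_D (ipD \<eta> \<xi>))"
    using assms trE_list[OF assms] by blast
next
  fix t
  assume "\<exists>ys. set ys \<subseteq> Xi \<times> Xi \<and>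
     (\<lambda>m p. \<Sum>(\<xi>, \<eta>)\<leftarrow>xs. ipE \<xi> \<eta> m p) = (\<lambda>m p. \<Sum>(\<xi>, \<eta>)\<leftarrow>ys. ipE \<xi> \<eta> m p) \<and>
     t = (\<Sum>(\<xi>, \<eta>)\<leftarrow>ys. trace_D (ipD \<eta> \<xi>))"
  then show "t = trE (\<lambda>m p. \<Sum>(\<xi>, \<eta>)\<leftarrow>xs. ipE \<xi> \<eta> m p)"
    using trE_list by metis
qed

text \<open>At p = 0 the multipliers in the derivations vanish and covariance becomes plain
  periodicity in x, so only derivatives of a doubly periodic function are integrated.\<close>

lemma trace_D_delta:
  assumes f: "f \<in> Xi" and g: "g \<in> Xi"
  shows "trace_D (delta c \<mu> W (ipD f g)) = 0"
proof -
  obtain a b d where W: "W = (a, b, d)" by (cases W)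
  define h where "h = (\<lambda>m. ipD f g m 0)"
  have h: "smooth h" unfolding h_def by (rule smooth_ipD[OF f g])
  have hy: "h (x, y + 1) = h (x, y)" for x y
    using rapid_ipD[OF f g] by (simp add: h_def rapid_def periodic_T_def)
  have hx: "h (x + 1, y) = h (x, y)" for x y
    using D_per_ipD[of f g, unfolded D_per_def, rule_format, of 1 0 y x] by (simp add: h_def)
  have c1: "continuous_on A (dx h)" and c2: "continuous_on A (dy h)" for A
    using smooth_continuous[OF smooth_dx[OF h]] smooth_continuous[OF smooth_dy[OF h]] continuous_on_subset
    by blast+
  have iy: "integral (cbox 0 1) (\<lambda>y. dy h (x, y)) = 0" for x
  proof -
    have "((\<lambda>y. dy h (x, y)) has_integral h (x, 1) - h (x, 0)) {0..1}"
      by (rule fundamental_theorem_of_calculus, simp, rule has_vector_derivative_at_within)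
        (intro has_dy smooth_differentiable_y h)
    then show ?thesis using hy[of x 0] by (simp add: integral_unique)
  qed
  have ix: "integral (cbox 0 1) (\<lambda>x. dx h (x, y)) = 0" for y
  proof -
    have "((\<lambda>x. dx h (x, y)) has_integral h (1, y) - h (0, y)) {0..1}"
      by (rule fundamental_theorem_of_calculus, simp, rule has_vector_derivative_at_within)
        (intro has_dx smooth_differentiable_x h)
    then show ?thesis using hx[of 0 y] by (simp add: integral_unique)
  qed
  have Iy: "integral (cbox (0, 0) (1, 1)) (dy h) = 0"
    unfolding integral_prod_continuous[OF c2] iy by simp
  have Ix: "integral (cbox (0, 0) (1, 1)) (dx h) = 0"
  proof -
    have "integral (cbox (0, 0) (1, 1)) (dx h) = integral (cbox 0 1) (\<lambda>x. integral (cbox 0 1) (\<lambda>y. dx h (x, y)))"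
      by (rule integral_prod_continuous[OF c1])
    also have "\<dots> = integral (cbox 0 1) (\<lambda>y. integral (cbox 0 1) (\<lambda>x. dx h (x, y)))"
      by (rule integral_swap_continuous) (use c1 in simp)
    finally show ?thesis unfolding ix by simp
  qed
  have "delta c \<mu> W (ipD f g) m 0 = (- of_real a) * dy h m + (- of_real b) * dx h m" for m
    by (cases m) (simp add: W delta_X_def delta_Y_def delta_Z_def h_def)
  then have "trace_D (delta c \<mu> W (ipD f g))
      = integral (cbox (0, 0) (1, 1)) (\<lambda>m. (- of_real a) * dy h m + (- of_real b) * dx h m)"
    by (simp add: trace_D_def)
  also have "\<dots> = (- of_real a) * integral (cbox (0, 0) (1, 1)) (dy h) + (- of_real b) * integral (cbox (0, 0) (1, 1)) (dx h)"
    by (subst Henstock_Kurzweil_Integration.integral_add)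
      (auto intro!: integrable_continuous continuous_intros c1 c2)
  finally show ?thesis by (simp add: Ix Iy)
qed

lemma trace_D_add: "rapid \<Phi> \<Longrightarrow> rapid \<Psi> \<Longrightarrow> trace_D (\<lambda>m p. \<Phi> m p + \<Psi> m p) = trace_D \<Phi> + trace_D \<Psi>"
  unfolding trace_D_def by (intro Henstock_Kurzweil_Integration.integral_add rapid_integrable)

end


subsection \<open>Compatible connections\<close>

lemma dx_at: "((\<lambda>s. f (s, y)) has_vector_derivative v) (at x) \<Longrightarrow> dx f (x, y) = v"
  by (simp add: dx_def vector_derivative_at)

lemma dy_at: "((\<lambda>s. f (x, s)) has_vector_derivative v) (at y) \<Longrightarrow> dy f (x, y) = v"
  by (simp add: dy_def vector_derivative_at)

lemma D_smooth_smooth: "\<Phi> \<in> D_smooth c \<mu> \<nu> \<Longrightarrow> smooth (\<lambda>m. \<Phi> m p)"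
  unfolding D_smooth_def by blast

text \<open>The empty list and the one-element lists in the definition of \<open>D_smooth\<close>.
  These bounds dominate the differentiated right action.\<close>

lemma D_smooth_bdd:
  assumes "\<Phi> \<in> D_smooth c \<mu> \<nu>"
  shows "bdd_alg \<Phi>" "bdd_alg (delta_X c \<mu> \<Phi>)" "bdd_alg (delta_Y \<Phi>)" "bdd_alg (delta_Z \<Phi>)"
proof -
  have *: "bdd_alg (fold (delta c \<mu>) Ws \<Phi>)" for Ws
    using assms D_alg_bounded unfolding D_smooth_def bdd_alg_def by blast
  show "bdd_alg \<Phi>" using *[of "[]"] by simp
  show "bdd_alg (delta_X c \<mu> \<Phi>)" using *[of "[(1, 0, 0)]"] by simp
  show "bdd_alg (delta_Y \<Phi>)" using *[of "[(0, 1, 0)]"] by simp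
  show "bdd_alg (delta_Z \<Phi>)" using *[of "[(0, 0, 1)]"] by simp
qed

section \<open>Derivatives of the right action and the Leibniz rule\<close>

definition tA :: "real \<Rightarrow> real \<Rightarrow> vec \<Rightarrow> alg \<Rightarrow> real \<Rightarrow> real \<Rightarrow> int \<Rightarrow> complex" where
  "tA \<mu> \<nu> g \<Phi> x y q = g (x + 2 * of_int q * \<mu>, y + 2 * of_int q * \<nu>)
       * cnj (\<Phi> (x + 2 * of_int q * \<mu>, y + 2 * of_int q * \<nu>) q)"

lemma act_D_eq: "act_D \<mu> \<nu> g \<Phi> (x, y) = (\<Sum>\<^sub>\<infinity>q. tA \<mu> \<nu> g \<Phi> x y q)"
  by (simp add: act_D_def tA_def)

lemma nabla0_add:
  assumes "\<xi> \<in> Xi" "\<eta> \<in> Xi"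
  shows "nabla0 c \<mu> W (\<lambda>m. \<xi> m + \<eta> m) = (\<lambda>m. nabla0 c \<mu> W \<xi> m + nabla0 c \<mu> W \<eta> m)"
proof -
  have "dx (\<lambda>m. \<xi> m + \<eta> m) = (\<lambda>m. dx \<xi> m + dx \<eta> m)"
    by (rule dx_eqI) (intro has_vector_derivative_add Xi_has_dx assms)
  moreover have "dy (\<lambda>m. \<xi> m + \<eta> m) = (\<lambda>m. dy \<xi> m + dy \<eta> m)"
    by (rule dy_eqI) (intro has_vector_derivative_add Xi_has_dy assms)
  ultimately show ?thesis
    by (cases W) (simp add: nabla0_eq xm_def fun_eq_iff algebra_simps)
qed

lemma nabla0_cmult:
  assumes "\<xi> \<in> Xi"
  shows "nabla0 c \<mu> W (\<lambda>m. a * \<xi> m) = (\<lambda>m. a * nabla0 c \<mu> W \<xi> m)"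
proof -
  have "dx (\<lambda>m. a * \<xi> m) = (\<lambda>m. a * dx \<xi> m)"
    by (rule dx_eqI) (intro has_vector_derivative_mult_right Xi_has_dx assms)
  moreover have "dy (\<lambda>m. a * \<xi> m) = (\<lambda>m. a * dy \<xi> m)"
    by (rule dy_eqI) (intro has_vector_derivative_mult_right Xi_has_dy assms)
  ultimately show ?thesis
    by (cases W) (simp add: nabla0_eq xm_def fun_eq_iff algebra_simps)
qed

lemma linear_nabla0: "linear (\<lambda>W. nabla0 c \<mu> W \<xi> m)"
  by (rule linearI) (auto simp: nabla0_eq scaleR_conv_of_real algebra_simps add_divide_distrib)

context qhm
begin

lemma tA_dominated:
  assumes "\<xi> \<in> Xi" "bdd_alg \<Phi>"
  shows "lattice_dominated (2 * \<mu>) u (\<lambda>q s. tA \<mu> \<nu> \<xi> \<Phi> (u s) (v s) q)"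
proof -
  obtain C where C: "C \<ge> 0" "\<And>m p. norm (\<Phi> m p) \<le> C" using assms(2) unfolding bdd_alg_def by blast
  obtain D where D: "D \<ge> 0" "\<And>x y. norm (\<xi> (x, y)) \<le> D * wt x" using Xi_bound[OF assms(1)] by blast
  have "norm (tA \<mu> \<nu> \<xi> \<Phi> x y q) \<le> (D * C) * wt (x + of_int q * (2 * \<mu>))" for x y q
  proof -
    have "norm (tA \<mu> \<nu> \<xi> \<Phi> x y q) \<le> (D * wt (x + 2 * of_int q * \<mu>)) * C"
      unfolding tA_def norm_mult complex_mod_cnj
      by (intro mult_mono C D mult_nonneg_nonneg wt_nonneg) auto
    then show ?thesis by (simp add: mult_ac)
  qed
  then show ?thesis by (rule lattice_dominatedI)
qed

lemma tA_summable: "\<xi> \<in> Xi \<Longrightarrow> bdd_alg \<Phi> \<Longrightarrow> tA \<mu> \<nu> \<xi> \<Phi> x y summable_on UNIV"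
  using lattice_dominated_summable[OF _ tA_dominated[of \<xi> \<Phi> "\<lambda>s. x" "\<lambda>s. y"]] mu by simp

lemma act_D_add_left:
  assumes "\<xi> \<in> Xi" "\<eta> \<in> Xi" "bdd_alg \<Phi>"
  shows "act_D \<mu> \<nu> (\<lambda>m. \<xi> m + \<eta> m) \<Phi> m = act_D \<mu> \<nu> \<xi> \<Phi> m + act_D \<mu> \<nu> \<eta> \<Phi> m"
proof (cases m)
  case (Pair x y)
  have *: "tA \<mu> \<nu> (\<lambda>m. \<xi> m + \<eta> m) \<Phi> x y = (\<lambda>q. tA \<mu> \<nu> \<xi> \<Phi> x y q + tA \<mu> \<nu> \<eta> \<Phi> x y q)"
    by (simp add: tA_def fun_eq_iff algebra_simps)
  show ?thesis unfolding Pair act_D_eq * by (simp add: infsum_add tA_summable assms)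
qed

lemma act_D_diff_left:
  assumes "\<xi> \<in> Xi" "\<eta> \<in> Xi" "bdd_alg \<Phi>"
  shows "act_D \<mu> \<nu> (\<lambda>m. \<xi> m - \<eta> m) \<Phi> m = act_D \<mu> \<nu> \<xi> \<Phi> m - act_D \<mu> \<nu> \<eta> \<Phi> m"
proof (cases m)
  case (Pair x y)
  have *: "tA \<mu> \<nu> (\<lambda>m. \<xi> m - \<eta> m) \<Phi> x y = (\<lambda>q. tA \<mu> \<nu> \<xi> \<Phi> x y q - tA \<mu> \<nu> \<eta> \<Phi> x y q)"
    by (simp add: tA_def fun_eq_iff algebra_simps)
  show ?thesis unfolding Pair act_D_eq * by (simp add: infsum_diff tA_summable assms)
qed

lemma act_D_cmult_left: "act_D \<mu> \<nu> (\<lambda>m. a * \<xi> m) \<Phi> m = a * act_D \<mu> \<nu> \<xi> \<Phi> m"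
proof (cases m)
  case (Pair x y)
  have *: "tA \<mu> \<nu> (\<lambda>m. a * \<xi> m) \<Phi> x y = (\<lambda>q. a * tA \<mu> \<nu> \<xi> \<Phi> x y q)"
    by (simp add: tA_def fun_eq_iff algebra_simps)
  show ?thesis unfolding Pair act_D_eq * by (simp add: infsum_cmult_right')
qed

lemma act_D_add_right:
  assumes "\<xi> \<in> Xi" "bdd_alg \<Phi>" "bdd_alg \<Psi>"
  shows "act_D \<mu> \<nu> \<xi> (\<lambda>m p. \<Phi> m p + \<Psi> m p) m = act_D \<mu> \<nu> \<xi> \<Phi> m + act_D \<mu> \<nu> \<xi> \<Psi> m"
proof (cases m)
  case (Pair x y)
  have *: "tA \<mu> \<nu> \<xi> (\<lambda>m p. \<Phi> m p + \<Psi> m p) x y = (\<lambda>q. tA \<mu> \<nu> \<xi> \<Phi> x y q + tA \<mu> \<nu> \<xi> \<Psi> x y q)"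
    by (simp add: tA_def fun_eq_iff algebra_simps)
  show ?thesis unfolding Pair act_D_eq * by (simp add: infsum_add tA_summable assms)
qed

lemma act_D_cmult_right: "act_D \<mu> \<nu> \<xi> (\<lambda>m p. a * \<Phi> m p) m = cnj a * act_D \<mu> \<nu> \<xi> \<Phi> m"
proof (cases m)
  case (Pair x y)
  have *: "tA \<mu> \<nu> \<xi> (\<lambda>m p. a * \<Phi> m p) x y = (\<lambda>q. cnj a * tA \<mu> \<nu> \<xi> \<Phi> x y q)"
    by (simp add: tA_def fun_eq_iff algebra_simps)
  show ?thesis unfolding Pair act_D_eq * by (simp add: infsum_cmult_right')
qed

lemma bdd_alg_cmult: "bdd_alg \<Phi> \<Longrightarrow> bdd_alg (\<lambda>m p. a * \<Phi> m p)"
proof -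
  assume "bdd_alg \<Phi>"
  then obtain C where C: "C \<ge> 0" "\<And>m p. norm (\<Phi> m p) \<le> C" unfolding bdd_alg_def by blast
  then have "norm (a * \<Phi> m p) \<le> norm a * C" for m p by (simp add: norm_mult mult_left_mono)
  then show ?thesis unfolding bdd_alg_def using C(1) by (intro exI[of _ "norm a * C"]) auto
qed

lemma bdd_alg_add: "bdd_alg \<Phi> \<Longrightarrow> bdd_alg \<Psi> \<Longrightarrow> bdd_alg (\<lambda>m p. \<Phi> m p + \<Psi> m p)"
proof -
  assume "bdd_alg \<Phi>" "bdd_alg \<Psi>"
  then obtain C D where C: "C \<ge> 0" "\<And>m p. norm (\<Phi> m p) \<le> C" and D: "D \<ge> 0" "\<And>m p. norm (\<Psi> m p) \<le> D"
    unfolding bdd_alg_def by metis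
  have "norm (\<Phi> m p + \<Psi> m p) \<le> C + D" for m p by (intro norm_triangle_mono C D)
  then show ?thesis unfolding bdd_alg_def using C(1) D(1) by (intro exI[of _ "C + D"]) auto
qed

lemma act_D_has_dx:
  assumes \<xi>: "\<xi> \<in> Xi" and \<Phi>: "\<Phi> \<in> D_smooth c \<mu> \<nu>"
  shows "((\<lambda>s. act_D \<mu> \<nu> \<xi> \<Phi> (s, y)) has_vector_derivative
    act_D \<mu> \<nu> (dx \<xi>) \<Phi> (x, y) - act_D \<mu> \<nu> \<xi> (delta_Y \<Phi>) (x, y)) (at x)"
proof -
  note b = D_smooth_bdd[OF \<Phi>]
  have "((\<lambda>s. \<Sum>\<^sub>\<infinity>q. tA \<mu> \<nu> \<xi> \<Phi> s y q) has_vector_derivative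
      (\<Sum>\<^sub>\<infinity>q. tA \<mu> \<nu> (dx \<xi>) \<Phi> x y q - tA \<mu> \<nu> \<xi> (delta_Y \<Phi>) x y q)) (at x)"
  proof (rule has_dx_lattice_sum[where L = "2 * \<mu>"])
    fix q :: int and s :: real
    have "((\<lambda>s. \<xi> (s + 2 * of_int q * \<mu>, y + 2 * of_int q * \<nu>)
          * cnj (\<Phi> (s + 2 * of_int q * \<mu>, y + 2 * of_int q * \<nu>) q)) has_vector_derivative
        \<xi> (s + 2 * of_int q * \<mu>, y + 2 * of_int q * \<nu>)
          * cnj (dx (\<lambda>m. \<Phi> m q) (s + 2 * of_int q * \<mu>, y + 2 * of_int q * \<nu>))
        + dx \<xi> (s + 2 * of_int q * \<mu>, y + 2 * of_int q * \<nu>)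
          * cnj (\<Phi> (s + 2 * of_int q * \<mu>, y + 2 * of_int q * \<nu>) q)) (at s)"
      by (intro has_vector_derivative_mult has_vector_derivative_cnj
          has_dx_shift[OF Xi_smooth[OF \<xi>]] has_dx_shift[OF D_smooth_smooth[OF \<Phi>]])
    then show "((\<lambda>s. tA \<mu> \<nu> \<xi> \<Phi> s y q) has_vector_derivative
        tA \<mu> \<nu> (dx \<xi>) \<Phi> s y q - tA \<mu> \<nu> \<xi> (delta_Y \<Phi>) s y q) (at s)"
      by (simp add: tA_def delta_Y_def algebra_simps)
  qed (use mu in simp, (intro lattice_dominated_diff tA_dominated \<xi> Xi_dx b)+)
  then show ?thesis unfolding act_D_eq by (simp add: infsum_diff tA_summable \<xi> Xi_dx b)
qed

text \<open>The bound available is for \<open>delta_X\<close> of \<Phi>, not for its y-derivative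
  alone. Its extra multiplier is rewritten, by 2 \<pi> i c q (x' - q \<mu>) = K (x'^2 - x^2) with x'
  = x + 2 q \<mu>, as squares of the coordinate falling on \<xi>, where the decay absorbs
  them.\<close>

lemma act_D_has_dy:
  fixes x :: real
  assumes \<xi>: "\<xi> \<in> Xi" and \<Phi>: "\<Phi> \<in> D_smooth c \<mu> \<nu>"
  defines "K \<equiv> of_real pi * of_int c * \<i> / (2 * of_real \<mu>)"
  shows "((\<lambda>s. act_D \<mu> \<nu> \<xi> \<Phi> (x, s)) has_vector_derivative
    act_D \<mu> \<nu> (dy \<xi>) \<Phi> (x, y) - act_D \<mu> \<nu> \<xi> (delta_X c \<mu> \<Phi>) (x, y)
      - K * (act_D \<mu> \<nu> (xm (xm \<xi>)) \<Phi> (x, y) - (of_real x)\<^sup>2 * act_D \<mu> \<nu> \<xi> \<Phi> (x, y))) (at y)"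
proof -
  note b = D_smooth_bdd[OF \<Phi>] and xx = Xi_xm[OF Xi_xm[OF \<xi>]]
  let ?t = "\<lambda>\<xi> \<Phi> s q. tA \<mu> \<nu> \<xi> \<Phi> x s q"
  have "((\<lambda>s. \<Sum>\<^sub>\<infinity>q. ?t \<xi> \<Phi> s q) has_vector_derivative
      (\<Sum>\<^sub>\<infinity>q. (?t (dy \<xi>) \<Phi> y q - ?t \<xi> (delta_X c \<mu> \<Phi>) y q)
        - K * (?t (xm (xm \<xi>)) \<Phi> y q - (of_real x)\<^sup>2 * ?t \<xi> \<Phi> y q))) (at y)"
  proof (rule has_dy_lattice_sum[where L = "2 * \<mu>" and x = x])
    fix q :: int and s :: real
    let ?x = "x + 2 * of_int q * \<mu>" and ?y = "s + 2 * of_int q * \<nu>"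
    have "((\<lambda>s. \<xi> (?x, s + 2 * of_int q * \<nu>) * cnj (\<Phi> (?x, s + 2 * of_int q * \<nu>) q)) has_vector_derivative
        \<xi> (?x, ?y) * cnj (dy (\<lambda>m. \<Phi> m q) (?x, ?y)) + dy \<xi> (?x, ?y) * cnj (\<Phi> (?x, ?y) q)) (at s)"
      by (intro has_vector_derivative_mult has_vector_derivative_cnj
          has_dy_shift[OF Xi_smooth[OF \<xi>]] has_dy_shift[OF D_smooth_smooth[OF \<Phi>]])
    moreover have "\<xi> (?x, ?y) * cnj (dy (\<lambda>m. \<Phi> m q) (?x, ?y)) + dy \<xi> (?x, ?y) * cnj (\<Phi> (?x, ?y) q)
        = (?t (dy \<xi>) \<Phi> s q - ?t \<xi> (delta_X c \<mu> \<Phi>) s q)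
          - K * (?t (xm (xm \<xi>)) \<Phi> s q - (of_real x)\<^sup>2 * ?t \<xi> \<Phi> s q)"
    proof -
      define v where "v = \<xi> (?x, ?y) * cnj (\<Phi> (?x, ?y) q)"
      have mu': "complex_of_real \<mu> \<noteq> 0" using mu by simp
      have "K * (?t (xm (xm \<xi>)) \<Phi> s q - (of_real x)\<^sup>2 * ?t \<xi> \<Phi> s q)
          = K * ((of_real ?x)\<^sup>2 - (of_real x)\<^sup>2) * v"
        by (simp add: tA_def xm_def v_def power2_eq_square algebra_simps)
      also have "K * ((of_real ?x)\<^sup>2 - (of_real x)\<^sup>2)
          = 2 * of_real pi * \<i> * of_int c * of_int q * of_real (?x - of_int q * \<mu>)"
        using mu' by (simp add: K_def field_simps power2_eq_square)
      finally have 1: "K * (?t (xm (xm \<xi>)) \<Phi> s q - (of_real x)\<^sup>2 * ?t \<xi> \<Phi> s q)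
          = 2 * of_real pi * \<i> * of_int c * of_int q * of_real (?x - of_int q * \<mu>) * v" .
      have 2: "?t \<xi> (delta_X c \<mu> \<Phi>) s q
          = - (2 * of_real pi * \<i> * of_int c * of_int q * of_real (?x - of_int q * \<mu>)) * v
            - \<xi> (?x, ?y) * cnj (dy (\<lambda>m. \<Phi> m q) (?x, ?y))"
        by (simp add: tA_def delta_X_def v_def algebra_simps)
      show ?thesis unfolding 1 2 by (simp add: tA_def v_def)
    qed
    ultimately show "((\<lambda>s. ?t \<xi> \<Phi> s q) has_vector_derivative
        (?t (dy \<xi>) \<Phi> s q - ?t \<xi> (delta_X c \<mu> \<Phi>) s q)
          - K * (?t (xm (xm \<xi>)) \<Phi> s q - (of_real x)\<^sup>2 * ?t \<xi> \<Phi> s q)) (at s)"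
      by (simp add: tA_def)
  qed (use mu in simp, (intro lattice_dominated_diff lattice_dominated_cmult tA_dominated \<xi> Xi_dy xx b)+)
  moreover have "(\<Sum>\<^sub>\<infinity>q. (?t (dy \<xi>) \<Phi> y q - ?t \<xi> (delta_X c \<mu> \<Phi>) y q)
        - K * (?t (xm (xm \<xi>)) \<Phi> y q - (of_real x)\<^sup>2 * ?t \<xi> \<Phi> y q))
      = ((\<Sum>\<^sub>\<infinity>q. ?t (dy \<xi>) \<Phi> y q) - (\<Sum>\<^sub>\<infinity>q. ?t \<xi> (delta_X c \<mu> \<Phi>) y q))
        - K * ((\<Sum>\<^sub>\<infinity>q. ?t (xm (xm \<xi>)) \<Phi> y q) - (of_real x)\<^sup>2 * (\<Sum>\<^sub>\<infinity>q. ?t \<xi> \<Phi> y q))"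
    by (subst infsum_diff infsum_cmult_right' |
        (intro summable_on_diff_complex summable_on_cmult_right tA_summable \<xi> Xi_dy xx b; fail))+ (rule refl)
  ultimately show ?thesis unfolding act_D_eq by simp
qed

text \<open>Multiplication by x outside the sum and inside it differ by 2 q \<mu> in the q-th term.
  Scaled by the constants of \<open>nab0\<close>, this discrepancy is the conjugated multiplier of
  \<open>delta_Z\<close>, and its quadratic analogue that of \<open>delta_X\<close>.\<close>

lemma nabla0_Leibniz:
  assumes \<xi>: "\<xi> \<in> Xi" and \<Phi>: "\<Phi> \<in> D_smooth c \<mu> \<nu>"
  shows "nab0 W (act_D \<mu> \<nu> \<xi> \<Phi>) = (\<lambda>m. act_D \<mu> \<nu> (nab0 W \<xi>) \<Phi> m + act_D \<mu> \<nu> \<xi> (delta c \<mu> W \<Phi>) m)"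
proof
  fix m :: pt
  obtain a b d where W: "W = (a, b, d)" by (cases W)
  obtain x y where m: "m = (x, y)" by (cases m)
  note bd = D_smooth_bdd[OF \<Phi>]
  define K :: complex where "K = of_real pi * of_int c * \<i> / (2 * of_real \<mu>)"
  define L :: complex where "L = of_real pi * \<i> / of_real \<mu>"
  have dxA: "dx (act_D \<mu> \<nu> \<xi> \<Phi>) m = act_D \<mu> \<nu> (dx \<xi>) \<Phi> m - act_D \<mu> \<nu> \<xi> (delta_Y \<Phi>) m"
    unfolding m by (rule dx_at[OF act_D_has_dx[OF assms]])
  have dyA: "dy (act_D \<mu> \<nu> \<xi> \<Phi>) m = act_D \<mu> \<nu> (dy \<xi>) \<Phi> m - act_D \<mu> \<nu> \<xi> (delta_X c \<mu> \<Phi>) m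
      - K * (act_D \<mu> \<nu> (xm (xm \<xi>)) \<Phi> m - xm (xm (act_D \<mu> \<nu> \<xi> \<Phi>)) m)"
    unfolding m dy_at[where f = "act_D \<mu> \<nu> \<xi> \<Phi>", OF act_D_has_dy[OF assms]] K_def
    by (simp add: xm_def power2_eq_square)
  have z: "L * xm (act_D \<mu> \<nu> \<xi> \<Phi>) m = L * act_D \<mu> \<nu> (xm \<xi>) \<Phi> m + act_D \<mu> \<nu> \<xi> (delta_Z \<Phi>) m"
  proof -
    have "tA \<mu> \<nu> \<xi> (delta_Z \<Phi>) x y q = L * of_real x * tA \<mu> \<nu> \<xi> \<Phi> x y q - L * tA \<mu> \<nu> (xm \<xi>) \<Phi> x y q" for q
    proof -
      have "L * (2 * of_int q * of_real \<mu>) = 2 * of_real pi * \<i> * of_int q"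
        using mu by (simp add: L_def field_simps)
      then have "L * of_real x - L * of_real (x + 2 * of_int q * \<mu>) = - (2 * of_real pi * \<i> * of_int q)"
        by (simp add: algebra_simps)
      moreover have "L * of_real x * tA \<mu> \<nu> \<xi> \<Phi> x y q - L * tA \<mu> \<nu> (xm \<xi>) \<Phi> x y q
          = (L * of_real x - L * of_real (x + 2 * of_int q * \<mu>)) * tA \<mu> \<nu> \<xi> \<Phi> x y q"
        by (simp add: tA_def xm_def algebra_simps)
      moreover have "tA \<mu> \<nu> \<xi> (delta_Z \<Phi>) x y q = - (2 * of_real pi * \<i> * of_int q) * tA \<mu> \<nu> \<xi> \<Phi> x y q"
        by (simp add: tA_def delta_Z_def)
      ultimately show ?thesis by simp
    qed
    then have "act_D \<mu> \<nu> \<xi> (delta_Z \<Phi>) m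
        = (\<Sum>\<^sub>\<infinity>q. L * of_real x * tA \<mu> \<nu> \<xi> \<Phi> x y q - L * tA \<mu> \<nu> (xm \<xi>) \<Phi> x y q)"
      unfolding m act_D_eq by presburger
    also have "\<dots> = L * of_real x * act_D \<mu> \<nu> \<xi> \<Phi> m - L * act_D \<mu> \<nu> (xm \<xi>) \<Phi> m"
      unfolding m act_D_eq
      by (subst infsum_diff infsum_cmult_right' |
        (intro summable_on_cmult_right tA_summable \<xi> Xi_xm bd; fail))+ (rule refl)
    finally show ?thesis by (simp add: xm_def m)
  qed
  have r: "act_D \<mu> \<nu> \<xi> (delta c \<mu> W \<Phi>) m = of_real a * act_D \<mu> \<nu> \<xi> (delta_X c \<mu> \<Phi>) m
      + of_real b * act_D \<mu> \<nu> \<xi> (delta_Y \<Phi>) m + of_real d * act_D \<mu> \<nu> \<xi> (delta_Z \<Phi>) m"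
    unfolding W delta.simps
    by (simp add: act_D_add_right act_D_cmult_right \<xi> bd bdd_alg_add bdd_alg_cmult)
  have l: "act_D \<mu> \<nu> (nab0 W \<xi>) \<Phi> m = of_real a * (K * act_D \<mu> \<nu> (xm (xm \<xi>)) \<Phi> m - act_D \<mu> \<nu> (dy \<xi>) \<Phi> m)
      - of_real b * act_D \<mu> \<nu> (dx \<xi>) \<Phi> m + of_real d * (L * act_D \<mu> \<nu> (xm \<xi>) \<Phi> m)"
    unfolding W nabla0_eq K_def[symmetric] L_def[symmetric]
    by (simp add: act_D_add_left act_D_diff_left act_D_cmult_left \<xi> bd Xi_add Xi_diff Xi_cmult Xi_dx Xi_dy Xi_xm)
  have "nab0 W (act_D \<mu> \<nu> \<xi> \<Phi>) m = of_real a * (- dy (act_D \<mu> \<nu> \<xi> \<Phi>) m + K * xm (xm (act_D \<mu> \<nu> \<xi> \<Phi>)) m)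
      + of_real b * (- dx (act_D \<mu> \<nu> \<xi> \<Phi>) m) + of_real d * (L * xm (act_D \<mu> \<nu> \<xi> \<Phi>) m)"
    unfolding W nabla0_eq K_def L_def by (rule refl)
  also have "\<dots> = act_D \<mu> \<nu> (nab0 W \<xi>) \<Phi> m + act_D \<mu> \<nu> \<xi> (delta c \<mu> W \<Phi>) m"
    unfolding dxA dyA z r l by (simp add: algebra_simps)
  finally show "nab0 W (act_D \<mu> \<nu> \<xi> \<Phi>) m = act_D \<mu> \<nu> (nab0 W \<xi>) \<Phi> m + act_D \<mu> \<nu> \<xi> (delta c \<mu> W \<Phi>) m" .
qed

end

section \<open>The perturbed connection and its curvature\<close>

locale qhm_perturbed = qhm +
  fixes g1 g2 :: "real \<Rightarrow> real" and H :: "heis \<Rightarrow> alg"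
  assumes g1d: "\<And>y. g1 differentiable (at y)" and g2d: "\<And>x. g2 differentiable (at x)"
    and g1p: "\<And>y (p::int). g1 y = g1 (y - 2 * of_int p * \<nu>)"
    and g2p: "\<And>x (p::int). g2 x = g2 (x - 2 * of_int p * \<mu>)"
    and Hlin: "linear_into (E_skew c \<mu> \<nu>) H"
    and HX: "H X = (\<lambda>(x, y) p. \<i> * of_real (g1 y) * delta0 p)"
    and HY: "H Y = (\<lambda>(x, y) p. \<i> * of_real (g2 x) * delta0 p)"
    and HZ: "H Z = (\<lambda>(x, y) p. 0)"
begin

abbreviation nab :: conn where "nab \<equiv> conn_add nab0 H"

text \<open>The minus sign reflects that the action is conjugate-linear in the algebra element: i g
  acts as multiplication by -i g.\<close>

definition pert_mult :: "heis \<Rightarrow> pt \<Rightarrow> complex" where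
  "pert_mult W m = - \<i> * (of_real (fst W) * of_real (g1 (snd m)) + of_real (fst (snd W)) * of_real (g2 (fst m)))"

lemma act_H: "act_E (H W) f = (\<lambda>m. pert_mult W m * f m)"
proof -
  obtain a b d where W: "W = (a, b, d)" by (cases W)
  have W': "W = a *\<^sub>R X + b *\<^sub>R Y + d *\<^sub>R Z" by (simp add: W X_def Y_def Z_def)
  have lin: "linear (\<lambda>W. H W m p)" for m p using Hlin unfolding linear_into_def by blast
  have "H W m p = of_real a * H X m p + of_real b * H Y m p + of_real d * H Z m p" for m p
    unfolding W' using linear_add[OF lin[of m p]] linear_scale[OF lin[of m p]]
    by (simp add: scaleR_conv_of_real)
  then have "H W = (\<lambda>m p. (\<i> * (of_real a * of_real (g1 (snd m)) + of_real b * of_real (g2 (fst m)))) * delta0 p)"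
    by (auto simp: fun_eq_iff HX HY HZ algebra_simps)
  then have "act_E (H W) f = (\<lambda>m. cnj (\<i> * (of_real a * of_real (g1 (snd m)) + of_real b * of_real (g2 (fst m)))) * f m)"
    by (simp only: act_E_delta0)
  then show ?thesis by (simp add: pert_mult_def W)
qed

lemma nab_eq: "nab W \<xi> = (\<lambda>m. nab0 W \<xi> m + pert_mult W m * \<xi> m)"
  by (simp add: conn_add_def act_H)

lemma Xi_hh: "\<xi> \<in> Xi \<Longrightarrow> (\<lambda>m. pert_mult W m * \<xi> m) \<in> Xi"
proof -
  assume "\<xi> \<in> Xi"
  then have "act_E (H W) \<xi> \<in> Xi" using Hlin unfolding linear_into_def E_skew_def E_smooth_def by blast
  then show ?thesis by (simp add: act_H)
qed

lemma g1_shift: "g1 (y + 2 * of_int q * \<nu>) = g1 y"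
  using g1p[of "y + 2 * of_int q * \<nu>" q] by simp

lemma g2_shift: "g2 (x + 2 * of_int q * \<mu>) = g2 x"
  using g2p[of "x + 2 * of_int q * \<mu>" q] by simp

text \<open>The multiplier is invariant under the translations by (2 q \<mu>, 2 q \<nu>) occurring
  in the right action, so it can be taken out of the sum.\<close>

lemma act_D_hh: "act_D \<mu> \<nu> (\<lambda>m. pert_mult W m * \<xi> m) \<Phi> m = pert_mult W m * act_D \<mu> \<nu> \<xi> \<Phi> m"
proof (cases m)
  case (Pair x y)
  have *: "tA \<mu> \<nu> (\<lambda>m. pert_mult W m * \<xi> m) \<Phi> x y = (\<lambda>q. pert_mult W (x, y) * tA \<mu> \<nu> \<xi> \<Phi> x y q)"
    by (simp add: tA_def pert_mult_def fun_eq_iff g1_shift g2_shift)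
  show ?thesis unfolding Pair act_D_eq * by (simp add: infsum_cmult_right')
qed

text \<open>The multiplier takes imaginary values and agrees at the two arguments in every summand,
  which differ by a lattice translation. Conjugation in the second slot then reverses the
  sign.\<close>

lemma ipD_hh: "ipD (\<lambda>m. pert_mult W m * \<xi> m) \<eta> m p + ipD \<xi> (\<lambda>m. pert_mult W m * \<eta> m) m p = 0"
proof (cases m)
  case (Pair x y)
  have g: "g1 (y - 2 * of_int p * \<nu>) = g1 y" using g1p by simp
  have g': "g2 (x - 2 * of_int p * \<mu> + of_int k) = g2 (x + of_int k)" for k :: int
    using g2p[of "x + of_int k" p] by (simp add: algebra_simps)
  have *: "tD c \<mu> \<nu> (\<lambda>m. pert_mult W m * \<xi> m) \<eta> x y p = (\<lambda>k. - tD c \<mu> \<nu> \<xi> (\<lambda>m. pert_mult W m * \<eta> m) x y p k)"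
    by (simp add: tD_def pert_mult_def fun_eq_iff g g')
  show ?thesis unfolding Pair ip_D_eq * by (simp add: infsum_uminus)
qed

lemma compatible_nab: "compatible_connection c \<mu> \<nu> nab"
  unfolding compatible_connection_def connection_def
proof (intro conjI allI ballI)
  fix W \<xi> assume \<xi>: "\<xi> \<in> Xi"
  show "nab W \<xi> \<in> Xi" unfolding nab_eq by (intro Xi_add Xi_nabla0 Xi_hh \<xi>)
  show "nab W (\<lambda>m. a * \<xi> m) = (\<lambda>m. a * nab W \<xi> m)" for a
    by (simp add: nab_eq nabla0_cmult \<xi> algebra_simps)
  fix \<eta> assume \<eta>: "\<eta> \<in> Xi"
  show "nab W (\<lambda>m. \<xi> m + \<eta> m) = (\<lambda>m. nab W \<xi> m + nab W \<eta> m)"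
    by (simp add: nab_eq nabla0_add \<xi> \<eta> algebra_simps)
  have "ipD (nab W \<xi>) \<eta> m p + ipD \<xi> (nab W \<eta>) m p = ipD (nab0 W \<xi>) \<eta> m p + ipD \<xi> (nab0 W \<eta>) m p" for m p
    unfolding nab_eq ipD_add_left[OF Xi_nabla0[OF \<xi>] Xi_hh[OF \<xi>] \<eta>] ipD_add_right[OF \<xi> Xi_nabla0[OF \<eta>] Xi_hh[OF \<eta>]]
    using ipD_hh[of W \<xi> \<eta> m p] by (simp add: algebra_simps)
  then show "delta c \<mu> W (ipD \<xi> \<eta>) = (\<lambda>m p. ipD (nab W \<xi>) \<eta> m p + ipD \<xi> (nab W \<eta>) m p)"
    by (simp add: delta_ipD \<xi> \<eta>)
next
  fix \<xi> m
  have "linear (\<lambda>W. pert_mult W m * \<xi> m)"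
    by (rule linearI) (simp_all add: pert_mult_def algebra_simps scaleR_conv_of_real)
  then show "linear (\<lambda>W. nab W \<xi> m)"
    unfolding nab_eq by (intro linear_compose_add linear_nabla0)
next
  fix W \<xi> \<Phi> assume \<xi>: "\<xi> \<in> Xi" and \<Phi>: "\<Phi> \<in> D_smooth c \<mu> \<nu>"
  show "nab W (act_D \<mu> \<nu> \<xi> \<Phi>) = (\<lambda>m. act_D \<mu> \<nu> (nab W \<xi>) \<Phi> m + act_D \<mu> \<nu> \<xi> (delta c \<mu> W \<Phi>) m)"
    unfolding nab_eq nabla0_Leibniz[OF \<xi> \<Phi>]
    by (simp add: act_D_add_left Xi_nabla0 Xi_hh \<xi> D_smooth_bdd[OF \<Phi>] act_D_hh distrib_left add_ac)
qed

text \<open>The part of order zero. The rest of the connection is a vector field with constant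
  coefficients, so commutators reduce to derivatives of this function.\<close>

definition conn_mult :: "heis \<Rightarrow> pt \<Rightarrow> complex" where
  "conn_mult W m = of_real (fst W) * (of_real pi * of_int c * \<i> / (2 * of_real \<mu>) * (of_real (fst m))\<^sup>2)
    + of_real (snd (snd W)) * (of_real pi * \<i> / of_real \<mu> * of_real (fst m)) + pert_mult W m"

lemma nab_MM: "nab (a, b, d) \<xi> = (\<lambda>m. (- of_real a) * dy \<xi> m + (- of_real b) * dx \<xi> m + conn_mult (a, b, d) m * \<xi> m)"
  by (simp add: nab_eq nabla0_eq conn_mult_def xm_def fun_eq_iff power2_eq_square algebra_simps)

text \<open>Second-order terms cancel by symmetry of mixed derivatives. As g1 depends on y alone and
  is paired with the derivative in y, its contribution is symmetric in a and a' and cancels;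
  likewise g2. The term linear in x cancels against the bracket because 2 K = c L.\<close>

lemma curvature_op_nab:
  assumes \<xi>: "\<xi> \<in> Xi"
  shows "curvature_op c nab (a, b, d) (a', b', d') \<xi>
    = (\<lambda>m. - of_real (b * d' - b' * d) * (of_real pi * \<i> / of_real \<mu>) * \<xi> m)"
proof (rule ext, clarify)
  fix x y :: real
  define K :: complex where "K = of_real pi * of_int c * \<i> / (2 * of_real \<mu>)"
  define L :: complex where "L = of_real pi * \<i> / of_real \<mu>"
  have KL: "2 * K = of_int c * L" by (simp add: K_def L_def)
  have sx: "smooth (dx \<xi>)" and sy: "smooth (dy \<xi>)" using \<xi> by (auto intro: Xi_smooth Xi_dx Xi_dy)
  obtain G1 where G1: "(g1 has_real_derivative G1) (at y)" using g1d real_differentiable_def by blast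
  obtain G2 where G2: "(g2 has_real_derivative G2) (at x)" using g2d real_differentiable_def by blast
  have My: "((\<lambda>s. conn_mult (a, b, d) (x, s)) has_vector_derivative - \<i> * (of_real a * of_real G1)) (at y)" for a b d
  proof -
    have "((\<lambda>s. (of_real a * (K * (of_real x)\<^sup>2) + of_real d * (L * of_real x))
        + - \<i> * (of_real a * of_real (g1 s) + of_real b * of_real (g2 x))) has_vector_derivative
        0 + - \<i> * (of_real a * of_real G1 + 0)) (at y)"
      by (intro has_vector_derivative_add has_vector_derivative_const has_vector_derivative_mult_right
          has_vector_derivative_of_real G1)
    then show ?thesis by (simp add: conn_mult_def pert_mult_def K_def L_def)
  qed
  have Mx: "((\<lambda>s. conn_mult (a, b, d) (s, y)) has_vector_derivative
      of_real a * (2 * K * of_real x) + of_real d * L - \<i> * (of_real b * of_real G2)) (at x)" for a b d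
  proof -
    have "((\<lambda>s. (of_real a * (K * of_real (s\<^sup>2)) + of_real d * (L * of_real s))
        + - \<i> * (of_real a * of_real (g1 y) + of_real b * of_real (g2 s))) has_vector_derivative
        (of_real a * (K * of_real (2 * x)) + of_real d * (L * of_real 1)) + - \<i> * (0 + of_real b * of_real G2)) (at x)"
      by (intro has_vector_derivative_add has_vector_derivative_const has_vector_derivative_mult_right
          has_vector_derivative_of_real G2) (auto intro!: derivative_eq_intros)
    then show ?thesis by (simp add: conn_mult_def pert_mult_def K_def L_def algebra_simps)
  qed
  have Ny: "dy (nab (a, b, d) \<xi>) (x, y) = (- of_real a) * dy (dy \<xi>) (x, y) + (- of_real b) * dy (dx \<xi>) (x, y)
      + (conn_mult (a, b, d) (x, y) * dy \<xi> (x, y) + - \<i> * (of_real a * of_real G1) * \<xi> (x, y))" for a b d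
    unfolding nab_MM dy_def[of "\<lambda>m. _ m + _ m"] case_prod_conv
    by (intro vector_derivative_at has_vector_derivative_add has_vector_derivative_mult_right
        has_vector_derivative_mult has_dy smooth_differentiable_y sx sy Xi_smooth[OF \<xi>] My)
  have Nx: "dx (nab (a, b, d) \<xi>) (x, y) = (- of_real a) * dx (dy \<xi>) (x, y) + (- of_real b) * dx (dx \<xi>) (x, y)
      + (conn_mult (a, b, d) (x, y) * dx \<xi> (x, y)
        + (of_real a * (2 * K * of_real x) + of_real d * L - \<i> * (of_real b * of_real G2)) * \<xi> (x, y))" for a b d
    unfolding nab_MM dx_def[of "\<lambda>m. _ m + _ m"] case_prod_conv
    by (intro vector_derivative_at has_vector_derivative_add has_vector_derivative_mult_right
        has_vector_derivative_mult has_dx smooth_differentiable_x sx sy Xi_smooth[OF \<xi>] Mx)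
  have NN: "nab (a, b, d) (nab W' \<xi>) (x, y) = (- of_real a) * dy (nab W' \<xi>) (x, y)
      + (- of_real b) * dx (nab W' \<xi>) (x, y) + conn_mult (a, b, d) (x, y) * nab W' \<xi> (x, y)" for a b d W'
    using nab_MM[of a b d "nab W' \<xi>"] by simp
  have N: "nab (a, b, d) \<xi> (x, y) = (- of_real a) * dy \<xi> (x, y) + (- of_real b) * dx \<xi> (x, y)
      + conn_mult (a, b, d) (x, y) * \<xi> (x, y)" for a b d
    using nab_MM[of a b d \<xi>] by simp
  have Nb: "nab (0, 0, of_int c * (a * b' - b * a')) \<xi> (x, y)
      = of_int c * (of_real a * of_real b' - of_real b * of_real a') * L * of_real x * \<xi> (x, y)"
    unfolding N by (simp add: conn_mult_def pert_mult_def L_def)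
  have "curvature_op c nab (a, b, d) (a', b', d') \<xi> (x, y) =
      (of_real a * (\<i> * (of_real a' * of_real G1)) - of_real a' * (\<i> * (of_real a * of_real G1))
       - of_real b * (of_real a' * (2 * K * of_real x) + of_real d' * L - \<i> * (of_real b' * of_real G2))
       + of_real b' * (of_real a * (2 * K * of_real x) + of_real d * L - \<i> * (of_real b * of_real G2))) * \<xi> (x, y)
      - of_int c * (of_real a * of_real b' - of_real b * of_real a') * L * of_real x * \<xi> (x, y)"
    unfolding curvature_op_def bracket.simps Nb unfolding NN Ny Nx N dx_dy_commute[OF Xi_smooth[OF \<xi>]]
    by (simp add: algebra_simps)
  also have "\<dots> = - of_real (b * d' - b' * d) * L * \<xi> (x, y)"
    unfolding KL by (simp add: algebra_simps)
  finally show "curvature_op c nab (a, b, d) (a', b', d') \<xi> (x, y)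
      = - of_real (b * d' - b' * d) * (of_real pi * \<i> / of_real \<mu>) * \<xi> (x, y)"
    unfolding L_def .
qed

end


subsection \<open>The module over inner products\<close>

context qhm
begin

abbreviation U :: "vec \<Rightarrow> vec \<Rightarrow> vec \<Rightarrow> vec" where "U f g z \<equiv> act_E (ipE f g) z"

text \<open>Serves to show that \<open>U f g z\<close> is in \<open>Xi\<close>. The Leibniz rule
  makes the span stable under \<open>nab0\<close>, from which both derivatives and multiplication by
  x can be recovered.\<close>

inductive_set Uspan :: "vec set" where
  U: "f \<in> Xi \<Longrightarrow> g \<in> Xi \<Longrightarrow> z \<in> Xi \<Longrightarrow> U f g z \<in> Uspan"
| add: "u \<in> Uspan \<Longrightarrow> v \<in> Uspan \<Longrightarrow> (\<lambda>m. u m + v m) \<in> Uspan"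

text \<open>The left inner product is conjugate-linear in its first slot and the action in the
  algebra element, so the composite is linear.\<close>

lemma U_cmult: "U (\<lambda>m. a * f m) g z = (\<lambda>m. a * U f g z m)"
proof -
  have "tE c \<mu> \<nu> (\<lambda>m. a * f m) g x y p = (\<lambda>k. cnj a * tE c \<mu> \<nu> f g x y p k)" for x y p
    by (simp add: tE_def fun_eq_iff)
  then have "ipE (\<lambda>m. a * f m) g = (\<lambda>m p. cnj a * ipE f g m p)"
    by (auto simp: fun_eq_iff ip_E_eq infsum_cmult_right')
  then show ?thesis by (simp add: act_E_cmult_alg)
qed

lemma Uspan_cmult: "u \<in> Uspan \<Longrightarrow> (\<lambda>m. a * u m) \<in> Uspan"
proof (induction rule: Uspan.induct)
  case (U f g z)
  then show ?case using Uspan.U[OF Xi_cmult[OF U(1)] U(2,3)] by (simp add: U_cmult)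
next
  case (add u v)
  then show ?case using Uspan.add by (simp add: distrib_left)
qed

lemma nabla0_U:
  assumes "f \<in> Xi" "g \<in> Xi" "z \<in> Xi"
  shows "nab0 W (U f g z) = (\<lambda>m. U (nab0 W f) g z m + (U f (nab0 W g) z m + U f g (nab0 W z) m))"
proof -
  have r: "bdd_alg (ipD f g)" if "f \<in> Xi" "g \<in> Xi" for f g using rapid_bdd rapid_ipD that by blast
  show ?thesis
    by (simp add: act_E_ipE assms Xi_nabla0 nabla0_Leibniz ipD_D_smooth delta_ipD act_D_add_right r)
qed

lemma Uspan_props:
  assumes "u \<in> Uspan"
  shows "periodic_T u \<and> continuous_on UNIV u \<and> (\<forall>x y. (\<lambda>s. u (s, y)) differentiable (at x)) \<and>
    (\<forall>x y. (\<lambda>s. u (x, s)) differentiable (at y)) \<and> bounded (range u) \<and>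
    dx u \<in> Uspan \<and> dy u \<in> Uspan \<and> xm u \<in> Uspan"
  using assms
proof induction
  case (U f g z)
  define \<Phi> where "\<Phi> = ipD g z"
  have \<Phi>: "\<Phi> \<in> D_smooth c \<mu> \<nu>" "rapid \<Phi>" unfolding \<Phi>_def by (intro ipD_D_smooth rapid_ipD U)+
  have bdd: "bdd_alg \<Phi>" by (rule rapid_bdd[OF \<Phi>(2)])
  have u: "U f g z = act_D \<mu> \<nu> f \<Phi>" unfolding \<Phi>_def by (rule act_E_ipE[OF U])
  obtain C where C: "C \<ge> 0" "\<And>q m. norm (tA \<mu> \<nu> f \<Phi> (fst m) (snd m) q) \<le> C * wt (fst m + of_int q * (2 * \<mu>))"
    by (rule lattice_dominatedE[OF tA_dominated[OF U(1) bdd, of fst snd]]) blast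
  have L: "2 * \<mu> \<noteq> 0" using mu by simp
  have "periodic_T (act_D \<mu> \<nu> f \<Phi>)"
  proof -
    have "\<Phi> (x, y + 1) q = \<Phi> (x, y) q" for x y q
      using \<Phi>(2) unfolding rapid_def periodic_T_def by blast
    moreover have "y + 1 + 2 * of_int q * \<nu> = (y + 2 * of_int q * \<nu>) + 1" for y and q :: int by simp
    ultimately have "tA \<mu> \<nu> f \<Phi> x (y + 1) q = tA \<mu> \<nu> f \<Phi> x y q" for x y q
      by (simp only: tA_def Xi_periodic[OF U(1)])
    then show ?thesis by (simp add: periodic_T_def act_D_eq)
  qed
  moreover have "continuous_on UNIV (act_D \<mu> \<nu> f \<Phi>)"
  proof -
    have "continuous_on UNIV (\<lambda>m. tA \<mu> \<nu> f \<Phi> (fst m) (snd m) q)" for q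
    proof -
      have c: "continuous_on UNIV (\<lambda>m. \<Phi> m q)" using \<Phi>(2) unfolding rapid_def by blast
      show ?thesis unfolding tA_def
        by (intro continuous_intros continuous_on_compose2[OF Xi_continuous[OF U(1)]]
          continuous_on_compose2[OF c]) auto
    qed
    then have "continuous_on UNIV (\<lambda>m. \<Sum>\<^sub>\<infinity>q. tA \<mu> \<nu> f \<Phi> (fst m) (snd m) q)"
      by (rule continuous_on_lattice_sum[OF L _ tA_dominated[OF U(1) bdd]])
    moreover have "act_D \<mu> \<nu> f \<Phi> = (\<lambda>m. \<Sum>\<^sub>\<infinity>q. tA \<mu> \<nu> f \<Phi> (fst m) (snd m) q)"
      by (auto simp: act_D_eq)
    ultimately show ?thesis by (simp only:)
  qed
  moreover have "(\<lambda>s. act_D \<mu> \<nu> f \<Phi> (s, y)) differentiable (at x)" for x y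
    by (rule differentiableI_vector[OF act_D_has_dx[OF U(1) \<Phi>(1)]])
  moreover have "(\<lambda>s. act_D \<mu> \<nu> f \<Phi> (x, s)) differentiable (at y)" for x y
    by (rule differentiableI_vector[OF act_D_has_dy[OF U(1) \<Phi>(1)]])
  moreover have "bounded (range (act_D \<mu> \<nu> f \<Phi>))"
  proof -
    have "norm (act_D \<mu> \<nu> f \<Phi> (x, y)) \<le> C * ((1 + 1 / (2 * \<mu>)\<^sup>2) * (4 * wsum))" for x y
    proof -
      have "norm (act_D \<mu> \<nu> f \<Phi> (x, y)) \<le> (\<Sum>\<^sub>\<infinity>q. C * wt (x + of_int q * (2 * \<mu>)))"
        unfolding act_D_eq by (rule norm_infsum_bounded)
          (intro summable_on_cmult_right summable_wt_step L, use C(2)[of "(x, y)"] in simp)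
      also have "\<dots> \<le> C * ((1 + 1 / (2 * \<mu>)\<^sup>2) * (4 * wsum))"
        unfolding infsum_cmult_right' by (intro mult_left_mono infsum_wt_step L C)
      finally show ?thesis .
    qed
    then show ?thesis unfolding bounded_iff by (intro exI[of _ "C * ((1 + 1 / (2 * \<mu>)\<^sup>2) * (4 * wsum))"]) auto
  qed
  moreover have nab: "nab0 W (U f g z) \<in> Uspan" for W
    unfolding nabla0_U[OF U] by (intro Uspan.add Uspan.U Xi_nabla0 U)
  have "dx (U f g z) = nab0 (0, - 1, 0) (U f g z)" by (simp add: nabla0_eq)
  then have dx: "dx (U f g z) \<in> Uspan" using nab by simp
  have x1: "xm (U f g z) \<in> Uspan" if "f \<in> Xi" "g \<in> Xi" "z \<in> Xi" for f g z
  proof -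
    have "nab0 (0, 0, 1) (U f g z) \<in> Uspan"
      unfolding nabla0_U[OF that] by (intro Uspan.add Uspan.U Xi_nabla0 that)
    \<comment> \<open>In the direction Z the connection is multiplication by \<pi> i x / \<mu>; its
      inverse constant isolates multiplication by x.\<close>
    then have "(\<lambda>m. of_real \<mu> / (of_real pi * \<i>) * nab0 (0, 0, 1) (U f g z) m) \<in> Uspan"
      by (rule Uspan_cmult)
    moreover have "(\<lambda>m. of_real \<mu> / (of_real pi * \<i>) * nab0 (0, 0, 1) (U f g z) m) = xm (U f g z)"
      using mu by (simp add: nabla0_eq fun_eq_iff)
    ultimately show ?thesis by simp
  qed
  have xspan: "xm u \<in> Uspan" if "u \<in> Uspan" for u
    using that
  proof induction
    case (add u v)
    then show ?case using Uspan.add[OF add.IH] by (simp add: xm_def distrib_left)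
  qed (rule x1)
  \<comment> \<open>In the direction -X the connection is the y-derivative minus a multiple of x^2.
    Adding the latter back, which the span permits, leaves the derivative.\<close>
  have "(\<lambda>m. nab0 (- 1, 0, 0) (U f g z) m
      + of_real pi * of_int c * \<i> / (2 * of_real \<mu>) * xm (xm (U f g z)) m) \<in> Uspan"
    by (intro Uspan.add nab Uspan_cmult xspan Uspan.U U)
  then have "dy (U f g z) \<in> Uspan" by (simp add: nabla0_eq)
  ultimately show ?case using dx x1[OF U] unfolding u by blast
next
  case (add u v)
  have "dx (\<lambda>m. u m + v m) = (\<lambda>m. dx u m + dx v m)" "dy (\<lambda>m. u m + v m) = (\<lambda>m. dy u m + dy v m)"
    by (rule dx_eqI dy_eqI; intro has_vector_derivative_add has_dx has_dy; use add.IH in simp)+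
  moreover have "xm (\<lambda>m. u m + v m) = (\<lambda>m. xm u m + xm v m)" by (simp add: xm_def distrib_left)
  moreover have "bounded (range (\<lambda>m. u m + v m))"
    using add.IH by (intro bounded_plus_comp) auto
  moreover have "periodic_T (\<lambda>m. u m + v m)" using add.IH by (simp add: periodic_T_def)
  ultimately show ?case using add.IH by (simp add: Uspan.add continuous_on_add differentiable_add)
qed

text \<open>Members are bounded and the span is stable under multiplication by x, so all x^n u are
  bounded: rapid decay without further estimates.\<close>

lemma Uspan_Xi: "u \<in> Uspan \<Longrightarrow> u \<in> Xi"
proof (rule Xi_coinduct[where S = Uspan])
  fix f n assume "f \<in> Uspan"
  have "(\<lambda>m. of_real (fst m) ^ n * f m) \<in> Uspan" for n
  proof (induction n)
    case (Suc n)
    then have "xm (\<lambda>m. of_real (fst m) ^ n * f m) \<in> Uspan" using Uspan_props by blast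
    then show ?case by (simp add: xm_def mult.assoc)
  qed (use \<open>f \<in> Uspan\<close> in simp)
  then show "bounded (range (\<lambda>(x, y). of_real x ^ n * f (x, y)))"
    using Uspan_props[of "\<lambda>m. of_real (fst m) ^ n * f m"] by (simp add: case_prod_unfold)
qed (use Uspan_props in blast)+

lemma Xi_U: "f \<in> Xi \<Longrightarrow> g \<in> Xi \<Longrightarrow> z \<in> Xi \<Longrightarrow> U f g z \<in> Xi"
  by (rule Uspan_Xi, rule Uspan.U)

lemma ipE_add_left:
  assumes "f \<in> Xi" "f' \<in> Xi" "g \<in> Xi"
  shows "ipE (\<lambda>m. f m + f' m) g m p = ipE f g m p + ipE f' g m p"
proof (cases m)
  case (Pair x y)
  have *: "tE c \<mu> \<nu> (\<lambda>m. f m + f' m) g x y p = (\<lambda>k. tE c \<mu> \<nu> f g x y p k + tE c \<mu> \<nu> f' g x y p k)"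
    by (simp add: tE_def fun_eq_iff algebra_simps)
  show ?thesis unfolding Pair ip_E_eq * by (simp add: infsum_add tE_summable assms)
qed

lemma ipE_cmult_left: "ipE (\<lambda>m. a * f m) g m p = cnj a * ipE f g m p"
proof (cases m)
  case (Pair x y)
  have *: "tE c \<mu> \<nu> (\<lambda>m. a * f m) g x y p = (\<lambda>k. cnj a * tE c \<mu> \<nu> f g x y p k)"
    by (simp add: tE_def fun_eq_iff algebra_simps)
  show ?thesis unfolding Pair ip_E_eq * by (simp add: infsum_cmult_right')
qed

lemma ipE_cmult_right: "ipE f (\<lambda>m. a * g m) m p = a * ipE f g m p"
proof (cases m)
  case (Pair x y)
  have *: "tE c \<mu> \<nu> f (\<lambda>m. a * g m) x y p = (\<lambda>k. a * tE c \<mu> \<nu> f g x y p k)"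
    by (simp add: tE_def fun_eq_iff algebra_simps)
  show ?thesis unfolding Pair ip_E_eq * by (simp add: infsum_cmult_right')
qed

lemma U_add_left:
  assumes "f \<in> Xi" "f' \<in> Xi" "g \<in> Xi" "z \<in> Xi"
  shows "U (\<lambda>m. f m + f' m) g z m = U f g z m + U f' g z m"
proof -
  have "ipE (\<lambda>m. f m + f' m) g = (\<lambda>m p. ipE f g m p + ipE f' g m p)"
    by (simp add: fun_eq_iff ipE_add_left assms)
  then show ?thesis by (simp add: act_E_add_alg rapid_bdd rapid_ipE assms)
qed

subsection \<open>Module operators and connections\<close>

definition lin_op :: "(vec \<Rightarrow> vec) \<Rightarrow> bool" where
  "lin_op T \<longleftrightarrow> (\<forall>\<xi>\<in>Xi. T \<xi> \<in> Xi) \<and>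
     (\<forall>\<xi>\<in>Xi. \<forall>\<eta>\<in>Xi. T (\<lambda>m. \<xi> m + \<eta> m) = (\<lambda>m. T \<xi> m + T \<eta> m)) \<and>
     (\<forall>\<xi>\<in>Xi. \<forall>a. T (\<lambda>m. a * \<xi> m) = (\<lambda>m. a * T \<xi> m))"

text \<open>By \<open>act_E_ipE\<close>, \<open>U f g z\<close> is \<open>f\<close> acted upon by the inner product of \<open>g\<close> and \<open>z\<close>, so the following are the
  operators that commute with the right action of the span of the inner products.\<close>

definition mod_op :: "(vec \<Rightarrow> vec) \<Rightarrow> bool" where
  "mod_op T \<longleftrightarrow> lin_op T \<and> (\<forall>f\<in>Xi. \<forall>g\<in>Xi. \<forall>z\<in>Xi. T (U f g z) = U (T f) g z)"

definition trace_pairing :: "vec \<Rightarrow> vec \<Rightarrow> complex" where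
  "trace_pairing f g = trE (ipE f g)"

text \<open>What a compatible connection retains in a fixed direction once the derivation of the
  right algebra is eliminated: a Leibniz rule in three arguments and skewness for the scalar
  pairing.\<close>

definition conn_op :: "(vec \<Rightarrow> vec) \<Rightarrow> bool" where
  "conn_op D \<longleftrightarrow> lin_op D \<and>
     (\<forall>f\<in>Xi. \<forall>g\<in>Xi. \<forall>z\<in>Xi. D (U f g z) = (\<lambda>m. U (D f) g z m + (U f (D g) z m + U f g (D z) m))) \<and>
     (\<forall>f\<in>Xi. \<forall>g\<in>Xi. trace_pairing (D f) g = - trace_pairing f (D g))"

lemma lin_opD:
  assumes "lin_op T"
  shows "\<xi> \<in> Xi \<Longrightarrow> T \<xi> \<in> Xi"
    and "\<xi> \<in> Xi \<Longrightarrow> \<eta> \<in> Xi \<Longrightarrow> T (\<lambda>m. \<xi> m + \<eta> m) = (\<lambda>m. T \<xi> m + T \<eta> m)"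
    and "\<xi> \<in> Xi \<Longrightarrow> T (\<lambda>m. a * \<xi> m) = (\<lambda>m. a * T \<xi> m)"
  using assms unfolding lin_op_def by blast+

lemma lin_op_0: "lin_op T \<Longrightarrow> T (\<lambda>m. 0) = (\<lambda>m. 0)"
  using lin_opD(3)[of T "\<lambda>m. 0" 0] Xi_0 by simp

lemma lin_op_sum:
  assumes T: "lin_op T" and u: "\<And>i. i \<in> I \<Longrightarrow> u i \<in> Xi"
  shows "T (\<lambda>m. \<Sum>i\<in>I. u i m) = (\<lambda>m. \<Sum>i\<in>I. T (u i) m)"
  using u
proof (induction I rule: infinite_finite_induct)
  case (insert i I)
  have "(\<lambda>m. \<Sum>i\<in>I. u i m) \<in> Xi" by (rule Xi_sum) (use insert.prems in auto)
  then show ?case using insert lin_opD(2)[OF T] by simp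
qed (simp_all add: lin_op_0[OF T])

lemma mod_op_lin: "mod_op T \<Longrightarrow> lin_op T"
  and mod_op_U: "mod_op T \<Longrightarrow> f \<in> Xi \<Longrightarrow> g \<in> Xi \<Longrightarrow> z \<in> Xi \<Longrightarrow> T (U f g z) = U (T f) g z"
  unfolding mod_op_def by blast+

lemma conn_op_lin: "conn_op D \<Longrightarrow> lin_op D"
  and conn_op_U: "conn_op D \<Longrightarrow> f \<in> Xi \<Longrightarrow> g \<in> Xi \<Longrightarrow> z \<in> Xi \<Longrightarrow>
    D (U f g z) = (\<lambda>m. U (D f) g z m + (U f (D g) z m + U f g (D z) m))"
  and conn_op_skew: "conn_op D \<Longrightarrow> f \<in> Xi \<Longrightarrow> g \<in> Xi \<Longrightarrow> trace_pairing (D f) g = - trace_pairing f (D g)"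
  unfolding conn_op_def by blast+

lemma lin_op_add: "lin_op S \<Longrightarrow> lin_op T \<Longrightarrow> lin_op (\<lambda>\<xi> m. S \<xi> m + T \<xi> m)"
  unfolding lin_op_def by (auto simp: Xi_add algebra_simps)

lemma lin_op_cmult: "lin_op T \<Longrightarrow> lin_op (\<lambda>\<xi> m. a * T \<xi> m)"
  unfolding lin_op_def by (auto simp: Xi_cmult algebra_simps)

lemma mod_op_add: "mod_op S \<Longrightarrow> mod_op T \<Longrightarrow> mod_op (\<lambda>\<xi> m. S \<xi> m + T \<xi> m)"
  using lin_op_add unfolding mod_op_def by (auto simp: U_add_left lin_opD(1) fun_eq_iff)

lemma mod_op_cmult: "mod_op T \<Longrightarrow> mod_op (\<lambda>\<xi> m. a * T \<xi> m)"
  using lin_op_cmult unfolding mod_op_def by (auto simp: U_cmult)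

lemma mod_op_diff: "mod_op S \<Longrightarrow> mod_op T \<Longrightarrow> mod_op (\<lambda>\<xi> m. S \<xi> m - T \<xi> m)"
  using mod_op_add[OF _ mod_op_cmult[of T "- 1"], of S] by simp

lemma mod_op_id: "mod_op (\<lambda>\<xi>. \<xi>)"
  unfolding mod_op_def lin_op_def by simp

lemma mod_op_comp: "mod_op S \<Longrightarrow> mod_op T \<Longrightarrow> mod_op (\<lambda>\<xi>. S (T \<xi>))"
  unfolding mod_op_def lin_op_def by (auto simp: Xi_U)

text \<open>In the two orders of composition the terms where D falls on g or z coincide, so only the
  action on f remains.\<close>

lemma mod_op_commutator:
  assumes D: "conn_op D" and T: "mod_op T"
  shows "mod_op (\<lambda>\<xi> m. D (T \<xi>) m - T (D \<xi>) m)"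
  unfolding mod_op_def
proof (intro conjI ballI)
  note Dl = conn_op_lin[OF D] and Tl = mod_op_lin[OF T]
  note X = lin_opD(1)[OF Dl] lin_opD(1)[OF Tl]
  show "lin_op (\<lambda>\<xi> m. D (T \<xi>) m - T (D \<xi>) m)"
    unfolding lin_op_def
    by (auto simp: X Xi_diff lin_opD(2)[OF Dl] lin_opD(2)[OF Tl] lin_opD(3)[OF Dl] lin_opD(3)[OF Tl] algebra_simps)
  fix f g z assume f: "f \<in> Xi" and g: "g \<in> Xi" and z: "z \<in> Xi"
  have "T (D (U f g z)) = T (\<lambda>m. U (D f) g z m + (U f (D g) z m + U f g (D z) m))"
    by (simp add: conn_op_U[OF D] f g z)
  also have "\<dots> = (\<lambda>m. T (U (D f) g z) m + (T (U f (D g) z) m + T (U f g (D z)) m))"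
    by (simp add: lin_opD(2)[OF Tl] Xi_U Xi_add X f g z)
  also have "\<dots> = (\<lambda>m. U (T (D f)) g z m + (U (T f) (D g) z m + U (T f) g (D z) m))"
    by (simp add: mod_op_U[OF T] X f g z)
  finally have 1: "T (D (U f g z)) = (\<lambda>m. U (T (D f)) g z m + (U (T f) (D g) z m + U (T f) g (D z) m))" .
  have 2: "D (T (U f g z)) = (\<lambda>m. U (D (T f)) g z m + (U (T f) (D g) z m + U (T f) g (D z) m))"
    by (simp add: mod_op_U[OF T] conn_op_U[OF D] X f g z)
  have 3: "U (\<lambda>m. D (T f) m - T (D f) m) g z m = U (D (T f)) g z m - U (T (D f)) g z m" for m
    using U_add_left[OF X(1)[OF X(2)[OF f]] Xi_cmult[OF X(2)[OF X(1)[OF f]], of "- 1"] g z, of m]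
      U_cmult[of "- 1" "T (D f)" g z] by simp
  show "(\<lambda>m. D (T (U f g z)) m - T (D (U f g z)) m) = U (\<lambda>m. D (T f) m - T (D f) m) g z"
    by (rule ext) (simp add: 1 2 3)
qed

lemma BB_trace: "f \<in> Xi \<Longrightarrow> g \<in> Xi \<Longrightarrow> trace_pairing f g = trace_D (ipD g f)"
  by (simp add: trace_pairing_def trace_D_ipD)

lemma BB_add_left: "f \<in> Xi \<Longrightarrow> f' \<in> Xi \<Longrightarrow> g \<in> Xi \<Longrightarrow> trace_pairing (\<lambda>m. f m + f' m) g = trace_pairing f g + trace_pairing f' g"
proof -
  assume f: "f \<in> Xi" "f' \<in> Xi" "g \<in> Xi"
  then have "ipE (\<lambda>m. f m + f' m) g = (\<lambda>m p. ipE f g m p + ipE f' g m p)"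
    by (simp add: fun_eq_iff ipE_add_left)
  then show ?thesis using trE_add[OF rapid_ipE rapid_ipE, of f g f' g] f by (simp add: trace_pairing_def)
qed

lemma BB_cmult_left: "trace_pairing (\<lambda>m. a * f m) g = cnj a * trace_pairing f g"
  by (simp add: trace_pairing_def ipE_cmult_left trE_def)

lemma BB_cmult_right: "trace_pairing f (\<lambda>m. a * g m) = a * trace_pairing f g"
  by (simp add: trace_pairing_def ipE_cmult_right trE_def)

lemma BB_diff_left:
  assumes "f \<in> Xi" "f' \<in> Xi" "g \<in> Xi"
  shows "trace_pairing (\<lambda>m. f m - f' m) g = trace_pairing f g - trace_pairing f' g"
  using BB_add_left[OF assms(1) Xi_cmult[OF assms(2), of "- 1"] assms(3)] BB_cmult_left[of "- 1" f' g] by simp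

lemma compatible_Leibniz:
  assumes "compatible_connection c \<mu> \<nu> D" "f \<in> Xi" "g \<in> Xi" "z \<in> Xi"
  shows "D W (U f g z) = (\<lambda>m. U (D W f) g z m + act_D \<mu> \<nu> f (delta c \<mu> W (ipD g z)) m)"
proof -
  have "D W \<xi> \<in> Xi" if "\<xi> \<in> Xi" for \<xi>
    using assms(1) that unfolding compatible_connection_def connection_def by blast
  moreover have "D W (act_D \<mu> \<nu> f (ipD g z)) =
      (\<lambda>m. act_D \<mu> \<nu> (D W f) (ipD g z) m + act_D \<mu> \<nu> f (delta c \<mu> W (ipD g z)) m)"
    using assms(1) ipD_D_smooth[OF assms(3,4)] assms(2)
    unfolding compatible_connection_def connection_def by blast
  ultimately show ?thesis by (simp add: act_E_ipE assms)
qed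

lemma compatible_lin_op: "compatible_connection c \<mu> \<nu> D \<Longrightarrow> lin_op (D W)"
  unfolding compatible_connection_def connection_def lin_op_def by blast

text \<open>Compatibility expands the derivation of an inner product in two ways: inside the Leibniz
  rule it yields the three terms, and under the trace, where it vanishes, it yields
  skewness.\<close>

lemma compatible_conn_op:
  assumes D: "compatible_connection c \<mu> \<nu> D" shows "conn_op (D W)"
  unfolding conn_op_def
proof (intro conjI ballI)
  show l: "lin_op (D W)" by (rule compatible_lin_op[OF D])
  note X = lin_opD(1)[OF l]
  have d: "delta c \<mu> W (ipD f g) = (\<lambda>m p. ipD (D W f) g m p + ipD f (D W g) m p)"
    if "f \<in> Xi" "g \<in> Xi" for f g
    using D that unfolding compatible_connection_def by blast
  have r: "bdd_alg (ipD f g)" if "f \<in> Xi" "g \<in> Xi" for f g using rapid_bdd rapid_ipD that by blast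
  fix f g assume f: "f \<in> Xi" and g: "g \<in> Xi"
  show "D W (U f g z) = (\<lambda>m. U (D W f) g z m + (U f (D W g) z m + U f g (D W z) m))" if z: "z \<in> Xi" for z
    unfolding compatible_Leibniz[OF D f g z] d[OF g z]
    by (simp add: act_D_add_right r X f g z act_E_ipE)
  have "0 = trace_D (\<lambda>m p. ipD (D W g) f m p + ipD g (D W f) m p)"
    using trace_D_delta[OF g f, of W] d[OF g f] by simp
  also have "\<dots> = trace_pairing f (D W g) + trace_pairing (D W f) g"
    by (simp add: trace_D_add rapid_ipD BB_trace X f g)
  finally show "trace_pairing (D W f) g = - trace_pairing f (D W g)" by (simp add: add_eq_0_iff)
qed

text \<open>Both connections produce the same term with \<open>delta\<close>, which cancels in the
  difference.\<close>

lemma compatible_diff_mod_op: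
  assumes D: "compatible_connection c \<mu> \<nu> D" and D': "compatible_connection c \<mu> \<nu> D'"
  shows "mod_op (\<lambda>\<xi> m. D' W \<xi> m - D W \<xi> m)"
  unfolding mod_op_def
proof (intro conjI ballI)
  note l = compatible_lin_op[OF D, of W] and l' = compatible_lin_op[OF D', of W]
  show "lin_op (\<lambda>\<xi> m. D' W \<xi> m - D W \<xi> m)"
    using lin_op_add[OF l' lin_op_cmult[OF l, of "- 1"]] by simp
  fix f g z assume f: "f \<in> Xi" and g: "g \<in> Xi" and z: "z \<in> Xi"
  have "U (\<lambda>m. D' W f m - D W f m) g z m = U (D' W f) g z m - U (D W f) g z m" for m
    using U_add_left[OF lin_opD(1)[OF l' f] Xi_cmult[OF lin_opD(1)[OF l f], of "- 1"] g z, of m]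
      U_cmult[of "- 1" "D W f" g z] by simp
  then show "(\<lambda>m. D' W (U f g z) m - D W (U f g z) m) = U (\<lambda>m. D' W f m - D W f m) g z"
    by (simp add: compatible_Leibniz[OF D f g z] compatible_Leibniz[OF D' f g z] fun_eq_iff)
qed

text \<open>Bounded coefficients and covariance, both inherited by uniform approximation from
  \<open>E0\<close>, are what associativity with \<open>U\<close> rests on.\<close>

lemma E_smooth_mod_op:
  assumes "\<Psi> \<in> E_smooth c \<mu> \<nu>" shows "mod_op (act_E \<Psi>)"
proof -
  have b: "bdd_alg \<Psi>" using assms E_alg_bounded unfolding E_smooth_def bdd_alg_def by blast
  have p: "E_per c \<mu> \<nu> \<Psi>" using assms E_alg_per unfolding E_smooth_def by blast
  have "lin_op (act_E \<Psi>)"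
    using assms act_E_add[OF b] act_E_cmult unfolding E_smooth_def lin_op_def by blast
  then show ?thesis using act_E_act_ipE[OF b p] unfolding mod_op_def by blast
qed

end


subsection \<open>Traces of module operators\<close>

lemma conv_summable:
  assumes "bdd_alg \<Psi>" "rapid \<Phi>"
  shows "(\<lambda>q::int. \<Psi> m q * \<Phi> (m' q) (p - q)) summable_on UNIV"
proof -
  obtain A where A: "A \<ge> 0" "\<And>m p. norm (\<Psi> m p) \<le> A" using assms(1) unfolding bdd_alg_def by blast
  obtain C where C: "C \<ge> 0" "\<And>m p. norm (\<Phi> m p) \<le> C * wt (of_int p)"
    using assms(2) unfolding rapid_def by blast
  show ?thesis
  proof (rule summable_bounded[where M = "\<lambda>q. A * C * wt (of_int (- p) + of_int q)"])
    fix q :: int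
    have "norm (\<Psi> m q * \<Phi> (m' q) (p - q)) \<le> A * (C * wt (of_int (p - q)))"
      unfolding norm_mult by (intro mult_mono A C) auto
    also have "wt (of_int (p - q)) = wt (of_int (- p) + of_int q)"
      using wt_minus[of "of_int (p - q)"] by simp
    finally show "norm (\<Psi> m q * \<Phi> (m' q) (p - q)) \<le> A * C * wt (of_int (- p) + of_int q)"
      by (simp add: mult.assoc)
  qed (intro summable_on_cmult_right summable_wt_shift)
qed

lemma rapid_sum: "(\<And>i. i \<in> I \<Longrightarrow> rapid (\<Psi> i)) \<Longrightarrow> rapid (\<lambda>m p. \<Sum>i\<in>I. \<Psi> i m p)"
proof (induction I rule: infinite_finite_induct)
  case (insert i I)
  then show ?case using rapid_add[of "\<Psi> i" "\<lambda>m p. \<Sum>i\<in>I. \<Psi> i m p"] by simp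
qed (auto simp: rapid_def periodic_T_def intro: exI[of _ 0])

lemma act_E_sum:
  assumes "finite I" "\<And>i. i \<in> I \<Longrightarrow> rapid (\<Psi> i)" "z \<in> Xi"
  shows "act_E (\<lambda>m p. \<Sum>i\<in>I. \<Psi> i m p) z = (\<lambda>m. \<Sum>i\<in>I. act_E (\<Psi> i) z m)"
  using assms(1,2)
proof (induction I rule: finite_induct)
  case empty
  show ?case using act_E_cmult_alg[of 0 "\<lambda>m p. 0" z] by simp
next
  case (insert i I)
  have "rapid (\<lambda>m p. \<Sum>i\<in>I. \<Psi> i m p)" by (rule rapid_sum) (use insert.prems in simp)
  then show ?case
    using act_E_add_alg[OF rapid_bdd rapid_bdd assms(3), of "\<Psi> i" "\<lambda>m p. \<Sum>i\<in>I. \<Psi> i m p"] insert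
    by simp
qed

lemma compatible_linear:
  assumes "compatible_connection c \<mu> \<nu> D" "\<xi> \<in> Xi" shows "linear (\<lambda>W. D W \<xi> m)"
proof -
  have "\<forall>\<xi>\<in>Xi. \<forall>m. linear (\<lambda>W. D W \<xi> m)"
    using assms(1) unfolding compatible_connection_def connection_def by (elim conjE)
  then show ?thesis using assms(2) by blast
qed

lemma (in qhm) BB_diff_right:
  assumes f: "f \<in> Xi" and g: "g \<in> Xi" and g': "g' \<in> Xi"
  shows "trace_pairing f (\<lambda>m. g m - g' m) = trace_pairing f g - trace_pairing f g'"
proof -
  have "ipD (\<lambda>m. g m - g' m) f = (\<lambda>m p. ipD g f m p + ipD (\<lambda>m. - 1 * g' m) f m p)"
    by (simp only: fun_eq_iff ipD_diff_left[OF g g' f] ipD_cmult_left) simp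
  then have "trace_pairing f (\<lambda>m. g m - g' m) = trace_pairing f g + trace_pairing f (\<lambda>m. - 1 * g' m)"
    using trace_D_add[OF rapid_ipD[OF g f] rapid_ipD[OF Xi_cmult[OF g', of "- 1"] f]]
    by (simp add: BB_trace f g Xi_diff g' Xi_uminus)
  then show ?thesis unfolding BB_cmult_right by simp
qed

locale qhm_frame = qhm +
  fixes N :: nat and fr gr :: "nat \<Rightarrow> vec"
  assumes fr: "\<And>i. i < N \<Longrightarrow> fr i \<in> Xi" and gr: "\<And>i. i < N \<Longrightarrow> gr i \<in> Xi"
    and frame: "\<And>m p. (\<Sum>i<N. ipE (fr i) (gr i) m p) = Id_E m p"
begin

definition op_elem :: "(vec \<Rightarrow> vec) \<Rightarrow> alg" where
  "op_elem T = (\<lambda>m p. \<Sum>i<N. ipE (T (fr i)) (gr i) m p)"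

definition Tr :: "(vec \<Rightarrow> vec) \<Rightarrow> complex" where
  "Tr T = (\<Sum>i<N. trace_pairing (T (fr i)) (gr i))"

lemma frame_expand: "z \<in> Xi \<Longrightarrow> (\<lambda>m. \<Sum>i<N. U (fr i) (gr i) z m) = z"
proof -
  assume z: "z \<in> Xi"
  have "act_E (\<lambda>m p. \<Sum>i<N. ipE (fr i) (gr i) m p) z = (\<lambda>m. \<Sum>i<N. U (fr i) (gr i) z m)"
    by (rule act_E_sum) (use z fr gr rapid_ipE in auto)
  moreover have "(\<lambda>m p. \<Sum>i<N. ipE (fr i) (gr i) m p) = Id_E" by (simp add: fun_eq_iff frame)
  ultimately show ?thesis by simp
qed

lemma rapid_el: "lin_op T \<Longrightarrow> rapid (op_elem T)"
  unfolding op_elem_def by (rule rapid_sum) (simp add: rapid_ipE lin_opD(1) fr gr)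

lemma E_per_el: "E_per c \<mu> \<nu> (op_elem T)"
  unfolding E_per_def op_elem_def sum_distrib_left
  by (intro allI sum.cong[OF refl]) (rule E_per_ipE[unfolded E_per_def, rule_format])

lemma act_E_el: "mod_op T \<Longrightarrow> z \<in> Xi \<Longrightarrow> act_E (op_elem T) z = T z"
proof -
  assume T: "mod_op T" and z: "z \<in> Xi"
  note X = lin_opD(1)[OF mod_op_lin[OF T]]
  have "act_E (op_elem T) z = (\<lambda>m. \<Sum>i<N. U (T (fr i)) (gr i) z m)"
    unfolding op_elem_def by (rule act_E_sum) (use z fr gr rapid_ipE X in auto)
  also have "\<dots> = (\<lambda>m. \<Sum>i<N. T (U (fr i) (gr i) z) m)"
    by (intro ext sum.cong refl) (simp add: mod_op_U[OF T] fr gr z)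
  also have "\<dots> = T (\<lambda>m. \<Sum>i<N. U (fr i) (gr i) z m)"
    by (rule lin_op_sum[OF mod_op_lin[OF T], symmetric]) (use Xi_U fr gr z in auto)
  finally show ?thesis using frame_expand[OF z] by simp
qed

lemma el_E_smooth: "mod_op T \<Longrightarrow> op_elem T \<in> E_smooth c \<mu> \<nu>"
proof -
  assume T: "mod_op T"
  have "op_elem T \<in> E_alg c \<mu> \<nu>" by (intro rapid_E_alg rapid_el mod_op_lin T E_per_el)
  moreover have "act_E (op_elem T) \<xi> \<in> Xi" if "\<xi> \<in> Xi" for \<xi>
    unfolding act_E_el[OF T that] by (rule lin_opD(1)[OF mod_op_lin[OF T] that])
  ultimately show ?thesis unfolding E_smooth_def by blast
qed

text \<open>Evaluates the definite description: the frame provides the element, faithfulness its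
  uniqueness.\<close>

lemma curvature_eq_el:
  assumes T: "mod_op T" and eq: "\<And>\<xi>. \<xi> \<in> Xi \<Longrightarrow> curvature_op c D W W' \<xi> = T \<xi>"
  shows "curvature c \<mu> \<nu> D W W' = op_elem T"
  unfolding curvature_def
proof (rule the_equality)
  show "op_elem T \<in> E_smooth c \<mu> \<nu> \<and> (\<forall>\<xi>\<in>Xi. act_E (op_elem T) \<xi> = curvature_op c D W W' \<xi>)"
    using el_E_smooth[OF T] act_E_el[OF T] eq by simp
next
  fix \<Psi> assume "\<Psi> \<in> E_smooth c \<mu> \<nu> \<and> (\<forall>\<xi>\<in>Xi. act_E \<Psi> \<xi> = curvature_op c D W W' \<xi>)"
  then show "\<Psi> = op_elem T"
    by (intro act_E_faithful) (simp add: eq act_E_el[OF T])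
qed

lemma el_scalar: "op_elem (\<lambda>\<xi> m. a * \<xi> m) = (\<lambda>m p. cnj a * Id_E m p)"
  by (simp add: op_elem_def ipE_cmult_left sum_distrib_left[symmetric] frame)

text \<open>By \<open>conv_ipE\<close>, convolving with \<open>op_elem T\<close> applies T in the
  first slot of each left inner product of the frame sum.\<close>

lemma conv_op_elem:
  assumes T: "mod_op T" shows "conv sig (op_elem T) (op_elem T) = op_elem (\<lambda>\<xi>. T (T \<xi>))"
proof (rule ext, rule ext)
  fix m p
  note X = lin_opD(1)[OF mod_op_lin[OF T]]
  have r: "rapid (op_elem T)" by (rule rapid_el[OF mod_op_lin[OF T]])
  have "conv sig (op_elem T) (op_elem T) m p
      = (\<Sum>\<^sub>\<infinity>q. \<Sum>i<N. op_elem T m q * ipE (T (fr i)) (gr i) (sig (- q) m) (p - q))"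
    unfolding conv_def by (subst (2) op_elem_def) (simp add: sum_distrib_left)
  also have "\<dots> = (\<Sum>i<N. conv sig (op_elem T) (ipE (T (fr i)) (gr i)) m p)"
    unfolding conv_def
    using infsum_sum[of "{..<N}" "\<lambda>i q. op_elem T m q * ipE (T (fr i)) (gr i) (sig (- q) m) (p - q)" UNIV]
      conv_summable[OF rapid_bdd[OF r] rapid_ipE[OF X[OF fr] gr]] by simp
  also have "\<dots> = (\<Sum>i<N. ipE (act_E (op_elem T) (T (fr i))) (gr i) m p)"
    by (intro sum.cong refl) (simp add: conv_ipE rapid_bdd[OF r] E_per_el X fr gr)
  also have "\<dots> = op_elem (\<lambda>\<xi>. T (T \<xi>)) m p"
    unfolding op_elem_def[of "\<lambda>\<xi>. T (T \<xi>)"] by (intro sum.cong refl) (simp add: act_E_el[OF T] X fr)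
  finally show "conv sig (op_elem T) (op_elem T) m p = op_elem (\<lambda>\<xi>. T (T \<xi>)) m p" .
qed

lemma trE_sum: "finite I \<Longrightarrow> (\<And>i. i \<in> I \<Longrightarrow> rapid (\<Psi> i)) \<Longrightarrow> trE (\<lambda>m p. \<Sum>i\<in>I. \<Psi> i m p) = (\<Sum>i\<in>I. trE (\<Psi> i))"
proof (induction I rule: finite_induct)
  case (insert i I)
  have "rapid (\<lambda>m p. \<Sum>i\<in>I. \<Psi> i m p)" by (rule rapid_sum) (use insert.prems in simp)
  then show ?case using trE_add[of "\<Psi> i" "\<lambda>m p. \<Sum>i\<in>I. \<Psi> i m p"] insert by simp
qed (simp add: trE_0)

lemma trE_el: "lin_op T \<Longrightarrow> trE (op_elem T) = Tr T"
  unfolding op_elem_def Tr_def trace_pairing_def by (rule trE_sum) (simp_all add: rapid_ipE lin_opD(1) fr gr)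

text \<open>The functional takes the trace of a sum of three squares. Concatenating the three frame
  lists represents that sum directly.\<close>

lemma trace_E_el3:
  assumes "lin_op R" "lin_op S" "lin_op T"
  shows "trace_E c \<mu> \<nu> (\<lambda>m p. op_elem R m p + op_elem S m p + op_elem T m p) = Tr R + Tr S + Tr T"
proof -
  let ?l = "\<lambda>T. map (\<lambda>i. (T (fr i), gr i)) [0..<N]"
  let ?xs = "?l R @ ?l S @ ?l T"
  have "set ?xs \<subseteq> Xi \<times> Xi" using assms fr gr by (auto simp: lin_opD(1))
  note t = trace_E_list[OF this]
  have l: "(\<Sum>(\<xi>, \<eta>)\<leftarrow>?l T. ipE \<xi> \<eta> m p) = op_elem T m p" for T m p
    by (simp add: op_elem_def o_def interv_sum_list_conv_sum_set_nat atLeast0LessThan)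
  have "(\<lambda>m p. \<Sum>(\<xi>, \<eta>)\<leftarrow>?xs. ipE \<xi> \<eta> m p) = (\<lambda>m p. op_elem R m p + op_elem S m p + op_elem T m p)"
    unfolding map_append sum_list_append l by (simp add: add.assoc)
  with t have "trace_E c \<mu> \<nu> (\<lambda>m p. op_elem R m p + op_elem S m p + op_elem T m p)
      = trE (\<lambda>m p. op_elem R m p + op_elem S m p + op_elem T m p)" by simp
  also have "\<dots> = Tr R + Tr S + Tr T"
    by (simp add: trE_add rapid_add rapid_el assms trE_el)
  finally show ?thesis .
qed

lemma YM_op_elem:
  assumes T: "mod_op T1" "mod_op T2" "mod_op T3"
    and eq: "curvature c \<mu> \<nu> D X Y = op_elem T1" "curvature c \<mu> \<nu> D X Z = op_elem T2" "curvature c \<mu> \<nu> D Y Z = op_elem T3"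
  shows "YM c \<mu> \<nu> D = - (Tr (\<lambda>\<xi>. T1 (T1 \<xi>)) + Tr (\<lambda>\<xi>. T2 (T2 \<xi>)) + Tr (\<lambda>\<xi>. T3 (T3 \<xi>)))"
  unfolding YM_def Let_def eq
  by (simp add: conv_op_elem T trace_E_el3 mod_op_lin mod_op_comp)

lemma Tr_cong: "(\<And>\<xi>. \<xi> \<in> Xi \<Longrightarrow> S \<xi> = T \<xi>) \<Longrightarrow> Tr S = Tr T"
  unfolding Tr_def using fr by simp

lemma Tr_add: "lin_op S \<Longrightarrow> lin_op T \<Longrightarrow> Tr (\<lambda>\<xi> m. S \<xi> m + T \<xi> m) = Tr S + Tr T"
  unfolding Tr_def sum.distrib[symmetric] by (rule sum.cong[OF refl]) (simp add: BB_add_left lin_opD(1) fr gr)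

lemma Tr_diff: "lin_op S \<Longrightarrow> lin_op T \<Longrightarrow> Tr (\<lambda>\<xi> m. S \<xi> m - T \<xi> m) = Tr S - Tr T"
  unfolding Tr_def sum_subtractf[symmetric] by (rule sum.cong[OF refl]) (simp add: BB_diff_left lin_opD(1) fr gr)

lemma Tr_cmult: "Tr (\<lambda>\<xi> m. a * T \<xi> m) = cnj a * Tr T"
  unfolding Tr_def sum_distrib_left by (simp add: BB_cmult_left)

text \<open>The area of the fundamental domain of the lattice of step 2|\<mu>|.\<close>

lemma Tr_id: "Tr (\<lambda>\<xi>. \<xi>) = of_real (2 * \<bar>\<mu>\<bar>)"
proof -
  have "Tr (\<lambda>\<xi>. \<xi>) = trE (op_elem (\<lambda>\<xi>. \<xi>))" by (rule trE_el[symmetric]) (rule mod_op_lin[OF mod_op_id])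
  also have "op_elem (\<lambda>\<xi>. \<xi>) = Id_E" by (simp add: op_elem_def frame fun_eq_iff)
  also have "trE Id_E = of_real (2 * \<bar>\<mu>\<bar>)"
    by (simp add: trE_def Id_E_def delta0_def content_Pair scaleR_conv_of_real)
  finally show ?thesis .
qed

text \<open>The sum \<open>K\<close> below is the derivative of the identity, moved to the left of \<open>T\<close>.\<close>

lemma Tr_commutator:
  assumes D: "conn_op D" and T: "mod_op T"
  shows "Tr (\<lambda>\<xi> m. D (T \<xi>) m - T (D \<xi>) m) = 0"
proof -
  note Dl = conn_op_lin[OF D] and Tl = mod_op_lin[OF T]
  note X = lin_opD(1)[OF Dl] lin_opD(1)[OF Tl]
  define K where "K = (\<lambda>m p. \<Sum>i<N. ipE (T (fr i)) (D (gr i)) m p + ipE (T (D (fr i))) (gr i) m p)"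
  have rK: "rapid (\<lambda>m p. ipE (T (fr i)) (D (gr i)) m p + ipE (T (D (fr i))) (gr i) m p)" if "i < N" for i
    by (intro rapid_add rapid_ipE X fr gr that)
  \<comment> \<open>D is applied to the expansion of z along the frame. The terms in which D falls
    on z add up to D z itself, so the others sum to zero.\<close>
  have zero: "(\<lambda>m. \<Sum>i<N. U (D (fr i)) (gr i) z m + U (fr i) (D (gr i)) z m) = (\<lambda>m. 0)" if z: "z \<in> Xi" for z
  proof
    fix m
    have "D z = D (\<lambda>m. \<Sum>i<N. U (fr i) (gr i) z m)" by (simp add: frame_expand[OF z])
    also have "\<dots> = (\<lambda>m. \<Sum>i<N. D (U (fr i) (gr i) z) m)"
      by (rule lin_op_sum[OF Dl]) (use Xi_U fr gr z in auto)
    also have "\<dots> = (\<lambda>m. \<Sum>i<N. U (D (fr i)) (gr i) z m + (U (fr i) (D (gr i)) z m + U (fr i) (gr i) (D z) m))"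
      by (intro ext sum.cong refl) (simp add: conn_op_U[OF D] fr gr z)
    finally have "D z m = (\<Sum>i<N. U (D (fr i)) (gr i) z m + (U (fr i) (D (gr i)) z m + U (fr i) (gr i) (D z) m))"
      by metis
    also have "\<dots> = (\<Sum>i<N. U (D (fr i)) (gr i) z m + U (fr i) (D (gr i)) z m) + (\<Sum>i<N. U (fr i) (gr i) (D z) m)"
      unfolding sum.distrib by (rule add.assoc[symmetric])
    also have "(\<Sum>i<N. U (fr i) (gr i) (D z) m) = D z m"
      using fun_cong[OF frame_expand[OF X(1)[OF z]], of m] .
    finally show "(\<Sum>i<N. U (D (fr i)) (gr i) z m + U (fr i) (D (gr i)) z m) = 0" by simp
  qed
  have "act_E K z = act_E (\<lambda>m p. 0) z" if z: "z \<in> Xi" for z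
  proof -
    have "act_E K z = (\<lambda>m. \<Sum>i<N. act_E (\<lambda>m p. ipE (T (fr i)) (D (gr i)) m p + ipE (T (D (fr i))) (gr i) m p) z m)"
      unfolding K_def by (rule act_E_sum) (use rK z in auto)
    also have "\<dots> = (\<lambda>m. \<Sum>i<N. T (\<lambda>m. U (D (fr i)) (gr i) z m + U (fr i) (D (gr i)) z m) m)"
      by (intro ext sum.cong refl)
        (simp add: act_E_add_alg rapid_bdd rapid_ipE X fr gr z lin_opD(2)[OF Tl] mod_op_U[OF T] Xi_U)
    also have "\<dots> = T (\<lambda>m. \<Sum>i<N. U (D (fr i)) (gr i) z m + U (fr i) (D (gr i)) z m)"
      by (rule lin_op_sum[OF Tl, symmetric]) (use Xi_U Xi_add fr gr z X in auto)
    also have "\<dots> = (\<lambda>m. 0)" unfolding zero[OF z] by (rule lin_op_0[OF Tl])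
    also have "\<dots> = act_E (\<lambda>m p. 0) z" using act_E_cmult_alg[of 0 "\<lambda>m p. 0" z] by simp
    finally show ?thesis .
  qed
  then have K: "K = (\<lambda>m p. 0)" by (rule act_E_faithful)
  have "Tr (\<lambda>\<xi> m. D (T \<xi>) m - T (D \<xi>) m) = (\<Sum>i<N. trace_pairing (D (T (fr i))) (gr i) - trace_pairing (T (D (fr i))) (gr i))"
    unfolding Tr_def by (intro sum.cong refl) (simp add: BB_diff_left X fr gr)
  \<comment> \<open>Skewness turns D applied to T f_i into minus D applied to g_i; what results is
    minus the trace of K.\<close>
  also have "\<dots> = - (\<Sum>i<N. trE (\<lambda>m p. ipE (T (fr i)) (D (gr i)) m p + ipE (T (D (fr i))) (gr i) m p))"
    unfolding sum_negf[symmetric]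
    by (intro sum.cong refl) (simp add: conn_op_skew[OF D] trE_add rapid_ipE trace_pairing_def[symmetric] X fr gr)
  also have "(\<Sum>i<N. trE (\<lambda>m p. ipE (T (fr i)) (D (gr i)) m p + ipE (T (D (fr i))) (gr i) m p)) = trE K"
    unfolding K_def by (rule trE_sum[symmetric]) (use rK in auto)
  finally show ?thesis by (simp add: K trE_0)
qed

text \<open>The constant term is a scalar s, so the coefficient of t is 2 s T1 as an operator. The
  trace conjugates s because left inner products are conjugate-linear in the first slot.\<close>

lemma Tr_quadratic:
  assumes T1: "mod_op T1" and T2: "mod_op T2"
  shows "\<exists>c0 c2 c3 c4. \<forall>t::real. Tr (\<lambda>\<xi>. (\<lambda>\<xi> m. s * \<xi> m + of_real t * T1 \<xi> m + of_real (t\<^sup>2) * T2 \<xi> m)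
      ((\<lambda>\<xi> m. s * \<xi> m + of_real t * T1 \<xi> m + of_real (t\<^sup>2) * T2 \<xi> m) \<xi>))
    = c0 + of_real t * (2 * cnj s * Tr T1) + of_real (t\<^sup>2) * c2 + of_real (t ^ 3) * c3 + of_real (t ^ 4) * c4"
proof (intro exI allI)
  fix t :: real
  note l1 = mod_op_lin[OF T1] and l2 = mod_op_lin[OF T2]
  note X = lin_opD(1)[OF l1] lin_opD(1)[OF l2]
  note l11 = mod_op_lin[OF mod_op_comp[OF T1 T1]] and l12 = mod_op_lin[OF mod_op_comp[OF T1 T2]]
    and l21 = mod_op_lin[OF mod_op_comp[OF T2 T1]] and l22 = mod_op_lin[OF mod_op_comp[OF T2 T2]]
  note lid = mod_op_lin[OF mod_op_id]
  let ?T = "\<lambda>\<xi> m. s * \<xi> m + of_real t * T1 \<xi> m + of_real (t\<^sup>2) * T2 \<xi> m"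
  have e1: "T1 (?T \<xi>) = (\<lambda>m. s * T1 \<xi> m + of_real t * T1 (T1 \<xi>) m + of_real (t\<^sup>2) * T1 (T2 \<xi>) m)" if "\<xi> \<in> Xi" for \<xi>
    by (simp add: lin_opD(2,3)[OF l1] that X Xi_add Xi_cmult del: of_real_power)
  have e2: "T2 (?T \<xi>) = (\<lambda>m. s * T2 \<xi> m + of_real t * T2 (T1 \<xi>) m + of_real (t\<^sup>2) * T2 (T2 \<xi>) m)" if "\<xi> \<in> Xi" for \<xi>
    by (simp add: lin_opD(2,3)[OF l2] that X Xi_add Xi_cmult del: of_real_power)
  have "Tr (\<lambda>\<xi>. ?T (?T \<xi>)) = Tr (\<lambda>\<xi> m. s\<^sup>2 * \<xi> m + ((of_real t * (2 * s)) * T1 \<xi> m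
      + (of_real (t\<^sup>2) * (2 * s * T2 \<xi> m + T1 (T1 \<xi>) m)
      + (of_real (t ^ 3) * (T1 (T2 \<xi>) m + T2 (T1 \<xi>) m) + of_real (t ^ 4) * T2 (T2 \<xi>) m))))"
    by (rule Tr_cong) (simp only: e1 e2,
        simp add: fun_eq_iff algebra_simps power2_eq_square power3_eq_cube power4_eq_xxxx)
  also have "\<dots> = (cnj s)\<^sup>2 * Tr (\<lambda>\<xi>. \<xi>) + (of_real t * (2 * cnj s) * Tr T1
      + (of_real (t\<^sup>2) * (2 * cnj s * Tr T2 + Tr (\<lambda>\<xi>. T1 (T1 \<xi>)))
      + (of_real (t ^ 3) * (Tr (\<lambda>\<xi>. T1 (T2 \<xi>)) + Tr (\<lambda>\<xi>. T2 (T1 \<xi>))) + of_real (t ^ 4) * Tr (\<lambda>\<xi>. T2 (T2 \<xi>)))))"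
    by (simp only: Tr_add Tr_cmult lin_op_add lin_op_cmult l1 l2 l11 l12 l21 l22 lid
        complex_cnj_mult complex_cnj_power complex_cnj_complex_of_real complex_cnj_numeral)
  finally show "Tr (\<lambda>\<xi>. ?T (?T \<xi>)) = (cnj s)\<^sup>2 * Tr (\<lambda>\<xi>. \<xi>) + of_real t * (2 * cnj s * Tr T1)
      + of_real (t\<^sup>2) * (2 * cnj s * Tr T2 + Tr (\<lambda>\<xi>. T1 (T1 \<xi>)))
      + of_real (t ^ 3) * (Tr (\<lambda>\<xi>. T1 (T2 \<xi>)) + Tr (\<lambda>\<xi>. T2 (T1 \<xi>))) + of_real (t ^ 4) * Tr (\<lambda>\<xi>. T2 (T2 \<xi>))"
    by (simp add: add.assoc mult.assoc)
qed

end

lemma quartic_has_vector_derivative: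
  fixes c0 c1 c2 c3 c4 :: complex
  shows "((\<lambda>t. c0 + of_real t * c1 + of_real (t\<^sup>2) * c2 + of_real (t ^ 3) * c3 + of_real (t ^ 4) * c4)
    has_vector_derivative c1) (at 0)"
proof -
  have "((\<lambda>t. c0 + of_real t * c1 + of_real (t\<^sup>2) * c2 + of_real (t ^ 3) * c3 + of_real (t ^ 4) * c4)
    has_vector_derivative 0 + of_real 1 * c1 + of_real 0 * c2 + of_real 0 * c3 + of_real 0 * c4) (at 0)"
    by (intro has_vector_derivative_add has_vector_derivative_const has_vector_derivative_mult_left
        has_vector_derivative_of_real) (auto intro!: derivative_eq_intros)
  then show ?thesis by simp
qed


subsection \<open>The Yang--Mills connections\<close>

locale qhm_framed = qhm_perturbed c \<mu> \<nu> g1 g2 H + qhm_frame c \<mu> \<nu> N fr gr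
  for c :: int and \<mu> \<nu> :: real and g1 g2 :: "real \<Rightarrow> real" and H :: "heis \<Rightarrow> alg"
    and N :: nat and fr gr :: "nat \<Rightarrow> vec"
begin

text \<open>The scalar of the curvature operator. It is the conjugate of the value of the curvature
  in the algebra, whence the sign.\<close>

definition curv_const :: "heis \<Rightarrow> heis \<Rightarrow> complex" where
  "curv_const W W' = - of_real (fst (snd W) * snd (snd W') - fst (snd W') * snd (snd W)) * (of_real pi * \<i> / of_real \<mu>)"

lemma curvature_op_sc: "\<xi> \<in> Xi \<Longrightarrow> curvature_op c nab W W' \<xi> = (\<lambda>m. curv_const W W' * \<xi> m)"
  by (cases W; cases W') (simp add: curvature_op_nab curv_const_def)

lemma curvature_nab: "curvature c \<mu> \<nu> nab W W' = (\<lambda>m p. cnj (curv_const W W') * Id_E m p)"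
  using curvature_eq_el[OF mod_op_cmult[OF mod_op_id] curvature_op_sc] el_scalar by simp

lemma sc_basis: "curv_const X Y = 0" "curv_const X Z = 0" "curv_const Y Z = - (of_real pi * \<i> / of_real \<mu>)"
  by (simp_all add: curv_const_def X_def Y_def Z_def)

lemma conn_op_nab: "conn_op (nab W)"
  by (rule compatible_conn_op[OF compatible_nab])

lemma critical: "YM_critical c \<mu> \<nu> nab"
  unfolding YM_critical_def
proof (intro allI impI)
  fix F assume F: "linear_into (E_skew c \<mu> \<nu>) F"
  define A where "A = (\<lambda>W. act_E (F W))"
  define D where "D = (\<lambda>t::real. conn_add nab (\<lambda>W m p. of_real t * F W m p))"
  have A: "mod_op (A W)" for W
    using F E_smooth_mod_op unfolding A_def linear_into_def E_skew_def by blast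
  note Al = mod_op_lin[OF A] and Dl = conn_op_lin[OF conn_op_nab]
  note X = lin_opD(1)[OF Al] lin_opD(1)[OF Dl]
  have Dt: "D t W \<xi> = (\<lambda>m. nab W \<xi> m + of_real t * A W \<xi> m)" for t W \<xi>
    unfolding D_def A_def conn_add_def[of nab] by (simp add: act_E_cmult_alg)
  \<comment> \<open>T1 and T2 are the coefficients of t and t^2 in the curvature of the varied
    connection.\<close>
  define T1 where "T1 = (\<lambda>W W' \<xi> m. (nab W (A W' \<xi>) m - A W' (nab W \<xi>) m)
      - (nab W' (A W \<xi>) m - A W (nab W' \<xi>) m) - A (bracket c W W') \<xi> m)"
  define T2 where "T2 = (\<lambda>W W' \<xi> m. A W (A W' \<xi>) m - A W' (A W \<xi>) m)"
  note c1 = mod_op_commutator[OF conn_op_nab A]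
  have T1: "mod_op (T1 W W')" for W W'
    unfolding T1_def by (rule mod_op_diff[OF mod_op_diff[OF c1 c1] A])
  have T2: "mod_op (T2 W W')" for W W'
    unfolding T2_def by (rule mod_op_diff[OF mod_op_comp[OF A A] mod_op_comp[OF A A]])
  define T where "T = (\<lambda>W W' t \<xi> m. curv_const W W' * \<xi> m + of_real t * T1 W W' \<xi> m + of_real (t\<^sup>2) * T2 W W' \<xi> m)"
  have T: "mod_op (T W W' t)" for W W' t
    unfolding T_def by (intro mod_op_add mod_op_cmult mod_op_id T1 T2)
  have "curvature_op c (D t) W W' \<xi> = T W W' t \<xi>" if \<xi>: "\<xi> \<in> Xi" for t W W' \<xi>
  proof -
    have 1: "nab W (\<lambda>m. nab W' \<xi> m + of_real t * A W' \<xi> m) = (\<lambda>m. nab W (nab W' \<xi>) m + of_real t * nab W (A W' \<xi>) m)" for W W'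
      by (simp add: lin_opD(2,3)[OF Dl] \<xi> X Xi_cmult)
    have 2: "A W (\<lambda>m. nab W' \<xi> m + of_real t * A W' \<xi> m) = (\<lambda>m. A W (nab W' \<xi>) m + of_real t * A W (A W' \<xi>) m)" for W W'
      by (simp add: lin_opD(2,3)[OF Al] \<xi> X Xi_cmult)
    have "curvature_op c (D t) W W' \<xi> = (\<lambda>m. curvature_op c nab W W' \<xi> m + of_real t * T1 W W' \<xi> m + of_real (t\<^sup>2) * T2 W W' \<xi> m)"
      by (simp only: curvature_op_def Dt 1 2 T1_def T2_def fun_eq_iff, simp add: algebra_simps power2_eq_square)
    then show ?thesis by (simp add: curvature_op_sc[OF \<xi>] T_def)
  qed
  then have curv: "curvature c \<mu> \<nu> (D t) W W' = op_elem (T W W' t)" for t W W'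
    by (intro curvature_eq_el T)
  have YM: "YM c \<mu> \<nu> (D t) = - (Tr (\<lambda>\<xi>. T X Y t (T X Y t \<xi>)) + Tr (\<lambda>\<xi>. T X Z t (T X Z t \<xi>))
      + Tr (\<lambda>\<xi>. T Y Z t (T Y Z t \<xi>)))" for t
    by (rule YM_op_elem[OF T T T curv curv curv])
  have der: "((\<lambda>t. Tr (\<lambda>\<xi>. T W W' t (T W W' t \<xi>))) has_vector_derivative 2 * cnj (curv_const W W') * Tr (T1 W W')) (at 0)" for W W'
  proof -
    obtain c0 c2 c3 c4 where "\<And>t. Tr (\<lambda>\<xi>. T W W' t (T W W' t \<xi>)) = c0 + of_real t * (2 * cnj (curv_const W W') * Tr (T1 W W'))
        + of_real (t\<^sup>2) * c2 + of_real (t ^ 3) * c3 + of_real (t ^ 4) * c4"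
      using Tr_quadratic[OF T1[of W W'] T2[of W W'], of "curv_const W W'"] unfolding T_def by blast
    then show ?thesis using quartic_has_vector_derivative by (simp only:)
  qed
  \<comment> \<open>For the other two pairs the curvature constant is already zero. Here the bracket
    vanishes, so T1 is a difference of two commutators.\<close>
  have "Tr (T1 Y Z) = 0"
  proof -
    have "bracket c Y Z = 0" by (simp add: Y_def Z_def zero_prod_def)
    moreover have "F 0 = (\<lambda>m p. 0)"
      using F linear_0 unfolding linear_into_def by blast
    moreover have "act_E (\<lambda>m p. 0) z = (\<lambda>m. 0)" for z using act_E_cmult_alg[of 0 "\<lambda>m p. 0" z] by simp
    ultimately have "T1 Y Z = (\<lambda>\<xi> m. (nab Y (A Z \<xi>) m - A Z (nab Y \<xi>) m) - (nab Z (A Y \<xi>) m - A Y (nab Z \<xi>) m))"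
      by (simp add: T1_def A_def)
    then show ?thesis
      by (simp add: Tr_diff mod_op_lin c1 Tr_commutator[OF conn_op_nab A])
  qed
  then have z: "2 * cnj (curv_const Y Z) * Tr (T1 Y Z) = 0" "2 * cnj (curv_const X Y) * Tr (T1 X Y) = 0" "2 * cnj (curv_const X Z) * Tr (T1 X Z) = 0"
    by (simp_all add: sc_basis)
  have "((\<lambda>t. Tr (\<lambda>\<xi>. T X Y t (T X Y t \<xi>)) + Tr (\<lambda>\<xi>. T X Z t (T X Z t \<xi>))
      + Tr (\<lambda>\<xi>. T Y Z t (T Y Z t \<xi>))) has_vector_derivative 0 + 0 + 0) (at 0)"
    by (intro has_vector_derivative_add der[of X Y, unfolded z] der[of X Z, unfolded z] der[of Y Z, unfolded z])
  then have "((\<lambda>t. - (Tr (\<lambda>\<xi>. T X Y t (T X Y t \<xi>)) + Tr (\<lambda>\<xi>. T X Z t (T X Z t \<xi>))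
      + Tr (\<lambda>\<xi>. T Y Z t (T Y Z t \<xi>)))) has_vector_derivative - (0 + 0 + 0)) (at 0)"
    by (rule has_vector_derivative_minus)
  then show "((\<lambda>t. YM c \<mu> \<nu> (conn_add nab (\<lambda>W m p. of_real t * F W m p))) has_vector_derivative 0) (at 0)"
    using YM unfolding D_def by simp
qed

text \<open>The trace of a constant curvature over \<open>(Y, Z)\<close> does not depend on the connection, and compatibility makes the
  other two constants imaginary.\<close>

lemma minimal:
  assumes D: "compatible_connection c \<mu> \<nu> D" and cc: "constant_curvature c \<mu> \<nu> D"
  shows "YM c \<mu> \<nu> nab \<le> YM c \<mu> \<nu> D"
proof -
  define F where "F = (\<lambda>W \<xi> m. D W \<xi> m - nab W \<xi> m)"
  have F: "mod_op (F W)" for W unfolding F_def by (rule compatible_diff_mod_op[OF compatible_nab D])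
  have DF: "D W \<xi> = (\<lambda>m. nab W \<xi> m + F W \<xi> m)" for W \<xi> by (simp add: F_def)
  note Dc = compatible_conn_op[OF D]
  note Fl = mod_op_lin[OF F] and Dl = conn_op_lin[OF Dc] and nl = conn_op_lin[OF conn_op_nab]
  note X = lin_opD(1)[OF Fl] lin_opD(1)[OF Dl] lin_opD(1)[OF nl]
  \<comment> \<open>One commutator is taken with the other connection and one with
    \<open>nab\<close>. This absorbs the quadratic term in F, so both corrections are of the form
    covered by \<open>Tr_commutator\<close>.\<close>
  define T where "T = (\<lambda>W W' \<xi> m. curv_const W W' * \<xi> m + (D W (F W' \<xi>) m - F W' (D W \<xi>) m)
      - (nab W' (F W \<xi>) m - F W (nab W' \<xi>) m) - F (bracket c W W') \<xi> m)"
  note com = mod_op_commutator[OF Dc F] mod_op_commutator[OF conn_op_nab F]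
  have T: "mod_op (T W W')" for W W'
    unfolding T_def
    by (rule mod_op_diff[OF mod_op_diff[OF mod_op_add[OF mod_op_cmult[OF mod_op_id] com(1)] com(2)] F])
  have op: "curvature_op c D W W' \<xi> = T W W' \<xi>" if \<xi>: "\<xi> \<in> Xi" for W W' \<xi>
  proof
    fix m
    have 1: "D W (D W' \<xi>) = (\<lambda>m. D W (nab W' \<xi>) m + D W (F W' \<xi>) m)" for W W'
      using lin_opD(2)[OF Dl[of W], of "nab W' \<xi>" "F W' \<xi>"] X \<xi> by (simp add: DF[of W' \<xi>])
    have 2: "D W (nab W' \<xi>) m = nab W (nab W' \<xi>) m + F W (nab W' \<xi>) m" for W W' by (simp add: F_def)
    have 3: "D W' (D W \<xi>) m = nab W' (nab W \<xi>) m + nab W' (F W \<xi>) m + F W' (D W \<xi>) m"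
    proof -
      have "nab W' (D W \<xi>) = (\<lambda>m. nab W' (nab W \<xi>) m + nab W' (F W \<xi>) m)"
        unfolding DF[of W \<xi>] by (rule lin_opD(2)[OF nl X(3)[OF \<xi>] X(1)[OF \<xi>]])
      then show ?thesis by (simp add: F_def)
    qed
    have "curvature_op c D W W' \<xi> m = curvature_op c nab W W' \<xi> m + (D W (F W' \<xi>) m - F W' (D W \<xi>) m)
      - (nab W' (F W \<xi>) m - F W (nab W' \<xi>) m) - F (bracket c W W') \<xi> m"
      unfolding curvature_op_def 1[of W W'] 2[of W W'] 3 DF[of "bracket c W W'" \<xi>] by simp
    then show "curvature_op c D W W' \<xi> m = T W W' \<xi> m"
      by (simp add: curvature_op_sc[OF \<xi>] T_def)
  qed
  have curv: "curvature c \<mu> \<nu> D W W' = op_elem (T W W')" for W W'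
    by (rule curvature_eq_el[OF T op])
  obtain a where a: "\<And>W W'. op_elem (T W W') = (\<lambda>m p. a W W' * Id_E m p)"
    using cc unfolding constant_curvature_def curv by metis
  have Ta: "T W W' \<xi> = (\<lambda>m. cnj (a W W') * \<xi> m)" if "\<xi> \<in> Xi" for W W' \<xi>
    using act_E_el[OF T that, of W W'] by (simp add: a act_E_Id)
  have TT: "Tr (\<lambda>\<xi>. T W W' (T W W' \<xi>)) = (a W W')\<^sup>2 * of_real (2 * \<bar>\<mu>\<bar>)" for W W'
  proof -
    have "Tr (\<lambda>\<xi>. T W W' (T W W' \<xi>)) = Tr (\<lambda>\<xi> m. (cnj (a W W') * cnj (a W W')) * \<xi> m)"
      by (rule Tr_cong) (simp add: Ta Xi_cmult mult.assoc)
    then show ?thesis by (simp add: Tr_cmult Tr_id power2_eq_square)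
  qed
  \<comment> \<open>Two applications of skewness reverse the order of the factors, so the curvature
    operator is skew for the pairing; for a scalar operator this means a = -
    \<open>cnj a\<close>.\<close>
  have imag: "Re (a W W') = 0" for W W'
  proof -
    have "a W W' * trace_pairing f g = - (cnj (a W W') * trace_pairing f g)" if f: "f \<in> Xi" and g: "g \<in> Xi" for f g
    proof -
      have sk: "trace_pairing (D W (D W' f)) g = trace_pairing f (D W' (D W g))" for W W'
        by (simp add: conn_op_skew[OF Dc] X f g)
      have "a W W' * trace_pairing f g = trace_pairing (T W W' f) g" by (simp add: Ta[OF f] BB_cmult_left)
      also have "\<dots> = trace_pairing (curvature_op c D W W' f) g" by (simp add: op[OF f])
      also have "\<dots> = trace_pairing (D W (D W' f)) g - trace_pairing (D W' (D W f)) g - trace_pairing (D (bracket c W W') f) g"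
        unfolding curvature_op_def by (simp add: BB_diff_left Xi_diff X f g)
      also have "\<dots> = trace_pairing f (D W' (D W g)) - trace_pairing f (D W (D W' g)) + trace_pairing f (D (bracket c W W') g)"
        by (simp add: sk conn_op_skew[OF Dc] f g)
      also have "\<dots> = - trace_pairing f (curvature_op c D W W' g)"
        unfolding curvature_op_def by (simp add: BB_diff_right Xi_diff X f g)
      also have "\<dots> = - (cnj (a W W') * trace_pairing f g)" by (simp add: op[OF g] Ta[OF g] BB_cmult_right)
      finally show ?thesis .
    qed
    \<comment> \<open>A single pairing may vanish. Summed over the frame the pairings give the trace
      2|\<mu>| of the identity, by which one can divide.\<close>
    then have "(\<Sum>i<N. a W W' * trace_pairing (fr i) (gr i)) = (\<Sum>i<N. - (cnj (a W W') * trace_pairing (fr i) (gr i)))"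
      using fr gr by (intro sum.cong refl) simp
    then have "a W W' * of_real (2 * \<bar>\<mu>\<bar>) = - (cnj (a W W') * of_real (2 * \<bar>\<mu>\<bar>))"
      unfolding sum_negf sum_distrib_left[symmetric] Tr_id[unfolded Tr_def] .
    then have "(a W W' + cnj (a W W')) * of_real (2 * \<bar>\<mu>\<bar>) = 0"
      unfolding distrib_right by (simp only: left_minus)
    then show ?thesis using mu by (simp add: complex_add_cnj)
  qed
  have YZ: "a Y Z = of_real pi * \<i> / of_real \<mu>"
  proof -
    have F0: "F 0 \<xi> m = 0" if "\<xi> \<in> Xi" for \<xi> m
    proof -
      have "linear (\<lambda>W. D W \<xi> m)" "linear (\<lambda>W. nab W \<xi> m)"
        by (rule compatible_linear[OF D that], rule compatible_linear[OF compatible_nab that])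
      from linear_0[OF this(1)] linear_0[OF this(2)] show ?thesis by (simp add: F_def)
    qed
    have "bracket c Y Z = 0" by (simp add: Y_def Z_def zero_prod_def)
    then have "Tr (T Y Z) = Tr (\<lambda>\<xi> m. curv_const Y Z * \<xi> m + (D Y (F Z \<xi>) m - F Z (D Y \<xi>) m)
      - (nab Z (F Y \<xi>) m - F Y (nab Z \<xi>) m))"
      by (intro Tr_cong) (simp add: T_def F0)
    also have "\<dots> = cnj (curv_const Y Z) * of_real (2 * \<bar>\<mu>\<bar>)"
      by (simp add: Tr_diff Tr_add Tr_cmult Tr_id mod_op_lin mod_op_add mod_op_cmult mod_op_id com
          Tr_commutator[OF Dc F] Tr_commutator[OF conn_op_nab F])
    also have "Tr (T Y Z) = Tr (\<lambda>\<xi> m. cnj (a Y Z) * \<xi> m)" by (rule Tr_cong) (rule Ta)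
    finally have "a Y Z * of_real (2 * \<bar>\<mu>\<bar>) = cnj (curv_const Y Z) * of_real (2 * \<bar>\<mu>\<bar>)"
      by (simp add: Tr_cmult Tr_id)
    then have "a Y Z = cnj (curv_const Y Z)"
      unfolding mult_cancel_right of_real_eq_0_iff using mu by simp
    then show ?thesis by (simp add: sc_basis)
  qed
  have YMD: "YM c \<mu> \<nu> D = - ((a X Y)\<^sup>2 + (a X Z)\<^sup>2 + (a Y Z)\<^sup>2) * of_real (2 * \<bar>\<mu>\<bar>)"
    using YM_op_elem[OF T T T curv curv curv] by (simp add: TT algebra_simps)
  have el_sc: "curvature c \<mu> \<nu> nab W W' = op_elem (\<lambda>\<xi> m. curv_const W W' * \<xi> m)" for W W'
    by (simp add: curvature_nab el_scalar)
  have YMn: "YM c \<mu> \<nu> nab = - (of_real pi * \<i> / of_real \<mu>)\<^sup>2 * of_real (2 * \<bar>\<mu>\<bar>)"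
  proof -
    have tr: "Tr (\<lambda>\<xi> m. s * (s * \<xi> m)) = (cnj s)\<^sup>2 * of_real (2 * \<bar>\<mu>\<bar>)" for s
      using Tr_cmult[of "s * s" "\<lambda>\<xi>. \<xi>"] by (simp add: Tr_id power2_eq_square mult.assoc)
    show ?thesis
      unfolding YM_op_elem[OF mod_op_cmult[OF mod_op_id] mod_op_cmult[OF mod_op_id] mod_op_cmult[OF mod_op_id] el_sc el_sc el_sc] tr
      by (simp add: sc_basis)
  qed
  have sq: "z\<^sup>2 = - of_real ((Im z)\<^sup>2)" if "Re z = 0" for z :: complex
    using that by (simp add: complex_eq_iff power2_eq_square)
  have "YM c \<mu> \<nu> D = YM c \<mu> \<nu> nab + of_real (((Im (a X Y))\<^sup>2 + (Im (a X Z))\<^sup>2) * (2 * \<bar>\<mu>\<bar>))"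
    unfolding YMD YMn YZ sq[OF imag[of X Y]] sq[OF imag[of X Z]] by (simp add: algebra_simps)
  then show ?thesis by (simp add: less_eq_complex_def)
qed

end

theorem theorem4p8:
  fixes c :: int and \<mu> \<nu> :: real and g1 g2 :: "real \<Rightarrow> real" and H :: "heis \<Rightarrow> alg"
  assumes "c \<ge> 1" and "\<mu> \<noteq> 0" and "\<nu> \<noteq> 0"
    and "\<And>y. g1 (y + 1) = g1 y"
    and "\<And>y. g1 differentiable (at y)" and "\<And>x. g2 differentiable (at x)"
    and "\<And>y (p::int). g1 y = g1 (y - 2 * of_int p * \<nu>)"
    and "\<And>x (p::int). g2 x = g2 (x - 2 * of_int p * \<mu>)"
    and "linear_into (E_skew c \<mu> \<nu>) H"
    and "H X = (\<lambda>(x, y) p. \<i> * of_real (g1 y) * delta0 p)"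
    and "H Y = (\<lambda>(x, y) p. \<i> * of_real (g2 x) * delta0 p)"
    and "H Z = (\<lambda>(x, y) p. 0)"
  shows "(compatible_connection c \<mu> \<nu> (conn_add (nabla0 c \<mu>) H) \<and>
          constant_curvature c \<mu> \<nu> (conn_add (nabla0 c \<mu>) H) \<and>
          curvature c \<mu> \<nu> (conn_add (nabla0 c \<mu>) H) X Y = (\<lambda>m p. 0) \<and>
          curvature c \<mu> \<nu> (conn_add (nabla0 c \<mu>) H) X Z = (\<lambda>m p. 0) \<and>
          curvature c \<mu> \<nu> (conn_add (nabla0 c \<mu>) H) Y Z
            = (\<lambda>m p. of_real pi * \<i> / of_real \<mu> * Id_E m p)) \<and>
         YM_connection_constant_curvature c \<mu> \<nu> (conn_add (nabla0 c \<mu>) H)"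
proof -
  interpret qhm_perturbed c \<mu> \<nu> g1 g2 H
    by unfold_locales (fact assms)+
  obtain N :: nat and fr gr where fr: "\<And>i. i < N \<Longrightarrow> fr i \<in> Xi" "\<And>i. i < N \<Longrightarrow> gr i \<in> Xi"
      "\<And>m p. (\<Sum>i<N. ip_E c \<mu> \<nu> (fr i) (gr i) m p) = Id_E m p"
    using frame_exists by blast
  interpret qhm_framed c \<mu> \<nu> g1 g2 H N fr gr
    by unfold_locales (fact fr)+
  have "constant_curvature c \<mu> \<nu> nab"
    unfolding constant_curvature_def curvature_nab by blast
  then show ?thesis
    unfolding YM_connection_constant_curvature_def
    using compatible_nab critical minimal by (auto simp: curvature_nab sc_basis)
qed

end
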